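(* Let $Q$ be a nonzero quadratic form on $\mathbb{F}_{q_1}/\mathbb{F}_q$ with rank $r_Q$, and let $\mathcal{C}_{Q,N}'$ be the $\mathbb{F}_p$-linear code obtained by descending $\mathcal{C}_Q'$ (as described in the context). For each $r$ with $1\le r\le m(m_2+2)$: (1) if $r_Q$ is even and $\epsilon=1$, then $d_r(\mathcal{C}_{Q,N}')=\frac{q^M(q-1)}{p^rN}(p^r-1)(1-q^{-r_Q/2})$ for $1\le r\le m$; $d_r(\mathcal{C}_{Q,N}')=\frac{q^M(q-1)}{p^rN}\bigl(p^r-1-q^{-r_Q/2}(q-1)\bigr)$ for $m<r\le m(m_2+1)$; $d_r(\mathcal{C}_{Q,N}')=\frac{q^M}{p^rN}\bigl(p^r(q-1)-(q-p^{r-m(m_2+1)})(1+q^{-r_Q/2}(q-1))\bigr)$ for $r>m(m_2+1)$; (2) if $r_Q$ is even and $\epsilon=-1$, then $d_r(\mathcal{C}_{Q,N}')=\frac{q^M}{p^rN}(p^r-1)(q-1-q^{-r_Q/2})$ for $1\le r\le m$; $d_r(\mathcal{C}_{Q,N}')=\frac{q^M(q-1)}{p^rN}(p^r-1-q^{-r_Q/2})$ for $m<r\le m(m_2+1)$; $d_r(\mathcal{C}_{Q,N}')=\frac{q^M}{p^rN}\bigl(p^r(q-1)-(q-p^{r-m(m_2+1)})(1+q^{-r_Q/2})\bigr)$ for $r>m(m_2+1)$; (3) if $r_Q$ is odd, then $d_r(\mathcal{C}_{Q,N}')=\frac{q^M}{p^rN}(p^r-1)(q-1-q^{(1-r_Q)/2})$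 for $1\le r\le m$; $d_r(\mathcal{C}_{Q,N}')=\frac{q^M(q-1)}{p^rN}(p^r-1-q^{(1-r_Q)/2})$ for $m<r\le m(m_2+1)$; $d_r(\mathcal{C}_{Q,N}')=\frac{q^M}{p^rN}\bigl(p^r(q-1)-(q-p^{r-m(m_2+1)})(1+q^{(1-r_Q)/2})\bigr)$ for $r>m(m_2+1)$.
   Context: Let $p$ be an odd prime, $m\ge1$, $q=p^m$. Let $m_1,m_2$ be positive integers, $M=m_1+m_2$, $q_i=q^{m_i}$, $\mathbb{F}=\mathbb{F}_{q_1}\times\mathbb{F}_{q_2}$. $\mathrm{Tr}_{q^s/q}$ is the trace $\mathbb{F}_{q^s}\to\mathbb{F}_q$; $\eta$ is the quadratic character of $\mathbb{F}_q$ with $\eta(0)=0$. A quadratic form $Q$ on $\mathbb{F}_{q_1}/\mathbb{F}_q$ is a map $Q:\mathbb{F}_{q_1}\to\mathbb{F}_q$ with $Q(ax)=a^2Q(x)$ ($a\in\mathbb{F}_q$) such that $B_Q(x,y)=\frac12(Q(x+y)-Q(x)-Q(y))$ is $\mathbb{F}_q$-bilinear; rank $r_Q=m_1-\dim_{\mathbb{F}_q}\{x:B_Q(x,y)=0\ \forall y\}$; in suitable coordinates $Q=\sum_{i=1}^{r_Q}\lambda_ix_i^2$, $\lambda_i\in\mathbb{F}_q^*$, $\varepsilon_Q=\eta(\lambda_1\cdots\lambda_{r_Q})$. $\epsilon=\varepsilon_Q(-1)^{(p-1)mr_Q/4}$ if $r_Q$ even, $\epsilon=\varepsilon_Q(-1)^{(p-1)m(r_Q+1)/4}$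 if $r_Q$ odd. Let $\mathcal{C}_Q'=\{(aQ(x)+\mathrm{Tr}_{q_2/q}(by)+c)_{(x,y)\in\mathbb{F}}:(a,b,c)\in\mathbb{F}_q\times\mathbb{F}_{q_2}\times\mathbb{F}_q\}$, of length $n'=q^M$. Let $N$ be a positive divisor of $p-1$ with $\gcd(N,\frac{q-1}{p-1})=1$, and $\theta$ a primitive $\frac{q-1}{N}$-th root of unity in $\mathbb{F}_q$. For $\gamma\in\mathbb{F}_q$ let $\psi_\gamma=(\mathrm{Tr}_{q/p}(\gamma\theta^i))_{0\le i<\frac{q-1}{N}}\in\mathbb{F}_p^{(q-1)/N}$. Define $\mathcal{C}_{Q,N}'=\{(\psi_{c_1},\dots,\psi_{c_{n'}}):(c_1,\dots,c_{n'})\in\mathcal{C}_Q'\}\subseteq\mathbb{F}_p^{n'(q-1)/N}$ (concatenation). For a linear code $\mathcal{C}$ over $\mathbb{F}_p$ of dimension $k$ and $1\le r\le k$, $d_r(\mathcal{C})$ is the minimum of $\#\mathrm{Supp}(K)$ over $r$-dimensional $\mathbb{F}_p$-subspaces $K\subseteq\mathcal{C}$, where $\mathrm{Supp}(K)$ is the set of coordinates where some codeword of $K$ is nonzero. *)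

theory Defs
  imports Complex_Main "HOL-Library.Function_Algebras" "HOL-Library.Cardinality" "HOL-Computational_Algebra.Primes"
begin

definition is_field_hom :: "('k::field \<Rightarrow> 'l::field) \<Rightarrow> bool" where
  "is_field_hom h \<longleftrightarrow> h 1 = 1 \<and> (\<forall>x y. h (x + y) = h x + h y) \<and> (\<forall>x y. h (x * y) = h x * h y)"

definition trace_into :: "('k::field \<Rightarrow> 'l::field) \<Rightarrow> nat \<Rightarrow> nat \<Rightarrow> 'l \<Rightarrow> 'k" where
  "trace_into \<iota> Q s y = (THE c. \<iota> c = (\<Sum>i<s. y ^ (Q ^ i)))"

definition quad_char :: "'k::field \<Rightarrow> int" where
  "quad_char x = (if x = 0 then 0 else if (\<exists>y. y ^ 2 = x) then 1 else -1)"

definition ext_scale :: "('k::field \<Rightarrow> 'l::field) \<Rightarrow> 'k \<Rightarrow> 'l \<Rightarrow> 'l" where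
  "ext_scale \<iota> c x = \<iota> c * x"

definition bilin :: "('l \<Rightarrow> 'k::field) \<Rightarrow> 'l::field \<Rightarrow> 'l \<Rightarrow> 'k" where
  "bilin Q x y = (Q (x + y) - Q x - Q y) / 2"

definition is_quadratic_form :: "('k::field \<Rightarrow> 'l::field) \<Rightarrow> ('l \<Rightarrow> 'k) \<Rightarrow> bool" where
  "is_quadratic_form \<iota> Q \<longleftrightarrow>
     (\<forall>a x. Q (\<iota> a * x) = a ^ 2 * Q x) \<and>
     (\<forall>a x x' y. bilin Q (\<iota> a * x + x') y = a * bilin Q x y + bilin Q x' y) \<and>
     (\<forall>a x y y'. bilin Q x (\<iota> a * y + y') = a * bilin Q x y + bilin Q x y')"

definition rank_qf :: "('k::field \<Rightarrow> 'l::field) \<Rightarrow> ('l \<Rightarrow> 'k) \<Rightarrow> nat \<Rightarrow> nat" where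
  "rank_qf \<iota> Q m1 = m1 - vector_space.dim (ext_scale \<iota>) {x. \<forall>y. bilin Q x y = 0}"

definition is_diagonalization ::
    "('k::field \<Rightarrow> 'l::field) \<Rightarrow> ('l \<Rightarrow> 'k) \<Rightarrow> 'l list \<Rightarrow> 'k list \<Rightarrow> bool" where
  "is_diagonalization \<iota> Q es ls \<longleftrightarrow>
     length ls \<le> length es \<and> (\<forall>l\<in>set ls. l \<noteq> 0) \<and>
     bij_betw (\<lambda>c. \<Sum>i<length es. \<iota> (c i) * es ! i) {c. \<forall>i\<ge>length es. c i = 0} UNIV \<and>
     (\<forall>c. Q (\<Sum>i<length es. \<iota> (c i) * es ! i) = (\<Sum>i<length ls. ls ! i * (c i) ^ 2))"

text \<open>epsilon_Q = eta(lambda_1 ... lambda_r) for a diagonalisation (well defined).\<close>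
definition eps_Q :: "('k::field \<Rightarrow> 'l::field) \<Rightarrow> ('l \<Rightarrow> 'k) \<Rightarrow> int" where
  "eps_Q \<iota> Q = (SOME e. \<exists>es ls. is_diagonalization \<iota> Q es ls \<and> e = quad_char (prod_list ls))"

definition eps_sign :: "('k::field \<Rightarrow> 'l::field) \<Rightarrow> ('l \<Rightarrow> 'k) \<Rightarrow> nat \<Rightarrow> nat \<Rightarrow> nat \<Rightarrow> int" where
  "eps_sign \<iota> Q p m m1 =
     (let r = rank_qf \<iota> Q m1 in
      eps_Q \<iota> Q * (-1) ^ (if even r then (p - 1) * m * r div 4 else (p - 1) * m * (r + 1) div 4))"

definition fscale :: "'p::field \<Rightarrow> ('i \<Rightarrow> 'p) \<Rightarrow> ('i \<Rightarrow> 'p)" where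
  "fscale c v = (\<lambda>j. c * v j)"

definition supp_set :: "('i \<Rightarrow> 'p::zero) set \<Rightarrow> 'i set" where
  "supp_set K = {j. \<exists>v\<in>K. v j \<noteq> 0}"

definition gen_weight :: "('i \<Rightarrow> 'p::field) set \<Rightarrow> nat \<Rightarrow> nat" where
  "gen_weight C r = Min {card (supp_set K) | K. K \<subseteq> C \<and> module.subspace fscale K \<and>
                                             vector_space.dim fscale K = r}"

text \<open>The descended code C'_{Q,N}. Coordinates are indexed by ((x,y),i) with
  (x,y) in F_{q1} x F_{q2} and 0 <= i < (q-1)/N; codewords vanish off this index set.\<close>
definition code_QN ::
  "('p::field \<Rightarrow> 'f::field) \<Rightarrow> ('f \<Rightarrow> 'a::field) \<Rightarrow> ('f \<Rightarrow> 'b::field) \<Rightarrow> ('a \<Rightarrow> 'f) \<Rightarrow>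
   nat \<Rightarrow> nat \<Rightarrow> nat \<Rightarrow> nat \<Rightarrow> 'f \<Rightarrow> ((('a \<times> 'b) \<times> nat) \<Rightarrow> 'p) set" where
  "code_QN \<iota>0 \<iota>1 \<iota>2 Q p m m2 N \<theta> =
     (\<lambda>(a, b, c). (\<lambda>((x, y), i).
        if i < (p ^ m - 1) div N
        then trace_into \<iota>0 p m ((a * Q x + trace_into \<iota>2 (p ^ m) m2 (b * y) + c) * \<theta> ^ i)
        else 0)) ` UNIV"

end

theory Submission
  imports Defs "HOL-Library.Product_Plus" "HOL-Library.FuncSet" "HOL-Computational_Algebra.Polynomial"
begin

text \<open>
  Two double counts reduce the support of a subcode \<open>K\<close> of dimension \<open>r\<close> to level sets of \<open>Q\<close>.
  First, every coordinate in the support of \<open>K\<close> is nonzero on \<open>(1 - 1/p) |K|\<close> codewords, so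
  the support is determined by the sum of the weights. Second, since \<open>gcd(N, (q-1)/(p-1)) = 1\<close>, the
  products of powers of \<open>\<theta>\<close> with nonzero elements of the prime field cover every nonzero element of
  \<open>F\<^sub>q\<close> equally often, so the weight of the codeword of \<open>(a, b, c)\<close> is a constant multiple of the number of
  points where \<open>a Q(x) + Tr(b y) + c\<close> does not vanish.

  That number depends on \<open>Q\<close> only if \<open>b = 0\<close>. Let \<open>G\<close> be the group of all \<open>(a, c)\<close> with \<open>(a, 0, c) \<in> K\<close>,
  let \<open>A = q\<^bsup>m\<^sub>1-1\<^esup>\<close> and \<open>e(t) = |{x. Q x = t}| - A\<close>. Then minimising the support means maximising
  the sum of \<open>e(-c/a)\<close> over \<open>(a, c) \<in> G\<close> with \<open>a \<noteq> 0\<close>, minus \<open>A (g\<^sub>0 - 1)\<close>, where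
  \<open>g\<^sub>0\<close> counts the elements of \<open>G\<close> with \<open>a = 0\<close>. If \<open>t\<close> maximises \<open>e\<close>, the optimum is attained by
  \<open>{(a, b, c - t a). a \<in> U, b \<in> B, c \<in> S}\<close> for subspaces \<open>U\<close>, \<open>B\<close>, \<open>S\<close> of suitable dimensions.
  The matching upper bounds are elementary for even rank. For odd rank \<open>e\<close> is a multiple
  of the quadratic character, and one compares the intersections of \<open>G\<close> with the lines through the origin.
\<close>

section \<open>Additive subgroups and the fibres of additive maps\<close>

definition add_subgroup :: "'a::ab_group_add set \<Rightarrow> bool" where
  "add_subgroup S \<longleftrightarrow> 0 \<in> S \<and> (\<forall>x\<in>S. \<forall>y\<in>S. x - y \<in> S)"

lemma add_subgroup_zero: "add_subgroup S \<Longrightarrow> 0 \<in> S"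
  and add_subgroup_diff: "add_subgroup S \<Longrightarrow> x \<in> S \<Longrightarrow> y \<in> S \<Longrightarrow> x - y \<in> S"
  by (auto simp: add_subgroup_def)

lemma add_subgroup_add: "add_subgroup S \<Longrightarrow> x \<in> S \<Longrightarrow> y \<in> S \<Longrightarrow> x + y \<in> S"
  by (metis add_subgroup_zero add_subgroup_diff diff_0 diff_minus_eq_add)

text \<open>A nonempty fibre is a translate of the kernel, by any preimage \<open>z\<close> of
  \<open>v\<close>.\<close>

lemma card_additive_fibre:
  fixes f :: "'a::ab_group_add \<Rightarrow> 'b::ab_group_add"
  assumes S: "add_subgroup S"
    and f: "\<And>x y. x \<in> S \<Longrightarrow> y \<in> S \<Longrightarrow> f (x - y) = f x - f y"
    and v: "v \<in> f ` S"
  shows "card {x\<in>S. f x = v} = card {x\<in>S. f x = 0}"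
proof -
  obtain z where z: "z \<in> S" "f z = v" using v by auto
  have add: "x + z \<in> S \<and> f (x + z) = f x + v" if "x \<in> S" for x
    using f[OF add_subgroup_add[OF S that z(1)] z(1)] z add_subgroup_add[OF S that z(1)]
    by (simp add: algebra_simps)
  have diff: "x - z \<in> S \<and> f (x - z) = f x - v" if "x \<in> S" for x
    using f[OF that z(1)] z add_subgroup_diff[OF S that z(1)] by simp
  have "card {x\<in>S. f x = v} = card ((\<lambda>x. x + z) ` {x\<in>S. f x = 0})"
  proof (rule arg_cong[where f = card], intro equalityI subsetI)
    fix y assume "y \<in> {x\<in>S. f x = v}"
    then have "y - z \<in> {x\<in>S. f x = 0}" using diff by simp
    then show "y \<in> (\<lambda>x. x + z) ` {x\<in>S. f x = 0}"
      by (intro image_eqI[of _ _ "y - z"]) simp_all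
  next
    fix y assume "y \<in> (\<lambda>x. x + z) ` {x\<in>S. f x = 0}"
    then obtain x where "x \<in> S" "f x = 0" "y = x + z" by blast
    then show "y \<in> {x\<in>S. f x = v}" using add[of x] by simp
  qed
  also have "\<dots> = card {x\<in>S. f x = 0}"
    by (rule card_image) (simp add: inj_on_def)
  finally show ?thesis .
qed

text \<open>The nonempty fibres partition \<open>S\<close>, and each is as large as the
  kernel.\<close>

lemma card_additive_image:
  fixes f :: "'a::ab_group_add \<Rightarrow> 'b::ab_group_add"
  assumes S: "add_subgroup S" and fin: "finite S"
    and f: "\<And>x y. x \<in> S \<Longrightarrow> y \<in> S \<Longrightarrow> f (x - y) = f x - f y"
  shows "card S = card (f ` S) * card {x\<in>S. f x = 0}"
proof -
  have "card S = (\<Sum>v\<in>f ` S. card {x\<in>S. f x = v})"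
    using fin sum.image_gen[of S "\<lambda>_. 1::nat" f] by simp
  also have "\<dots> = (\<Sum>v\<in>f ` S. card {x\<in>S. f x = 0})"
    by (rule sum.cong) (use card_additive_fibre[OF S f] in auto)
  finally show ?thesis by simp
qed

lemma add_subgroup_UNIV: "add_subgroup UNIV"
  by (simp add: add_subgroup_def)

lemma card_additive_UNIV:
  fixes f :: "'a::{ab_group_add,finite} \<Rightarrow> 'b::{ab_group_add,finite}"
  assumes f: "\<And>x y. f (x - y) = f x - f y" and surj: "surj f"
  shows "CARD('a) = CARD('b) * card {x. f x = v}"
proof -
  have "card {x. f x = v} = card {x. f x = 0}"
    using card_additive_fibre[OF add_subgroup_UNIV, of f v] f surj by simp
  then show ?thesis
    using card_additive_image[OF add_subgroup_UNIV, of f] f surj by simp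
qed

section \<open>Finite fields and field homomorphisms\<close>

lemma power_card_same:
  fixes x :: "'a::{field,finite}"
  shows "x ^ CARD('a) = x"
proof (cases "x = 0")
  case False
  have C: "Suc (CARD('a) - 1) = CARD('a)"
    using finite_UNIV_card_ge_0[where ?'a = 'a] by simp
  \<comment> \<open>Multiplication by \<open>x\<close> permutes the nonzero elements, so the
    products with and without the factors \<open>x\<close> agree and cancel. The extra
    \<open>x\<close> in front turns the exponent into the full cardinality.\<close>
  have "x * (\<Prod>y\<in>UNIV-{0}. x * y) = x * x ^ (CARD('a) - 1) * \<Prod>(UNIV-{0})"
    by (simp add: prod.distrib mult_ac)
  also have "x * x ^ (CARD('a) - 1) = x ^ CARD('a)"
    using C by (metis power_Suc)
  also have "(\<Prod>y\<in>UNIV-{0}. x * y) = (\<Prod>y\<in>UNIV-{0}. y)"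
    by (rule prod.reindex_bij_witness[of _ "\<lambda>y. y / x" "\<lambda>y. x * y"]) (use False in auto)
  finally show ?thesis
    by simp
qed (use finite_UNIV_card_ge_0[where ?'a = 'a] in auto)

lemma power_card_pred:
  fixes x :: "'a::{field,finite}"
  assumes "x \<noteq> 0"
  shows "x ^ (CARD('a) - 1) = 1"
proof -
  have "x * x ^ (CARD('a) - 1) = x * 1"
    using power_card_same[of x] by (simp flip: power_Suc)
  then show ?thesis using assms by simp
qed

text \<open>Translation by 1 permutes the field, so the number of elements is zero in it. Hence the
  characteristic, which is prime, divides \<open>p ^ n\<close>.\<close>

lemma CHAR_of_card:
  assumes "prime p" and card: "CARD('a::{field,finite}) = p ^ n"
  shows "CHAR('a) = p"
proof -
  have "(\<Sum>x\<in>(UNIV::'a set). x + 1) = (\<Sum>x\<in>(UNIV::'a set). x)"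
    by (rule sum.reindex_bij_witness[of _ "\<lambda>x. x - 1" "\<lambda>x. x + 1"]) auto
  then have "(of_nat (p ^ n) :: 'a) = 0"
    by (simp add: sum.distrib flip: card)
  then have dvd: "CHAR('a) dvd p ^ n"
    by (simp only: of_nat_eq_0_iff_char_dvd)
  have "CHAR('a) > 0"
    using finite_imp_CHAR_pos[where ?'a='a] by simp
  then have "prime CHAR('a)"
    by (rule prime_CHAR_semidom)
  with dvd \<open>prime p\<close> show ?thesis
    by (metis prime_dvd_power primes_dvd_imp_eq)
qed

lemma card_roots_of_power:
  fixes a :: "'a::{field,finite}"
  assumes "n > 0"
  shows "card {x. x ^ n = a} \<le> n"
proof -
  let ?P = "monom 1 n + [:-a:] :: 'a poly"
  have deg: "degree ?P = n"
    using assms by (subst degree_add_eq_left) (auto simp: degree_monom_eq)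
  then have "?P \<noteq> 0" using assms by (metis degree_0 less_irrefl)
  from card_poly_roots_bound[OF this] deg show ?thesis
    by (simp add: poly_monom)
qed

context
  fixes \<iota> :: "'k::field \<Rightarrow> 'l::field"
  assumes hom: "is_field_hom \<iota>"
begin

lemma field_hom_add: "\<iota> (x + y) = \<iota> x + \<iota> y"
  and field_hom_mult: "\<iota> (x * y) = \<iota> x * \<iota> y"
  and field_hom_one: "\<iota> 1 = 1"
  using hom by (auto simp: is_field_hom_def)

lemma field_hom_zero: "\<iota> 0 = 0"
  using field_hom_add[of 0 0] by (metis add.right_neutral add_left_cancel)

lemma field_hom_diff: "\<iota> (x - y) = \<iota> x - \<iota> y"
  using field_hom_add[of "x - y" y] by simp

lemma field_hom_eq_0_iff: "\<iota> x = 0 \<longleftrightarrow> x = 0"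
proof
  assume x: "\<iota> x = 0"
  show "x = 0"
  proof (rule ccontr)
    assume "x \<noteq> 0"
    then have "\<iota> (x * inverse x) = 1" by (simp add: field_hom_one)
    then show False using x by (simp add: field_hom_mult)
  qed
qed (simp add: field_hom_zero)

lemma field_hom_inj: "inj \<iota>"
  by (rule injI) (metis eq_iff_diff_eq_0 field_hom_diff field_hom_eq_0_iff)

lemma field_hom_power: "\<iota> (x ^ n) = \<iota> x ^ n"
  by (induction n) (simp_all add: field_hom_one field_hom_mult)

lemma is_field_hom_comp:
  assumes "is_field_hom \<kappa>"
  shows "is_field_hom (\<kappa> \<circ> \<iota>)"
  using hom assms by (simp add: is_field_hom_def)

end

subsection \<open>Traces\<close>

text \<open>The base field has \<open>p ^ n\<close> elements so that both traces are covered: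
  \<open>n = 1\<close>, \<open>s = m\<close> for the descent to the prime field, and
  \<open>n = m\<close>, \<open>s = m2\<close> for the trace inside the code.\<close>

locale trace_setup =
  fixes \<iota> :: "'k::{field,finite} \<Rightarrow> 'l::{field,finite}" and p n s :: nat
  assumes hom: "is_field_hom \<iota>" and prime: "prime p"
    and cardk: "CARD('k) = p ^ n" and cardl: "CARD('l) = (p ^ n) ^ s" and s: "s > 0"
begin

abbreviation Tr :: "'l \<Rightarrow> 'k" where "Tr \<equiv> trace_into \<iota> (p ^ n) s"

definition trsum :: "'l \<Rightarrow> 'l" where "trsum y = (\<Sum>i<s. y ^ ((p ^ n) ^ i))"

lemma card_k_gt_1: "p ^ n > 1"
proof -
  have "card {0, 1 :: 'k} \<le> CARD('k)" by (intro card_mono) auto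
  then show ?thesis by (simp add: cardk)
qed

lemma frobenius_add: "(x + y :: 'l) ^ ((p ^ n) ^ i) = x ^ ((p ^ n) ^ i) + y ^ ((p ^ n) ^ i)"
proof -
  have C: "CHAR('l) = p"
    using CHAR_of_card[OF prime, of "n * s", where ?'a='l] by (simp add: cardl power_mult)
  show ?thesis
    by (rule freshmans_dream'[where n = "n * i"]) (simp_all add: C prime power_mult)
qed

text \<open>The base field consists of roots of \<open>X ^ (p ^ n) - X\<close> by Fermat, and this
  polynomial has no room for further roots.\<close>

lemma range_hom: "range \<iota> = {x. x ^ (p ^ n) = x}"
proof (rule card_subset_eq)
  show "finite {x :: 'l. x ^ (p ^ n) = x}" by simp
  show sub: "range \<iota> \<subseteq> {x. x ^ (p ^ n) = x}"
    using power_card_same[where 'a='k] by (auto simp: field_hom_power[OF hom, symmetric] simp flip: cardk)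
  let ?P = "monom 1 (p ^ n) + [:0, -1:] :: 'l poly"
  have deg: "degree ?P = p ^ n"
    using card_k_gt_1 by (subst degree_add_eq_left) (auto simp: degree_monom_eq)
  then have "?P \<noteq> 0" using card_k_gt_1 by (metis degree_0 not_one_less_zero)
  from card_poly_roots_bound[OF this] deg
  have "card {x :: 'l. x ^ (p ^ n) = x} \<le> p ^ n" by (simp add: poly_monom)
  moreover have "card (range \<iota>) = p ^ n"
    using card_image[OF field_hom_inj[OF hom]] cardk by simp
  ultimately show "card (range \<iota>) = card {x :: 'l. x ^ (p ^ n) = x}"
    using card_mono[OF finite sub] by linarith
qed

text \<open>The Frobenius map shifts the exponents by one step, and the new last term is
  \<open>y\<close> again. So the sum is fixed and lies in the base field by
  \<open>range_hom\<close>.\<close>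

lemma trsum_in_range: "trsum y \<in> range \<iota>"
proof -
  have "trsum y ^ (p ^ n) = (\<Sum>i<s. y ^ ((p ^ n) ^ Suc i))"
  proof -
    have "(\<Sum>i<t. y ^ ((p ^ n) ^ i)) ^ (p ^ n) = (\<Sum>i<t. y ^ ((p ^ n) ^ Suc i))" for t
    proof (induction t)
      case 0
      then show ?case using card_k_gt_1 prime_gt_0_nat[OF prime] by (simp add: power_0_left)
    next
      case (Suc t)
      then show ?case
        using frobenius_add[of _ _ 1] by (simp add: mult.commute flip: power_mult)
    qed
    then show ?thesis by (simp add: trsum_def)
  qed
  also have "\<dots> = (\<Sum>i<Suc s. y ^ ((p ^ n) ^ i)) - y"
    by (subst sum.lessThan_Suc_shift) simp
  also have "\<dots> = trsum y + y ^ ((p ^ n) ^ s) - y"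
    by (simp add: trsum_def)
  also have "y ^ ((p ^ n) ^ s) = y"
    using power_card_same[of y] by (simp add: cardl)
  finally show ?thesis by (simp add: range_hom)
qed

lemma hom_trace: "\<iota> (Tr y) = trsum y"
proof -
  obtain c where c: "\<iota> c = trsum y" using trsum_in_range by (metis imageE)
  have "trace_into \<iota> (p ^ n) s y = c"
    unfolding trace_into_def trsum_def[symmetric] c[symmetric]
    by (rule the_equality) (use field_hom_inj[OF hom] in \<open>auto dest: injD\<close>)
  then show ?thesis using c by simp
qed

lemma trace_add: "Tr (x + y) = Tr x + Tr y"
proof -
  have "\<iota> (Tr (x + y)) = \<iota> (Tr x + Tr y)"
    unfolding field_hom_add[OF hom] hom_trace
    by (simp add: trsum_def sum.distrib frobenius_add)
  then show ?thesis using field_hom_inj[OF hom] by (auto dest: injD)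
qed

lemma trace_scale: "Tr (\<iota> c * y) = c * Tr y"
proof -
  \<comment> \<open>Elements of the base field are fixed by Frobenius, so \<open>\<iota> c\<close>
    comes out of every term.\<close>
  have c: "\<iota> c ^ ((p ^ n) ^ i) = \<iota> c" for i
  proof (induction i)
    case (Suc i)
    have "\<iota> c ^ ((p ^ n) ^ Suc i) = (\<iota> c ^ ((p ^ n) ^ i)) ^ (p ^ n)"
      by (simp add: mult.commute flip: power_mult)
    also have "\<dots> = \<iota> (c ^ CARD('k))"
      by (simp add: Suc field_hom_power[OF hom] cardk)
    finally show ?case by (simp add: power_card_same)
  qed simp
  have "\<iota> (Tr (\<iota> c * y)) = \<iota> (c * Tr y)"
    unfolding field_hom_mult[OF hom] hom_trace
    by (simp add: trsum_def power_mult_distrib c sum_distrib_left)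
  then show ?thesis using field_hom_inj[OF hom] by (auto dest: injD)
qed

lemma trace_zero: "Tr 0 = 0"
  using trace_add[of 0 0] by (metis add.right_neutral add_left_cancel)

lemma trace_diff: "Tr (x - y) = Tr x - Tr y"
  using trace_add[of "x - y" y] by simp

text \<open>The trace is a polynomial function of degree at most \<open>(p ^ n) ^ (s - 1)\<close>
  with linear coefficient 1. Such a polynomial cannot vanish at all \<open>(p ^ n) ^ s\<close>
  elements.\<close>

lemma trace_nonzero: "\<exists>y. Tr y \<noteq> 0"
proof (rule ccontr)
  assume "\<not> ?thesis"
  then have 0: "trsum y = 0" for y
    by (simp add: field_hom_zero[OF hom] flip: hom_trace)
  let ?P = "(\<Sum>i<s. monom 1 ((p ^ n) ^ i)) :: 'l poly"
  have "coeff ?P 1 = (\<Sum>i<s. if i = 0 then 1 else 0)"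
    unfolding coeff_sum by (rule sum.cong) (use card_k_gt_1 in auto)
  also have "\<dots> = 1" using s by (simp add: sum.delta)
  finally have nz: "?P \<noteq> 0" by auto
  have "degree ?P \<le> (p ^ n) ^ (s - 1)"
  proof (rule degree_sum_le)
    fix i assume "i \<in> {..<s}"
    then have "(p ^ n) ^ i \<le> (p ^ n) ^ (s - 1)"
      using card_k_gt_1 by (intro power_increasing) auto
    then show "degree (monom (1::'l) ((p ^ n) ^ i)) \<le> (p ^ n) ^ (s - 1)"
      using degree_monom_le le_trans by blast
  qed simp
  moreover have "card {x. poly ?P x = 0} = (p ^ n) ^ s"
    using 0 by (simp add: poly_sum poly_monom trsum_def cardl)
  moreover have "(p ^ n) ^ (s - 1) < (p ^ n) ^ s"
    using card_k_gt_1 s by (intro power_strict_increasing) auto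
  ultimately show False
    using card_poly_roots_bound[OF nz] by linarith
qed

lemma surj_trace_mult:
  assumes "b \<noteq> 0"
  shows "surj (\<lambda>y. Tr (b * y))"
proof -
  obtain z where z: "Tr z \<noteq> 0" using trace_nonzero by auto
  have "Tr (b * (\<iota> (c / Tr z) * (z / b))) = c" for c
  proof -
    have "b * (\<iota> (c / Tr z) * (z / b)) = \<iota> (c / Tr z) * z" using assms by simp
    then show ?thesis using z by (simp add: trace_scale)
  qed
  then show ?thesis by (rule surjI)
qed

lemma card_trace_fibre:
  assumes "b \<noteq> 0"
  shows "p ^ n * card {y. Tr (b * y) = v} = CARD('l)"
proof -
  have "Tr (b * (x - y)) = Tr (b * x) - Tr (b * y)" for x y
    by (simp add: right_diff_distrib trace_diff)
  from card_additive_UNIV[OF this surj_trace_mult[OF assms], of v] show ?thesis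
    by (simp add: cardk)
qed

end

subsection \<open>The quadratic character\<close>

text \<open>This is the cardinality times the indicator of 0, minus 1; it sums to 0. Together with
  the quadratic character it describes the error terms of all level sets of
  \<open>Q\<close>.\<close>

definition zero_weight :: "'k::{field,finite} \<Rightarrow> int" where
  "zero_weight t = (if t = 0 then int CARD('k) - 1 else - 1)"

context
  fixes h :: nat
  assumes card_odd: "CARD('k::{field,finite}) = 2 * h + 1"
begin

lemma two_neq_zero: "(2::'k) \<noteq> 0"
proof
  assume 2: "(2::'k) = 0"
  have "(1::'k) + 1 = 0" using 2 by simp
  then have "CHAR('k) dvd 2"
    by (simp flip: of_nat_eq_0_iff_char_dvd)
  \<comment> \<open>The shift by 1 makes the number of elements zero in the field; being odd, it
    would be 1 if \<open>2 = 0\<close>.\<close>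
  moreover have "(\<Sum>x\<in>(UNIV::'k set). x + 1) = (\<Sum>x\<in>(UNIV::'k set). x)"
    by (rule sum.reindex_bij_witness[of _ "\<lambda>x. x - 1" "\<lambda>x. x + 1"]) auto
  then have "(of_nat CARD('k) :: 'k) = 0"
    by (simp add: sum.distrib)
  ultimately show False using 2 by (simp add: card_odd)
qed

lemma neg_eq_iff: "(- x = x) \<longleftrightarrow> x = (0::'k)"
proof
  assume "- x = x"
  then have "2 * x = 0" by (metis add.right_inverse mult_2)
  then show "x = 0" using two_neq_zero by simp
qed simp

lemma card_square_roots: "int (card {y. y ^ 2 = (x::'k)}) = 1 + quad_char x"
proof (cases "x \<noteq> 0 \<and> (\<exists>y. y ^ 2 = x)")
  case True
  then obtain y where y: "y ^ 2 = x" "y \<noteq> 0" by auto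
  then have "{z. z ^ 2 = x} = {y, - y}" by (auto simp: power2_eq_iff)
  moreover have "y \<noteq> - y" using y neg_eq_iff[of y] by metis
  ultimately show ?thesis using True by (simp add: quad_char_def)
qed (auto simp: quad_char_def)

text \<open>Every \<open>y\<close> is a square root of exactly one \<open>x\<close>, so
  \<open>1 + quad_char x\<close> sums to the number of elements.\<close>

lemma sum_quad_char: "(\<Sum>x\<in>UNIV. quad_char (x::'k)) = 0"
proof -
  have "(\<Sum>x\<in>UNIV. 1 + quad_char (x::'k)) = int (\<Sum>x\<in>(UNIV::'k set). card {y. y ^ 2 = x})"
    by (simp add: card_square_roots)
  also have "(\<Sum>x\<in>(UNIV::'k set). card {y. y ^ 2 = x}) = (\<Sum>x\<in>(UNIV::'k set). card {y\<in>UNIV. y ^ 2 = x})"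
    by simp
  also have "\<dots> = (\<Sum>y\<in>(UNIV::'k set). 1)"
    using sum.group[of "UNIV::'k set" "UNIV::'k set" "\<lambda>y. y ^ 2" "\<lambda>_. 1::nat"] by simp
  finally show ?thesis by (simp add: sum.distrib)
qed

text \<open>Euler's criterion. Nonzero squares are roots of \<open>X ^ h - 1\<close>. Since the
  character sums to 0, there are exactly \<open>h\<close> of them, so they are all the
  roots.\<close>

lemma power_half_eq_1_iff: "(x::'k) ^ h = 1 \<longleftrightarrow> quad_char x = 1"
proof -
  have h: "h > 0"
    using card_odd card_mono[of "UNIV :: 'k set" "{0, 1}"] by simp
  let ?S = "{x :: 'k. quad_char x = 1}" and ?N = "{x :: 'k. quad_char x = - 1}"
  have sub: "?S \<subseteq> {x. x ^ h = 1}"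
  proof
    fix x :: 'k assume "x \<in> ?S"
    then obtain y where y: "y ^ 2 = x" "y \<noteq> 0"
      by (auto simp: quad_char_def split: if_splits)
    then have "x ^ h = y ^ (CARD('k) - 1)" by (auto simp: card_odd simp flip: power_mult)
    then show "x \<in> {x. x ^ h = 1}" using power_card_pred[of y] y by simp
  qed
  have U: "(UNIV :: 'k set) = insert 0 (?S \<union> ?N)" by (auto simp: quad_char_def)
  have "2 * h + 1 = card (insert 0 (?S \<union> ?N))"
    using card_odd U by simp
  also have "\<dots> = 1 + (card ?S + card ?N)"
    by (subst card_insert_disjoint) (auto simp: quad_char_def card_Un_disjoint disjoint_iff)
  finally have "2 * h = card ?S + card ?N" by simp
  moreover have "int (card ?S) = int (card ?N)"
  proof -
    have "0 = (\<Sum>x\<in>insert 0 (?S \<union> ?N). quad_char x)"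
      using sum_quad_char U by simp
    also have "\<dots> = (\<Sum>x\<in>?S \<union> ?N. quad_char x)"
      by (subst sum.insert) (auto simp: quad_char_def)
    also have "\<dots> = (\<Sum>x\<in>?S. quad_char x) + (\<Sum>x\<in>?N. quad_char x)"
      by (rule sum.union_disjoint) auto
    finally show ?thesis by simp
  qed
  ultimately have "card ?S = h" by linarith
  then have "?S = {x. x ^ h = 1}"
    using card_roots_of_power[OF h, of "1::'k"] by (intro card_seteq sub) auto
  then show ?thesis by blast
qed

lemma power_half_cases: "x \<noteq> 0 \<Longrightarrow> (x::'k) ^ h = 1 \<or> x ^ h = - 1"
proof -
  assume "x \<noteq> 0"
  then have "(x ^ h) ^ 2 = 1"
    using power_card_pred[of x] card_odd by (simp add: mult.commute flip: power_mult)
  then show ?thesis by (simp add: power2_eq_1_iff)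
qed

lemma one_neq_minus_one: "(1::'k) \<noteq> - 1"
  using neg_eq_iff[of 1] by force

text \<open>By Euler's criterion the character of a nonzero \<open>x\<close> is
  \<open>x ^ h\<close>, read as an integer 1 or -1, and powers are multiplicative.\<close>

lemma quad_char_mult: "quad_char (x * y) = quad_char x * quad_char (y::'k)"
proof -
  consider "x = 0" | "y = 0" | "x \<noteq> 0" "y \<noteq> 0" by blast
  then show ?thesis
  proof cases
    case 3
    have qc: "quad_char z = (if z ^ h = 1 then 1 else - 1)" if "z \<noteq> 0" for z :: 'k
      using power_half_eq_1_iff[of z] that by (auto simp: quad_char_def)
    show ?thesis
      using power_half_cases[OF 3(1)] power_half_cases[OF 3(2)] one_neq_minus_one
      by (auto simp: qc 3 power_mult_distrib)
  qed (auto simp: quad_char_def)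
qed

lemma quad_char_cases: "x \<noteq> 0 \<Longrightarrow> quad_char (x::'k) = 1 \<or> quad_char x = - 1"
  by (auto simp: quad_char_def)

lemma quad_char_minus_one: "quad_char (- 1 :: 'k) = (- 1) ^ h"
proof (cases "even h")
  case True
  then show ?thesis using power_half_eq_1_iff[of "- 1"] by simp
next
  case False
  then have "(- 1 :: 'k) ^ h \<noteq> 1" using one_neq_minus_one by (metis power_minus_odd power_one)
  then show ?thesis
    using power_half_eq_1_iff[of "- 1"] quad_char_cases[of "- 1"] False by auto
qed

lemma quad_char_sq: "x \<noteq> 0 \<Longrightarrow> quad_char (x::'k) * quad_char x = 1"
  by (auto simp: quad_char_def)

lemma quad_char_1: "quad_char (1::'k) = 1"
  using power_half_eq_1_iff[of 1] by simp

lemma quad_char_0: "quad_char (0::'k) = 0"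
  by (simp add: quad_char_def)

lemma quad_char_divide: "quad_char (x / y) = quad_char x * quad_char (y::'k)"
proof (cases "y = 0")
  case False
  then have "quad_char x = quad_char (x / y) * quad_char y" by (simp flip: quad_char_mult)
  then show ?thesis using quad_char_sq[OF False] by (simp add: mult.assoc)
qed (simp add: quad_char_0)

text \<open>The affine curve \<open>y\<^sup>2 = x\<^sup>2 + c\<close> becomes \<open>u v = c\<close> for \<open>u = y - x\<close> and \<open>v = y + x\<close>.\<close>
lemma sum_quad_char_square_plus:
  "(\<Sum>x\<in>UNIV. quad_char (x ^ 2 + (c::'k))) = zero_weight c"
proof -
  have "(\<Sum>x\<in>UNIV. 1 + quad_char (x ^ 2 + (c::'k))) = (\<Sum>x\<in>(UNIV::'k set). int (card {y. y ^ 2 = x ^ 2 + c}))"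
    by (simp add: card_square_roots)
  also have "\<dots> = int (card (SIGMA x:UNIV. {y. y ^ 2 = x ^ 2 + c}))"
    by simp
  also have "card (SIGMA x:UNIV. {y. y ^ 2 = x ^ 2 + c}) = card {(u, v :: 'k). u * v = c}"
  proof -
    define H :: 'k where "H = 1 / 2"
    have H: "x * H + x * H = x" for x
    proof -
      have "x * H + x * H = x * (2 * H)" by (simp add: algebra_simps)
      then show ?thesis using two_neq_zero by (simp add: H_def)
    qed
    have inv1: "((y + x) - (y - x)) * H = x" "((y - x) + (y + x)) * H = y" for x y
      using H[of x] H[of y] by (simp_all add: algebra_simps)
    have inv2: "(u + v) * H - (v - u) * H = u" "(u + v) * H + (v - u) * H = v" for u v
    proof -
      have "(u + v) * H - (v - u) * H = u * H + u * H" "(u + v) * H + (v - u) * H = v * H + v * H"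
        by (simp_all add: algebra_simps)
      then show "(u + v) * H - (v - u) * H = u" "(u + v) * H + (v - u) * H = v"
        by (simp_all only: H)
    qed
    have conv: "((u + v) * H) ^ 2 = ((v - u) * H) ^ 2 + u * v" for u v
    proof -
      have "((u + v) * H) ^ 2 - ((v - u) * H) ^ 2 =
          ((u + v) * H - (v - u) * H) * ((u + v) * H + (v - u) * H)"
        by (simp add: power2_eq_square algebra_simps)
      also have "\<dots> = u * v" by (simp only: inv2)
      finally show ?thesis by (simp add: algebra_simps)
    qed
    have "bij_betw (\<lambda>(x, y). (y - x, y + x)) (SIGMA x:UNIV. {y. y ^ 2 = x ^ 2 + c}) {(u, v :: 'k). u * v = c}"
    proof (rule bij_betw_byWitness[where f' = "\<lambda>(u, v). ((v - u) * H, (u + v) * H)"], goal_cases)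
      case 1
      then show ?case by (intro ballI) (simp only: split_paired_all case_prod_conv inv1)
    next
      case 2
      then show ?case by (intro ballI) (simp only: split_paired_all case_prod_conv inv2)
    next
      case 3
      then show ?case by (auto simp: power2_eq_square algebra_simps)
    next
      case 4
      then show ?case using conv by clarsimp
    qed
    then show ?thesis by (rule bij_betw_same_card)
  qed
  \<comment> \<open>For \<open>c = 0\<close> the curve is the union of the two axes; otherwise each
    nonzero \<open>u\<close> gives one point.\<close>
  also have "int (card {(u, v :: 'k). u * v = c}) = int CARD('k) + zero_weight c"
  proof (cases "c = 0")
    case True
    have "{(u, v :: 'k). u * v = c} = insert 0 (({0} \<times> (UNIV - {0})) \<union> ((UNIV - {0}) \<times> {0}))"
      using True by (auto simp: zero_prod_def)
    also have "card \<dots> = 1 + ((CARD('k) - 1) + (CARD('k) - 1))"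
      by (subst card_insert_disjoint)
        (auto simp: zero_prod_def card_Un_disjoint disjoint_iff card_cartesian_product card_Diff_singleton)
    finally show ?thesis using True card_odd by (simp add: zero_weight_def)
  next
    case False
    have "{(u, v :: 'k). u * v = c} = (\<lambda>u. (u, c / u)) ` (UNIV - {0})"
      using False by (auto simp: image_iff field_simps)
    also have "card \<dots> = CARD('k) - 1"
      by (subst card_image) (auto simp: inj_on_def card_Diff_singleton)
    finally show ?thesis using False card_odd by (simp add: zero_weight_def)
  qed
  finally show ?thesis by (simp add: sum.distrib)
qed

lemma sum_quad_char_quadratic:
  assumes "l \<noteq> (0::'k)"
  shows "(\<Sum>x\<in>UNIV. quad_char (t - l * x ^ 2)) = quad_char (- l) * zero_weight t"
proof -
  have "t - l * x ^ 2 = - l * (x ^ 2 + - (t / l))" for x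
    using assms by (simp add: field_simps)
  then have "(\<Sum>x\<in>UNIV. quad_char (t - l * x ^ 2)) =
      quad_char (- l) * (\<Sum>x\<in>UNIV. quad_char (x ^ 2 + - (t / l)))"
    by (simp only: quad_char_mult sum_distrib_left)
  then show ?thesis
    using assms unfolding sum_quad_char_square_plus by (simp add: zero_weight_def)
qed

text \<open>With \<open>zero_weight\<close> written as an indicator times the cardinality, minus 1,
  only the number of square roots of \<open>t / l\<close> has to be counted.\<close>

lemma sum_zero_weight_quadratic:
  assumes "l \<noteq> (0::'k)"
  shows "(\<Sum>x\<in>UNIV. zero_weight (t - l * x ^ 2)) = int CARD('k) * quad_char (t * l)"
proof -
  have zw: "zero_weight u = int CARD('k) * (if u = 0 then 1 else 0) - 1" for u :: 'k
    by (simp add: zero_weight_def)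
  have "(\<Sum>x\<in>(UNIV::'k set). if t - l * x ^ 2 = 0 then 1 else 0 :: int) = int (card {x. x ^ 2 = t / l})"
  proof -
    have "t - l * x ^ 2 = 0 \<longleftrightarrow> x ^ 2 = t / l" for x using assms by (auto simp: field_simps)
    then show ?thesis by (simp add: sum.If_cases)
  qed
  also have "\<dots> = 1 + quad_char (t * l)"
    by (simp add: card_square_roots quad_char_divide quad_char_mult)
  finally show ?thesis
    by (simp add: zw sum_subtractf algebra_simps flip: sum_distrib_left)
qed

end

subsection \<open>Counting the values of a diagonal form\<close>

text \<open>Tuples are functions on all of \<open>nat\<close> that vanish from \<open>n\<close> on,
  so tuples of different lengths share one type and a coordinate is added by a function
  update.\<close>

definition diag_count :: "(nat \<Rightarrow> 'k::{field,finite}) \<Rightarrow> nat \<Rightarrow> 'k \<Rightarrow> nat" where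
  "diag_count a n t = card {c :: nat \<Rightarrow> 'k. (\<forall>i\<ge>n. c i = 0) \<and> (\<Sum>i<n. a i * c i ^ 2) = t}"


text \<open>Finiteness is a hypothesis instead of a sort constraint because the scalars of
  \<open>vector_space\<close> are only known to form a field.\<close>

lemma
  assumes fin: "finite (UNIV :: 'k::zero set)"
  shows finite_supported: "finite {c :: nat \<Rightarrow> 'k. \<forall>i\<ge>n. c i = 0}"
    and card_supported: "card {c :: nat \<Rightarrow> 'k. \<forall>i\<ge>n. c i = 0} = CARD('k) ^ n"
proof -
  have "bij_betw (\<lambda>c. restrict c {..<n}) {c :: nat \<Rightarrow> 'k. \<forall>i\<ge>n. c i = 0} (PiE {..<n} (\<lambda>_. UNIV))"
  proof (rule bij_betw_byWitness[where f' = "\<lambda>c i. if i < n then c i else 0"], goal_cases)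
    case 1
    show ?case by (intro ballI ext) (simp add: restrict_def)
  next
    case 2
    show ?case by (intro ballI ext) (simp add: restrict_def PiE_def extensional_def)
  next
    case 3
    show ?case by (intro image_subsetI) (simp add: PiE_def)
  next
    case 4
    show ?case by (intro image_subsetI) simp
  qed
  moreover have "finite (PiE {..<n} (\<lambda>_. UNIV :: 'k set))"
    by (rule finite_PiE) (auto simp: fin)
  ultimately show "finite {c :: nat \<Rightarrow> 'k. \<forall>i\<ge>n. c i = 0}"
    and "card {c :: nat \<Rightarrow> 'k. \<forall>i\<ge>n. c i = 0} = CARD('k) ^ n"
    by (auto simp: bij_betw_finite bij_betw_same_card card_PiE)
qed

context
  fixes h :: nat
  assumes card_odd: "CARD('k::{field,finite}) = 2 * h + 1"
begin

lemma diag_count_0: "diag_count (a :: nat \<Rightarrow> 'k) 0 t = (if t = 0 then 1 else 0)"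
proof -
  have "{c :: nat \<Rightarrow> 'k. (\<forall>i\<ge>0. c i = 0) \<and> (\<Sum>i<0. a i * c i ^ 2) = t} = (if t = 0 then {\<lambda>_. 0} else {})"
    by auto
  then show ?thesis unfolding diag_count_def by simp
qed

lemma diag_count_Suc:
  "diag_count (a :: nat \<Rightarrow> 'k) (Suc n) t = (\<Sum>x\<in>UNIV. diag_count a n (t - a n * x ^ 2))"
proof -
  let ?D = "\<lambda>t. {c :: nat \<Rightarrow> 'k. (\<forall>i\<ge>n. c i = 0) \<and> (\<Sum>i<n. a i * c i ^ 2) = t}"
  have fin: "finite (?D t)" for t by (rule finite_subset[OF _ finite_supported[OF finite, of n]]) auto
  have "(\<Sum>x\<in>UNIV. diag_count a n (t - a n * x ^ 2)) = card (SIGMA x:UNIV. ?D (t - a n * x ^ 2))"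
    unfolding diag_count_def by (rule card_SigmaI[symmetric]) (use fin in auto)
  also have "\<dots> = card {c :: nat \<Rightarrow> 'k. (\<forall>i\<ge>Suc n. c i = 0) \<and> (\<Sum>i<Suc n. a i * c i ^ 2) = t}"
  proof (rule bij_betw_same_card[of "\<lambda>(x, c). c(n := x)"],
      rule bij_betw_byWitness[where f' = "\<lambda>c. (c n, c(n := 0))"])
    show "(\<lambda>(x, c). c(n := x)) ` (SIGMA x:UNIV. ?D (t - a n * x ^ 2)) \<subseteq>
      {c. (\<forall>i\<ge>Suc n. c i = 0) \<and> (\<Sum>i<Suc n. a i * c i ^ 2) = t}"
      by auto
    show "(\<lambda>c. (c n, c(n := 0))) ` {c. (\<forall>i\<ge>Suc n. c i = 0) \<and> (\<Sum>i<Suc n. a i * c i ^ 2) = t} \<subseteq>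
      (SIGMA x:UNIV. ?D (t - a n * x ^ 2))"
      by (auto simp: algebra_simps)
  qed auto
  finally show ?thesis unfolding diag_count_def by simp
qed

text \<open>Both parities are proved together, since the induction alternates between them: summing
  over the last coordinate turns the character into \<open>zero_weight\<close> by
  \<open>sum_quad_char_quadratic\<close>, and back by
  \<open>sum_zero_weight_quadratic\<close>.\<close>

lemma diag_count_closed_form:
  fixes a :: "nat \<Rightarrow> 'k"
  assumes "\<And>i. i < n \<Longrightarrow> a i \<noteq> 0"
  shows "(\<forall>k t. n = 2 * k + 1 \<longrightarrow> int (diag_count a n t) =
           int CARD('k) ^ (2 * k) + quad_char ((- 1) ^ k * t * (\<Prod>i<n. a i)) * int CARD('k) ^ k) \<and>
         (\<forall>k t. n = 2 * k + 2 \<longrightarrow> int (diag_count a n t) =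
           int CARD('k) ^ (2 * k + 1) + quad_char ((- 1) ^ (k + 1) * (\<Prod>i<n. a i)) * zero_weight t * int CARD('k) ^ k)"
  using assms
proof (induction n)
  case (Suc n)
  note IH = Suc.IH[OF Suc.prems[OF less_SucI]]
  have an: "a n \<noteq> 0" using Suc.prems by simp
  have rec: "int (diag_count a (Suc n) t) = (\<Sum>x\<in>UNIV. int (diag_count a n (t - a n * x ^ 2)))" for t
    by (simp add: diag_count_Suc)
  show ?case
  proof (intro conjI allI impI)
    fix k t assume n: "Suc n = 2 * k + 1"
    show "int (diag_count a (Suc n) t) =
       int CARD('k) ^ (2 * k) + quad_char ((- 1) ^ k * t * (\<Prod>i<Suc n. a i)) * int CARD('k) ^ k"
    proof (cases k)
      \<comment> \<open>One variable: the induction hypothesis for no variables is vacuous, and the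
        square roots of \<open>t / a n\<close> are counted directly.\<close>
      case 0
      have "int (diag_count a (Suc n) t) = (\<Sum>x\<in>(UNIV::'k set). if t - a n * x ^ 2 = 0 then 1 else 0)"
        unfolding rec using n 0 by (intro sum.cong) (simp_all add: diag_count_0)
      also have "\<dots> = int (card {x. x ^ 2 = t / a n})"
      proof -
        have "t - a n * x ^ 2 = 0 \<longleftrightarrow> x ^ 2 = t / a n" for x using an by (auto simp: field_simps)
        then show ?thesis by (simp add: sum.If_cases)
      qed
      finally show ?thesis
        using n 0 by (simp add: card_square_roots[OF card_odd] quad_char_divide[OF card_odd] quad_char_mult[OF card_odd])
    next
      case (Suc j)
      let ?e = "quad_char ((- 1) ^ k * (\<Prod>i<n. a i))"
      have "int (diag_count a n u) = int CARD('k) ^ (2 * j + 1) + ?e * int CARD('k) ^ j * zero_weight u" for u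
        using IH n Suc by (simp add: mult_ac)
      then have "int (diag_count a (Suc n) t) =
          int CARD('k) * int CARD('k) ^ (2 * j + 1) + ?e * int CARD('k) ^ j * (int CARD('k) * quad_char (t * a n))"
        unfolding rec by (simp add: sum.distrib sum_zero_weight_quadratic[OF card_odd an] flip: sum_distrib_left)
      also have "?e * int CARD('k) ^ j * (int CARD('k) * quad_char (t * a n)) =
          (?e * quad_char (t * a n)) * int CARD('k) ^ k"
        using Suc by (simp add: mult_ac)
      also have "?e * quad_char (t * a n) = quad_char ((- 1) ^ k * t * (\<Prod>i<Suc n. a i))"
        by (simp add: mult_ac flip: quad_char_mult[OF card_odd])
      finally show ?thesis using Suc by (simp add: power_add)
    qed
  next
    fix k t assume n: "Suc n = 2 * k + 2"
    let ?e = "quad_char ((- 1) ^ k * (\<Prod>i<n. a i))"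
    have "int (diag_count a n u) = int CARD('k) ^ (2 * k) + ?e * int CARD('k) ^ k * quad_char u" for u
      using IH n by (simp add: quad_char_mult[OF card_odd] mult_ac)
    then have "int (diag_count a (Suc n) t) =
        int CARD('k) * int CARD('k) ^ (2 * k) + ?e * int CARD('k) ^ k * (quad_char (- a n) * zero_weight t)"
      unfolding rec by (simp add: sum.distrib sum_quad_char_quadratic[OF card_odd an] flip: sum_distrib_left)
    also have "?e * int CARD('k) ^ k * (quad_char (- a n) * zero_weight t) =
        (?e * quad_char (- a n)) * zero_weight t * int CARD('k) ^ k"
      by (simp add: mult_ac)
    also have "?e * quad_char (- a n) = quad_char ((- 1) ^ (k + 1) * (\<Prod>i<Suc n. a i))"
      by (simp add: mult_ac flip: quad_char_mult[OF card_odd])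
    finally show "int (diag_count a (Suc n) t) =
       int CARD('k) ^ (2 * k + 1) + quad_char ((- 1) ^ (k + 1) * (\<Prod>i<Suc n. a i)) * zero_weight t * int CARD('k) ^ k"
      by simp
  qed
qed simp

lemma diag_count_zero_tail:
  assumes "\<And>i. r \<le> i \<Longrightarrow> a i = (0::'k)"
  shows "diag_count a (r + j) t = CARD('k) ^ j * diag_count a r t"
  using assms by (induction j) (simp_all add: diag_count_Suc)

end

subsection \<open>Coordinates in finite vector spaces\<close>

context vector_space
begin

lemma independent_list_coordinates:
  assumes "distinct ws" "independent (set ws)"
  shows "bij_betw (\<lambda>c. \<Sum>i<length ws. scale (c i) (ws ! i)) {c. \<forall>i\<ge>length ws. c i = 0} (span (set ws))"
proof -
  let ?n = "length ws"
  let ?S = "\<lambda>c. \<Sum>i<?n. scale (c i) (ws ! i)"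
  have bij: "bij_betw ((!) ws) {..<?n} (set ws)"
    using assms(1) by (intro bij_betw_nth) auto
  have reindex: "(\<Sum>i<?n. F (ws ! i)) = (\<Sum>v\<in>set ws. F v)" for F :: "'b \<Rightarrow> 'b"
    by (rule sum.reindex_bij_betw[OF bij])
  have zero: "c i = 0" if c: "?S c = 0" and i: "i < ?n" for c i
  proof -
    \<comment> \<open>Independence speaks of sets, so the coefficients are moved from positions to
      vectors, which is possible because \<open>ws\<close> is distinct.\<close>
    let ?g = "\<lambda>v. c (inv_into {..<?n} ((!) ws) v)"
    have g: "?g (ws ! j) = c j" if "j < ?n" for j
      using bij that by (simp add: bij_betw_inv_into_left)
    have "(\<Sum>v\<in>set ws. scale (?g v) v) = ?S c"
      unfolding reindex[symmetric] by (rule sum.cong) (use g in auto)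
    then have "\<forall>v\<in>set ws. ?g v = 0"
      using assms(2) c independent_explicit_finite_subsets[of "set ws"]
      by (metis List.finite_set subset_refl)
    then show ?thesis using g[OF i] i by simp
  qed
  show ?thesis
  proof (rule bij_betw_imageI)
    show "inj_on ?S {c. \<forall>i\<ge>?n. c i = 0}"
    proof (rule inj_onI)
      fix c d assume cd: "c \<in> {c. \<forall>i\<ge>?n. c i = 0}" "d \<in> {c. \<forall>i\<ge>?n. c i = 0}" "?S c = ?S d"
      have "?S (\<lambda>i. c i - d i) = 0"
        using cd(3) by (simp add: scale_left_diff_distrib sum_subtractf)
      then have "c i - d i = 0" if "i < ?n" for i
        using zero[of "\<lambda>i. c i - d i" i] that by blast
      then have "c i = d i" for i using cd(1,2) by (cases "i < ?n") auto
      then show "c = d" by blast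
    qed
    show "?S ` {c. \<forall>i\<ge>?n. c i = 0} = span (set ws)"
    proof (intro equalityI subsetI)
      fix x assume "x \<in> span (set ws)"
      then obtain u where u: "x = (\<Sum>v\<in>set ws. scale (u v) v)"
        unfolding span_finite[OF List.finite_set] by blast
      let ?c = "\<lambda>i. if i < ?n then u (ws ! i) else 0"
      have "?S ?c = (\<Sum>i<?n. scale (u (ws ! i)) (ws ! i))" by (rule sum.cong) auto
      then have "x = ?S ?c" unfolding u reindex[symmetric] by simp
      then show "x \<in> ?S ` {c. \<forall>i\<ge>?n. c i = 0}"
        by (rule image_eqI[where x = ?c]) simp
    next
      fix x assume "x \<in> ?S ` {c. \<forall>i\<ge>?n. c i = 0}"
      then show "x \<in> span (set ws)"
        by (auto intro!: span_sum span_scale intro: span_base)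
    qed
  qed
qed

lemma finite_subspace_coordinates:
  assumes "subspace S" "finite S"
  obtains ws where "set ws \<subseteq> S" "length ws = dim S"
    "bij_betw (\<lambda>c. \<Sum>i<length ws. scale (c i) (ws ! i)) {c. \<forall>i\<ge>length ws. c i = 0} S"
proof -
  obtain B where B: "B \<subseteq> S" "independent B" "S \<subseteq> span B" "card B = dim S"
    using basis_exists by blast
  have "span B = S" using B(1,3) assms(1) span_minimal by blast
  moreover obtain ws where "set ws = B" "distinct ws"
    using finite_distinct_list finite_subset[OF B(1) assms(2)] by blast
  ultimately show ?thesis
    using that[of ws] independent_list_coordinates[of ws] B distinct_card[of ws] by simp
qed

lemma card_finite_subspace:
  assumes "subspace S" "finite S" "finite (UNIV :: 'a set)"
  shows "card S = CARD('a) ^ dim S"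
proof -
  obtain ws where "set ws \<subseteq> S" and len: "length ws = dim S"
    and bij: "bij_betw (\<lambda>c. \<Sum>i<length ws. scale (c i) (ws ! i)) {c. \<forall>i\<ge>length ws. c i = 0} S"
    by (rule finite_subspace_coordinates[OF assms(1,2)])
  show ?thesis
    using bij_betw_same_card[OF bij] card_supported[OF assms(3), of "length ws"] len by simp
qed

end

lemma vector_space_fscale: "vector_space fscale"
  by unfold_locales (auto simp: fscale_def fun_eq_iff algebra_simps)

lemma vector_space_ext_scale: "is_field_hom \<iota> \<Longrightarrow> vector_space (ext_scale \<iota>)"
  by unfold_locales (auto simp: ext_scale_def is_field_hom_def algebra_simps)

lemma sum_lessThan_add:
  fixes f :: "nat \<Rightarrow> 'a::comm_monoid_add"
  shows "(\<Sum>i<r + s. f i) = (\<Sum>i<r. f i) + (\<Sum>j<s. f (r + j))"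
  by (induction s) (simp_all add: add.assoc)

subsection \<open>Diagonalisation of quadratic forms\<close>

locale quadratic_form =
  fixes \<iota> :: "'f::{field,finite} \<Rightarrow> 'a::{field,finite}" and Q :: "'a \<Rightarrow> 'f" and h m1 :: nat
  assumes hom: "is_field_hom \<iota>" and qf: "is_quadratic_form \<iota> Q"
    and card_f: "CARD('f) = 2 * h + 1" and card_a: "CARD('a) = CARD('f) ^ m1"
begin

interpretation V: vector_space "ext_scale \<iota>"
  by (rule vector_space_ext_scale[OF hom])

lemma bilin_commute: "bilin Q x y = bilin Q y x"
  by (simp add: bilin_def add.commute)

lemma form_scale: "Q (\<iota> a * x) = a ^ 2 * Q x"
  using qf by (simp add: is_quadratic_form_def)

lemma bilin_lin: "bilin Q (\<iota> a * x + x') y = a * bilin Q x y + bilin Q x' y"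
  using qf by (simp add: is_quadratic_form_def)

lemma bilin_add: "bilin Q (x + x') y = bilin Q x y + bilin Q x' y"
  using bilin_lin[of 1 x x' y] by (simp add: field_hom_one[OF hom])

lemma bilin_zero: "bilin Q 0 y = 0"
  using bilin_add[of 0 0 y] by (metis add.right_neutral add_left_cancel)

lemma bilin_scale: "bilin Q (\<iota> a * x) y = a * bilin Q x y"
  using bilin_lin[of a x 0 y] by (simp add: bilin_zero)

lemma bilin_diff: "bilin Q (x - x') y = bilin Q x y - bilin Q x' y"
  using bilin_add[of "x - x'" x' y] by simp

lemma bilin_sum: "bilin Q (\<Sum>i<(n::nat). \<iota> (c i) * e i) y = (\<Sum>i<n. c i * bilin Q (e i) y)"
  by (induction n) (simp_all add: bilin_zero bilin_add bilin_scale)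

lemma form_add: "Q (x + y) = Q x + Q y + 2 * bilin Q x y"
proof -
  have "bilin Q x y * 2 = Q (x + y) - Q x - Q y"
    by (rule iffD1[OF nonzero_eq_divide_eq[OF two_neq_zero[OF card_f]]]) (simp only: bilin_def)
  then show ?thesis by (simp add: mult.commute[of 2])
qed

text \<open>Compare \<open>Q (x + x) = 4 * Q x\<close> with the expansion by \<open>form_add\<close>
  and cancel 2.\<close>

lemma form_eq_bilin: "Q x = bilin Q x x"
proof -
  have "Q (x + x) = 2 ^ 2 * Q x"
    using form_scale[of 2 x] field_hom_add[OF hom, of 1 1]
    by (simp add: field_hom_one[OF hom] distrib_right)
  then have "2 * Q x = 2 * bilin Q x x"
    using form_add[of x x] by (simp add: algebra_simps)
  then show ?thesis by (rule iffD1[OF mult_left_cancel[OF two_neq_zero[OF card_f]]])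
qed

text \<open>Take a list of greatest length: a \<open>w\<close> orthogonal to it with
  \<open>Q w \<noteq> 0\<close> could be appended.\<close>

lemma ex_maximal_orthogonal:
  "\<exists>es. (\<forall>i<length es. \<forall>j<length es. i \<noteq> j \<longrightarrow> bilin Q (es ! i) (es ! j) = 0) \<and>
    (\<forall>e\<in>set es. Q e \<noteq> 0) \<and> (\<forall>w. (\<forall>e\<in>set es. bilin Q w e = 0) \<longrightarrow> Q w = 0)"
proof -
  define P where "P es \<longleftrightarrow> (\<forall>i<length es. \<forall>j<length es. i \<noteq> j \<longrightarrow> bilin Q (es ! i) (es ! j) = 0) \<and>
    (\<forall>e\<in>set es. Q e \<noteq> 0)" for es
  \<comment> \<open>A repeated entry would be orthogonal to itself, against
    \<open>Q e \<noteq> 0\<close>. So lengths are bounded.\<close>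
  have bound: "length es \<le> CARD('a)" if "P es" for es
  proof -
    have "distinct es"
      unfolding distinct_conv_nth using that by (metis P_def form_eq_bilin nth_mem)
    then show ?thesis by (metis card_mono distinct_card finite subset_UNIV)
  qed
  have "P []" by (simp add: P_def)
  then have "\<exists>es. P es \<and> (\<forall>es'. P es' \<longrightarrow> length es' \<le> length es)"
    by (rule ex_has_greatest_nat[where b = "Suc CARD('a)"]) (simp add: bound less_Suc_eq_le)
  then obtain es where es: "P es" "\<forall>es'. P es' \<longrightarrow> length es' \<le> length es"
    by (elim exE conjE)
  have "Q w = 0" if w: "\<forall>e\<in>set es. bilin Q w e = 0" for w
  proof (rule ccontr)
    assume nz: "Q w \<noteq> 0"
    have w': "\<forall>e\<in>set es. bilin Q e w = 0"
      using w by (simp add: bilin_commute[where y = w])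
    have "P (es @ [w])"
      using es(1) w w' nz unfolding P_def
      by (auto simp: nth_append less_Suc_eq)
    then show False using es(2)[rule_format, of "es @ [w]"] by simp
  qed
  then show ?thesis using es(1) unfolding P_def by (intro exI[of _ es]) simp
qed

text \<open>A maximal orthogonal list \<open>es\<close> is followed by a basis \<open>ws\<close> of
  its orthogonal complement \<open>W\<close>. As \<open>Q\<close> vanishes on \<open>W\<close>, the
  vectors of \<open>ws\<close> get no coefficient.\<close>

lemma diagonalization_exists: "\<exists>es ls. is_diagonalization \<iota> Q es ls"
proof -
  obtain es where orth: "\<And>i j. i < length es \<Longrightarrow> j < length es \<Longrightarrow> i \<noteq> j \<Longrightarrow> bilin Q (es ! i) (es ! j) = 0"
    and aniso: "\<And>e. e \<in> set es \<Longrightarrow> Q e \<noteq> 0"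
    and compl: "\<And>w. \<forall>e\<in>set es. bilin Q w e = 0 \<Longrightarrow> Q w = 0"
    using ex_maximal_orthogonal by auto
  define W where "W = {w. \<forall>e\<in>set es. bilin Q w e = 0}"
  have "V.subspace W"
    unfolding V.subspace_def W_def by (auto simp: ext_scale_def bilin_zero bilin_add bilin_scale)
  then obtain ws where ws: "set ws \<subseteq> W" and "length ws = V.dim W"
    and bij: "bij_betw (\<lambda>c. \<Sum>i<length ws. ext_scale \<iota> (c i) (ws ! i)) {c. \<forall>i\<ge>length ws. c i = 0} W"
    by (rule V.finite_subspace_coordinates[OF _ finite])
  define S where "S c = (\<Sum>i<length es. \<iota> (c i) * es ! i)" for c
  define T where "T c = (\<Sum>i<length ws. \<iota> (c i) * ws ! i)" for c
  define U where "U c = (\<Sum>i<length (es @ ws). \<iota> (c i) * (es @ ws) ! i)" for c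
  have U: "U c = S c + T (\<lambda>j. c (length es + j))" for c
    unfolding U_def S_def T_def length_append sum_lessThan_add by (simp add: nth_append)
  have bijT: "bij_betw T {c. \<forall>i\<ge>length ws. c i = 0} W"
    using bij unfolding T_def ext_scale_def .
  have TW: "T c \<in> W" for c
  proof -
    have "bilin Q (T c) e = 0" if "e \<in> set es" for e
      unfolding T_def bilin_sum
      by (rule sum.neutral) (use ws that in \<open>auto simp: W_def subset_iff\<close>)
    then show ?thesis by (simp add: W_def)
  qed
  have BT: "bilin Q (T c) (es ! i) = 0" if "i < length es" for c i
    using TW[of c] that by (simp add: W_def)
  have BS: "bilin Q (S c) (es ! i) = c i * Q (es ! i)" if "i < length es" for c i
  proof -
    have "bilin Q (S c) (es ! i) = (\<Sum>j<length es. if j = i then c i * Q (es ! i) else 0)"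
      unfolding S_def bilin_sum
      by (rule sum.cong) (use that orth in \<open>auto simp: form_eq_bilin\<close>)
    then show ?thesis using that by simp
  qed
  have QS: "Q (S c) = (\<Sum>i<length es. Q (es ! i) * c i ^ 2)" for c
  proof -
    have "Q (S c) = (\<Sum>i<length es. c i * bilin Q (es ! i) (S c))"
      unfolding form_eq_bilin[of "S c"] by (subst (1) S_def) (simp add: bilin_sum)
    also have "\<dots> = (\<Sum>i<length es. Q (es ! i) * c i ^ 2)"
      by (rule sum.cong) (auto simp: bilin_commute[of _ "S c"] BS power2_eq_square)
    finally show ?thesis .
  qed
  have BST: "bilin Q (S c) (T d) = 0" for c d
    unfolding S_def bilin_sum
    by (rule sum.neutral) (simp add: bilin_commute[of _ "T d"] BT)
  have QT: "Q (T c) = 0" for c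
    using compl[of "T c"] TW[of c] by (simp add: W_def)
  have "is_diagonalization \<iota> Q (es @ ws) (map Q es)"
    unfolding is_diagonalization_def U_def[symmetric]
  proof (intro conjI)
    show "\<forall>l\<in>set (map Q es). l \<noteq> 0" using aniso by auto
    show "\<forall>c. Q (U c) = (\<Sum>i<length (map Q es). map Q es ! i * (c i)\<^sup>2)"
      by (simp add: U form_add BST QT QS)
    show "bij_betw U {c. \<forall>i\<ge>length (es @ ws). c i = 0} UNIV"
    proof (rule bij_betw_imageI)
      show "inj_on U {c. \<forall>i\<ge>length (es @ ws). c i = 0}"
      proof (rule inj_onI)
        fix c d assume c: "c \<in> {c. \<forall>i\<ge>length (es @ ws). c i = 0}"
          and d: "d \<in> {c. \<forall>i\<ge>length (es @ ws). c i = 0}" and eq: "U c = U d"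
        \<comment> \<open>Pairing with \<open>es ! i\<close> recovers the coordinate up to the
          nonzero factor \<open>Q (es ! i)\<close>; the other coordinates follow from
          \<open>bijT\<close>.\<close>
        have 1: "c i = d i" if "i < length es" for i
        proof -
          have "bilin Q (U c) (es ! i) = c i * Q (es ! i)" for c
            using that by (simp add: U bilin_add BS BT)
          then have "c i * Q (es ! i) = d i * Q (es ! i)" using eq by metis
          then show ?thesis using aniso that by simp
        qed
        then have "S c = S d" unfolding S_def by simp
        then have "T (\<lambda>j. c (length es + j)) = T (\<lambda>j. d (length es + j))" using eq by (simp add: U)
        then have "(\<lambda>j. c (length es + j)) = (\<lambda>j. d (length es + j))"
          using c d by (intro inj_onD[OF bij_betw_imp_inj_on[OF bijT]]) auto
        then have 2: "c (length es + j) = d (length es + j)" for j by metis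
        show "c = d"
        proof
          fix i show "c i = d i"
            using 1[of i] 2[of "i - length es"] by (cases "i < length es") auto
        qed
      qed
      show "U ` {c. \<forall>i\<ge>length (es @ ws). c i = 0} = UNIV"
      proof (intro equalityI subsetI)
        fix x :: 'a
        \<comment> \<open>The coefficients of the orthogonal projection onto the span of
          \<open>es\<close>; what remains of \<open>x\<close> lies in \<open>W\<close>.\<close>
        define c where "c i = bilin Q x (es ! i) / Q (es ! i)" for i
        have "x - S c \<in> W"
        proof -
          have "bilin Q (x - S c) (es ! i) = 0" if "i < length es" for i
            using BS[OF that, of c] that aniso by (simp add: bilin_diff c_def)
          then show ?thesis unfolding W_def by (auto simp: in_set_conv_nth)
        qed
        then have "x - S c \<in> T ` {c. \<forall>i\<ge>length ws. c i = 0}"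
          by (simp only: bij_betw_imp_surj_on[OF bijT])
        then obtain d where d: "x - S c = T d" "d \<in> {c. \<forall>i\<ge>length ws. c i = 0}"
          by (rule imageE)
        let ?u = "\<lambda>i. if i < length es then c i else d (i - length es)"
        have "S ?u = S c" unfolding S_def by simp
        then have "x = U ?u" using d(1) by (simp add: U algebra_simps)
        then show "x \<in> U ` {c. \<forall>i\<ge>length (es @ ws). c i = 0}"
          by (rule image_eqI[where x = ?u]) (use d(2) in auto)
      qed simp
    qed
  qed simp
  then show ?thesis by blast
qed

lemma diagonalization_length:
  assumes "is_diagonalization \<iota> Q es ls"
  shows "length es = m1"
proof -
  have lengths: "card {c :: nat \<Rightarrow> 'f. \<forall>i\<ge>length es. c i = 0} = CARD('f) ^ length es"
    by (rule card_supported) simp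
  have "bij_betw (\<lambda>c. \<Sum>i<length es. \<iota> (c i) * es ! i) {c. \<forall>i\<ge>length es. c i = 0} UNIV"
    using assms by (simp only: is_diagonalization_def)
  then have "CARD('f) ^ length es = CARD('f) ^ m1"
    unfolding lengths[symmetric] card_a[symmetric] by (rule bij_betw_same_card)
  moreover have "CARD('f) > 1"
    using card_mono[of "UNIV :: 'f set" "{0, 1}"] by simp
  ultimately show ?thesis by (metis power_inject_exp)
qed

text \<open>In diagonal coordinates \<open>bilin Q\<close> is the sum of
  \<open>ls ! i * c i * d i\<close>, so the radical is where the first \<open>length ls\<close>
  coordinates vanish. Its dimension is read off from its size.\<close>

lemma rank_eq_length:
  assumes D: "is_diagonalization \<iota> Q es ls"
  shows "rank_qf \<iota> Q m1 = length ls" and "length ls \<le> m1"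
proof -
  define S where "S c = (\<Sum>i<length es. \<iota> (c i) * es ! i)" for c
  let ?r = "length ls"
  have n: "length es = m1" by (rule diagonalization_length[OF D])
  show r: "?r \<le> m1" using D n by (simp add: is_diagonalization_def)
  have bij: "bij_betw S {c. \<forall>i\<ge>m1. c i = 0} UNIV"
    and QS: "\<And>c. Q (S c) = (\<Sum>i<?r. ls ! i * c i ^ 2)" and nz: "\<And>i. i < ?r \<Longrightarrow> ls ! i \<noteq> 0"
    using D unfolding is_diagonalization_def S_def n by auto
  have Sadd: "S c + S d = S (\<lambda>i. c i + d i)" for c d
    by (simp add: S_def field_hom_add[OF hom] distrib_right sum.distrib)
  have B: "bilin Q (S c) (S d) = (\<Sum>i<?r. ls ! i * c i * d i)" for c d
  proof -
    have "2 * bilin Q (S c) (S d) = Q (S (\<lambda>i. c i + d i)) - Q (S c) - Q (S d)"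
      by (simp add: form_add flip: Sadd)
    also have "\<dots> = 2 * (\<Sum>i<?r. ls ! i * c i * d i)"
      unfolding QS sum_distrib_left sum_subtractf[symmetric]
      by (rule sum.cong) (auto simp: power2_eq_square algebra_simps)
    finally show ?thesis using two_neq_zero[OF card_f] by simp
  qed
  let ?Z = "{c :: nat \<Rightarrow> 'f. (\<forall>i<?r. c i = 0) \<and> (\<forall>i\<ge>m1. c i = 0)}"
  let ?R = "{x. \<forall>y. bilin Q x y = 0}"
  have image: "S ` ?Z = ?R"
  proof (intro equalityI subsetI)
    fix x assume x: "x \<in> ?R"
    have "x \<in> S ` {c. \<forall>i\<ge>m1. c i = 0}"
      by (simp only: bij_betw_imp_surj_on[OF bij] UNIV_I)
    then obtain c where c: "x = S c" "c \<in> {c. \<forall>i\<ge>m1. c i = 0}"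
      by (rule imageE)
    have "c j = 0" if "j < ?r" for j
    proof -
      have "0 = bilin Q (S c) (S (\<lambda>i. if i = j then 1 else 0))" using x c by simp
      also have "\<dots> = (\<Sum>i<?r. if i = j then ls ! j * c j else 0)"
        unfolding B by (rule sum.cong) auto
      finally show ?thesis using that nz[OF that] by simp
    qed
    then show "x \<in> S ` ?Z" using c by (intro image_eqI[where x = c]) simp_all
  next
    fix x assume "x \<in> S ` ?Z"
    then obtain c where c: "x = S c" "c \<in> ?Z" by (rule imageE)
    have "bilin Q x y = 0" for y
    proof -
      have "y \<in> S ` {c. \<forall>i\<ge>m1. c i = 0}"
        by (simp only: bij_betw_imp_surj_on[OF bij] UNIV_I)
      then obtain d where "y = S d" by (rule imageE)
      then show ?thesis using B[of c d] c by simp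
    qed
    then show "x \<in> ?R" by simp
  qed
  have inj: "inj_on S ?Z"
    by (rule inj_on_subset[OF bij_betw_imp_inj_on[OF bij]]) auto
  have "card ?R = card ?Z"
    unfolding image[symmetric] by (rule card_image[OF inj])
  \<comment> \<open>Shifting the indices by \<open>?r\<close> brings these tuples into the form
    counted by \<open>card_supported\<close>.\<close>
  also have "?Z = (\<lambda>c i. if i < ?r then 0 else c (i - ?r)) ` {c. \<forall>i\<ge>m1 - ?r. c i = (0::'f)}" (is "_ = ?g ` ?X")
  proof (intro equalityI subsetI)
    fix c assume c: "c \<in> ?Z"
    have "c = ?g (\<lambda>i. c (i + ?r))" using c by auto
    then show "c \<in> ?g ` ?X"
      by (rule image_eqI[where x = "\<lambda>i. c (i + ?r)"]) (use c r in auto)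
  qed (use r in auto)
  also have "card (?g ` ?X) = card ?X"
  proof (rule card_image, rule inj_onI)
    fix c d :: "nat \<Rightarrow> 'f" assume "?g c = ?g d"
    then have "?g c (i + ?r) = ?g d (i + ?r)" for i by metis
    then show "c = d" by (auto simp: fun_eq_iff)
  qed
  also have "\<dots> = CARD('f) ^ (m1 - ?r)" by (rule card_supported) simp
  finally have "card ?R = CARD('f) ^ (m1 - ?r)" .
  moreover have "V.subspace ?R"
    unfolding V.subspace_def by (auto simp: ext_scale_def bilin_zero bilin_add bilin_scale)
  ultimately have "CARD('f) ^ V.dim ?R = CARD('f) ^ (m1 - ?r)"
    using V.card_finite_subspace[of ?R] by simp
  moreover have "CARD('f) > 1"
    using card_mono[of "UNIV :: 'f set" "{0, 1}"] by simp
  ultimately have "V.dim ?R = m1 - ?r" by (metis power_inject_exp)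
  then show "rank_qf \<iota> Q m1 = ?r" using r by (simp add: rank_qf_def)
qed

text \<open>Coordinates turn the level set into a diagonal equation in \<open>m1\<close> variables,
  of which \<open>m1 - length ls\<close> have coefficient 0 and are free.\<close>

lemma card_level_set:
  assumes D: "is_diagonalization \<iota> Q es ls"
  shows "card {x. Q x = t} = CARD('f) ^ (m1 - length ls) *
    diag_count (\<lambda>i. if i < length ls then ls ! i else 0) (length ls) t"
proof -
  define S where "S c = (\<Sum>i<length es. \<iota> (c i) * es ! i)" for c
  let ?r = "length ls"
  let ?a = "\<lambda>i. if i < ?r then ls ! i else 0"
  have n: "length es = m1" by (rule diagonalization_length[OF D])
  have r: "?r \<le> m1" using D n by (simp add: is_diagonalization_def)
  have bij: "bij_betw S {c. \<forall>i\<ge>m1. c i = 0} UNIV"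
    and QS: "\<And>c. Q (S c) = (\<Sum>i<?r. ls ! i * c i ^ 2)"
    using D unfolding is_diagonalization_def S_def n by auto
  have QS': "Q (S c) = (\<Sum>i<m1. ?a i * c i ^ 2)" for c
    unfolding QS using r by (intro sum.mono_neutral_cong_left) auto
  have image: "S ` {c. (\<forall>i\<ge>m1. c i = 0) \<and> (\<Sum>i<m1. ?a i * c i ^ 2) = t} = {x. Q x = t}"
  proof (intro equalityI subsetI)
    fix x assume x: "x \<in> {x. Q x = t}"
    have "x \<in> S ` {c. \<forall>i\<ge>m1. c i = 0}"
      by (simp only: bij_betw_imp_surj_on[OF bij] UNIV_I)
    then obtain c where "x = S c" "c \<in> {c. \<forall>i\<ge>m1. c i = 0}"
      by (rule imageE)
    then show "x \<in> S ` {c. (\<forall>i\<ge>m1. c i = 0) \<and> (\<Sum>i<m1. ?a i * c i ^ 2) = t}"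
      unfolding QS'[symmetric] using x by blast
  next
    fix x assume "x \<in> S ` {c. (\<forall>i\<ge>m1. c i = 0) \<and> (\<Sum>i<m1. ?a i * c i ^ 2) = t}"
    then show "x \<in> {x. Q x = t}" unfolding QS'[symmetric] by blast
  qed
  have inj: "inj_on S {c. (\<forall>i\<ge>m1. c i = 0) \<and> (\<Sum>i<m1. ?a i * c i ^ 2) = t}"
    by (rule inj_on_subset[OF bij_betw_imp_inj_on[OF bij]]) auto
  have "card {x. Q x = t} = diag_count ?a m1 t"
    unfolding diag_count_def image[symmetric] by (rule card_image[OF inj])
  also have "\<dots> = CARD('f) ^ (m1 - ?r) * diag_count ?a ?r t"
    using diag_count_zero_tail[OF card_f, of ?r ?a "m1 - ?r" t] r by simp
  finally show ?thesis .
qed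

text \<open>Here \<open>z\<close> is \<open>(-1) ^ k\<close> times the product of the diagonal
  coefficients. The final formulas do not contain it, so only its existence is recorded.\<close>

lemma card_level_set_odd_rank:
  assumes rank: "rank_qf \<iota> Q m1 = 2 * k + 1"
  shows "\<exists>z. z \<noteq> 0 \<and> (\<forall>t. real (card {x. Q x = t}) =
    real CARD('f) ^ (m1 - 1) + real_of_int (quad_char (z * t)) * (real CARD('f) ^ (m1 - 1) / real CARD('f) ^ k))"
proof -
  obtain es ls where D: "is_diagonalization \<iota> Q es ls" using diagonalization_exists by blast
  have len: "length ls = 2 * k + 1" and m1: "2 * k + 1 \<le> m1"
    using rank_eq_length[OF D] rank by simp_all
  let ?a = "\<lambda>i. if i < length ls then ls ! i else 0"
  let ?z = "(- 1) ^ k * (\<Prod>i<2 * k + 1. ?a i)"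
  have nz: "?a i \<noteq> 0" if "i < 2 * k + 1" for i
    using D that len by (simp add: is_diagonalization_def)
  have "real (card {x. Q x = t}) =
    real CARD('f) ^ (m1 - 1) + real_of_int (quad_char (?z * t)) * (real CARD('f) ^ (m1 - 1) / real CARD('f) ^ k)" for t
  proof -
    have "int (diag_count ?a (2 * k + 1) t) =
        int CARD('f) ^ (2 * k) + quad_char ((- 1) ^ k * t * (\<Prod>i<2 * k + 1. ?a i)) * int CARD('f) ^ k"
      using diag_count_closed_form[OF card_f, of "2 * k + 1" ?a] nz by blast
    also have "(- 1) ^ k * t * (\<Prod>i<2 * k + 1. ?a i) = ?z * t" by (simp only: mult_ac)
    finally have "real_of_int (int (diag_count ?a (2 * k + 1) t)) =
        real_of_int (int CARD('f) ^ (2 * k) + quad_char (?z * t) * int CARD('f) ^ k)"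
      by (rule arg_cong)
    then have d: "real (diag_count ?a (2 * k + 1) t) =
        real CARD('f) ^ (2 * k) + real_of_int (quad_char (?z * t)) * real CARD('f) ^ k"
      by simp
    have "real (card {x. Q x = t}) = real CARD('f) ^ (m1 - (2 * k + 1)) * real (diag_count ?a (2 * k + 1) t)"
      unfolding card_level_set[OF D] len by simp
    also have "\<dots> = real CARD('f) ^ (m1 - (2 * k + 1)) * real CARD('f) ^ (2 * k)
        + real_of_int (quad_char (?z * t)) * (real CARD('f) ^ (m1 - (2 * k + 1)) * real CARD('f) ^ k)"
      unfolding d by (simp add: algebra_simps)
    also have "real CARD('f) ^ (m1 - (2 * k + 1)) * real CARD('f) ^ (2 * k) = real CARD('f) ^ (m1 - 1)"
      using m1 by (simp flip: power_add)
    also have "real CARD('f) ^ (m1 - (2 * k + 1)) * real CARD('f) ^ k = real CARD('f) ^ (m1 - 1) / real CARD('f) ^ k"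
    proof -
      have "real CARD('f) ^ (m1 - (2 * k + 1)) * real CARD('f) ^ k * real CARD('f) ^ k = real CARD('f) ^ (m1 - 1)"
        using m1 by (simp flip: power_add)
      then show ?thesis by (simp add: field_simps)
    qed
    finally show ?thesis .
  qed
  moreover have "?z \<noteq> 0" using nz by (simp add: prod_zero_iff)
  ultimately show ?thesis by blast
qed

lemma card_level_set_even_rank:
  assumes p: "odd p" and cardp: "CARD('f) = p ^ m"
    and rank: "rank_qf \<iota> Q m1 = 2 * k" and nz: "\<exists>x. Q x \<noteq> 0"
  shows "k \<ge> 1"
    and "real (card {x. Q x = t}) = real CARD('f) ^ (m1 - 1) +
      real_of_int (eps_sign \<iota> Q p m m1 * zero_weight t) * (real CARD('f) ^ (m1 - 1) / real CARD('f) ^ k)"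
proof -
  \<comment> \<open>\<open>eps_Q\<close> is a choice among the values of all diagonalizations; one
    that attains the chosen value is fixed.\<close>
  have "\<exists>e es ls. is_diagonalization \<iota> Q es ls \<and> e = quad_char (prod_list ls)"
    using diagonalization_exists by blast
  then have "\<exists>es ls. is_diagonalization \<iota> Q es ls \<and> eps_Q \<iota> Q = quad_char (prod_list ls)"
    unfolding eps_Q_def by (rule someI_ex)
  then obtain es ls where D: "is_diagonalization \<iota> Q es ls"
    and eps: "eps_Q \<iota> Q = quad_char (prod_list ls)"
    by blast
  have len: "length ls = 2 * k" and m1: "2 * k \<le> m1"
    using rank_eq_length[OF D] rank by simp_all
  show k: "k \<ge> 1"
  proof (rule ccontr)
    assume "\<not> k \<ge> 1"
    then have "k = 0" by simp
    then have ls: "ls = []" using len by simp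
    have "Q x = 0" for x
    proof -
      have "x \<in> (\<lambda>c. \<Sum>i<length es. \<iota> (c i) * es ! i) ` {c. \<forall>i\<ge>length es. c i = 0}"
        using D unfolding is_diagonalization_def bij_betw_def by blast
      then show ?thesis using D ls unfolding is_diagonalization_def by auto
    qed
    then show False using nz by blast
  qed
  then obtain j where j: "k = j + 1" by (metis add.commute le_Suc_ex)
  let ?a = "\<lambda>i. if i < length ls then ls ! i else 0"
  have anz: "?a i \<noteq> 0" if "i < 2 * k" for i
    using D that len by (simp add: is_diagonalization_def)
  have prod: "(\<Prod>i<2 * k. ?a i) = prod_list ls"
    unfolding prod.list_conv_set_nth len atLeast0LessThan by (rule prod.cong) (auto simp: len)
  \<comment> \<open>Write the cardinality as \<open>2 * h + 1\<close> and
    \<open>p = 2 * u + 1\<close>. The character of -1 is \<open>(-1) ^ h\<close>, and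
    \<open>h\<close> has the parity of \<open>u * m\<close>, so \<open>(-1) ^ k\<close> under the
    character contributes the sign \<open>(-1) ^ (u * m * k)\<close> of
    \<open>eps_sign\<close>.\<close>
  have sign: "quad_char ((- 1) ^ k * prod_list ls) = eps_sign \<iota> Q p m m1"
  proof -
    obtain u where u: "p = 2 * u + 1" using p by (metis oddE)
    have "even h \<longleftrightarrow> even (u * m)"
    proof -
      \<comment> \<open>Passing to the next power replaces \<open>g\<close> by
        \<open>g * p + u\<close>, which has the parity of \<open>g + u\<close> because
        \<open>p\<close> is odd.\<close>
      have "\<exists>g. p ^ m = 2 * g + 1 \<and> (even g \<longleftrightarrow> even (u * m))"
      proof (induction m)
        case (Suc m)
        then obtain g where g: "p ^ m = 2 * g + 1" "even g \<longleftrightarrow> even (u * m)" by blast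
        then have "p ^ Suc m = 2 * (g * p + u) + 1" by (simp add: u algebra_simps)
        moreover have "even (g * p + u) \<longleftrightarrow> even (u * Suc m)" using g(2) by (auto simp: u)
        ultimately show ?case by blast
      qed simp
      then show ?thesis using card_f cardp by auto
    qed
    then have h: "(- 1 :: int) ^ h = (- 1) ^ (u * m)" by (simp add: minus_one_power_iff)
    have "quad_char ((- 1) ^ i :: 'f) = ((- 1) ^ h) ^ i" for i
    proof (induction i)
      case 0
      then show ?case by (simp add: quad_char_1[OF card_f])
    next
      case (Suc i)
      then show ?case
        unfolding power_Suc quad_char_mult[OF card_f] quad_char_minus_one[OF card_f] by simp
    qed
    then have "quad_char ((- 1) ^ k * prod_list ls) = eps_Q \<iota> Q * (- 1) ^ (u * m * k)"
      by (simp add: quad_char_mult[OF card_f] eps h flip: power_mult)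
    moreover have "(p - 1) * m * (2 * k) div 4 = u * m * k"
    proof -
      have "(p - 1) * m * (2 * k) = 4 * (u * m * k)" by (simp add: u)
      then show ?thesis by (metis nonzero_mult_div_cancel_left zero_neq_numeral)
    qed
    ultimately show ?thesis by (simp add: eps_sign_def rank)
  qed
  have "int (diag_count ?a (2 * k) t) =
      int CARD('f) ^ (2 * j + 1) + quad_char ((- 1) ^ (j + 1) * (\<Prod>i<2 * k. ?a i)) * zero_weight t * int CARD('f) ^ j"
  proof -
    have "2 * k = 2 * j + 2" using j by simp
    then show ?thesis
      using diag_count_closed_form[OF card_f, of "2 * k" ?a] anz by blast
  qed
  also have "quad_char ((- 1) ^ (j + 1) * (\<Prod>i<2 * k. ?a i)) = eps_sign \<iota> Q p m m1"
    unfolding prod j[symmetric] by (rule sign)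
  finally have "real_of_int (int (diag_count ?a (2 * k) t)) =
      real_of_int (int CARD('f) ^ (2 * j + 1) + eps_sign \<iota> Q p m m1 * zero_weight t * int CARD('f) ^ j)"
    by (rule arg_cong)
  then have d: "real (diag_count ?a (2 * k) t) =
      real CARD('f) ^ (2 * j + 1) + real_of_int (eps_sign \<iota> Q p m m1 * zero_weight t) * real CARD('f) ^ j"
    by simp
  have "real (card {x. Q x = t}) = real CARD('f) ^ (m1 - 2 * k) * real (diag_count ?a (2 * k) t)"
    unfolding card_level_set[OF D] len by simp
  also have "\<dots> = real CARD('f) ^ (m1 - 2 * k) * real CARD('f) ^ (2 * j + 1)
      + real_of_int (eps_sign \<iota> Q p m m1 * zero_weight t) * (real CARD('f) ^ (m1 - 2 * k) * real CARD('f) ^ j)"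
    unfolding d by (simp only: algebra_simps)
  also have "real CARD('f) ^ (m1 - 2 * k) * real CARD('f) ^ (2 * j + 1) = real CARD('f) ^ (m1 - 1)"
  proof -
    have "m1 - 2 * k + (2 * j + 1) = m1 - 1" using m1 j by simp
    then show ?thesis by (metis power_add)
  qed
  also have "real CARD('f) ^ (m1 - 2 * k) * real CARD('f) ^ j = real CARD('f) ^ (m1 - 1) / real CARD('f) ^ k"
  proof -
    have "m1 - 2 * k + j + k = m1 - 1" using m1 j by simp
    then have "real CARD('f) ^ (m1 - 2 * k) * real CARD('f) ^ j * real CARD('f) ^ k = real CARD('f) ^ (m1 - 1)"
      by (metis power_add)
    then show ?thesis by (simp add: field_simps)
  qed
  finally show "real (card {x. Q x = t}) = real CARD('f) ^ (m1 - 1) +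
      real_of_int (eps_sign \<iota> Q p m m1 * zero_weight t) * (real CARD('f) ^ (m1 - 1) / real CARD('f) ^ k)" .
qed

end

subsection \<open>Powers of a root of unity modulo the prime field\<close>

locale descent =
  fixes \<iota>0 :: "'p::{field,finite} \<Rightarrow> 'f::{field,finite}" and p m N :: nat and \<theta> :: 'f
  assumes hom0: "is_field_hom \<iota>0" and prime_p: "prime p" and m: "m \<ge> 1"
    and card_p: "CARD('p) = p" and card_f: "CARD('f) = p ^ m"
    and N: "N > 0" "N dvd p - 1" "coprime N ((p ^ m - 1) div (p - 1))"
    and \<theta>: "\<theta> ^ ((p ^ m - 1) div N) = 1"
      "\<forall>k. 0 < k \<and> k < (p ^ m - 1) div N \<longrightarrow> \<theta> ^ k \<noteq> 1"
begin

sublocale T0: trace_setup \<iota>0 p 1 m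
  using hom0 prime_p card_p card_f m by unfold_locales simp_all

abbreviation Tr0 :: "'f \<Rightarrow> 'p" where "Tr0 \<equiv> trace_into \<iota>0 p m"

abbreviation n :: nat where "n \<equiv> (p ^ m - 1) div N"

lemma p_gt_1: "p > 1"
  using prime_p by (rule prime_gt_1_nat)

lemma pred_p_dvd: "p - 1 dvd p ^ m - 1"
proof -
  have "p - 1 dvd p ^ i - 1" for i
  proof (induction i)
    case (Suc i)
    have "p ^ Suc i - 1 = (p ^ i - 1) * p + (p - 1)"
    proof -
      have "p ^ i \<ge> 1" using p_gt_1 by simp
      then show ?thesis using p_gt_1 by (simp add: algebra_simps)
    qed
    then show ?case using Suc by simp
  qed simp
  then show ?thesis .
qed

lemma n_times_N: "n * N = p ^ m - 1"
  using N(2) pred_p_dvd by (metis dvd_div_mult_self dvd_trans)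

lemma n_pos: "n > 0"
proof -
  have "p ^ m > 1" using p_gt_1 m by (intro one_less_power) auto
  then show ?thesis using n_times_N by (metis gr0I mult_0 zero_less_diff less_irrefl)
qed

lemma n_factor: "n = ((p ^ m - 1) div (p - 1)) * ((p - 1) div N)"
proof -
  have "((p ^ m - 1) div (p - 1)) * ((p - 1) div N) * N = n * N"
    using N(2) pred_p_dvd n_times_N by (simp add: mult.assoc)
  then show ?thesis using N(1) by simp
qed

lemma theta_nonzero: "\<theta> \<noteq> 0"
  using \<theta>(1) n_pos by (metis power_eq_0_iff zero_neq_one power_0_left not_gr_zero)

lemma theta_power_eq_1: "\<theta> ^ k = 1 \<Longrightarrow> n dvd k"
proof -
  assume k: "\<theta> ^ k = 1"
  have "\<theta> ^ k = (\<theta> ^ n) ^ (k div n) * \<theta> ^ (k mod n)"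
    by (simp flip: power_mult power_add)
  then have "\<theta> ^ (k mod n) = 1" using k \<theta>(1) by simp
  then have "k mod n = 0" using \<theta>(2) n_pos by (metis gr0I mod_less_divisor)
  then show ?thesis by auto
qed

text \<open>Raising to the power \<open>p - 1\<close> removes the prime field factors, so
  \<open>n\<close> divides \<open>(i - i') * (p - 1)\<close>. By \<open>n_factor\<close> both sides
  contain \<open>(p - 1) div N\<close>; after cancelling it, coprimality removes the factor
  \<open>N\<close>.\<close>

lemma prime_field_multiples_of_theta:
  assumes c: "c \<noteq> 0" "c' \<noteq> 0" and eq: "\<iota>0 c * \<theta> ^ i = \<iota>0 c' * \<theta> ^ i'" and le: "i' \<le> i"
  shows "(p ^ m - 1) div (p - 1) dvd i - i'"
proof -
  let ?l = "(p ^ m - 1) div (p - 1)" and ?e = "(p - 1) div N"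
  have "\<iota>0 c * \<theta> ^ (i - i') * \<theta> ^ i' = \<iota>0 c' * \<theta> ^ i'"
    using eq le by (simp add: mult.assoc flip: power_add)
  then have "\<iota>0 c * \<theta> ^ (i - i') = \<iota>0 c'" using theta_nonzero by simp
  then have "\<iota>0 c ^ (p - 1) * \<theta> ^ ((i - i') * (p - 1)) = \<iota>0 c' ^ (p - 1)"
    by (metis power_mult power_mult_distrib)
  moreover have "\<iota>0 d ^ (p - 1) = 1" if "d \<noteq> 0" for d
    using power_card_pred[OF that] card_p
    by (simp add: field_hom_one[OF hom0] flip: field_hom_power[OF hom0])
  ultimately have "\<theta> ^ ((i - i') * (p - 1)) = 1" using c by simp
  then have "n dvd (i - i') * (p - 1)" by (rule theta_power_eq_1)
  moreover have "(i - i') * (p - 1) = (i - i') * N * ?e" using N(2) by (simp add: mult.assoc)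
  ultimately have "?l * ?e dvd (i - i') * N * ?e"
    unfolding n_factor by (simp only:)
  moreover have "?e \<noteq> 0" using n_factor n_pos by (metis mult_0_right less_irrefl)
  ultimately have "?l dvd (i - i') * N" by simp
  then show ?thesis using N(3) by (simp add: coprime_dvd_mult_left_iff coprime_commute)
qed

text \<open>Every nonzero \<open>u\<close> has the same number of representations \<open>c \<theta>\<^sup>i\<close> with \<open>c\<close> in the prime field:
  no \<open>u\<close> has more than \<open>(p - 1) / N\<close> of them, and this is also the average number.\<close>
lemma card_representations:
  assumes u: "u \<noteq> 0"
  shows "card {(i, c) \<in> {..<n} \<times> (UNIV - {0}). \<iota>0 c * \<theta> ^ i = u} = (p - 1) div N"
proof -
  let ?e = "(p - 1) div N" and ?l = "(p ^ m - 1) div (p - 1)"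
  let ?X = "{..<n} \<times> (UNIV - {0 :: 'p})"
  define F where "F u = {(i, c) \<in> ?X. \<iota>0 c * \<theta> ^ i = u}" for u
  have le: "card (F u) \<le> ?e" for u
  proof -
    \<comment> \<open>All exponents in \<open>F u\<close> are congruent modulo \<open>?l\<close>, so
      the quotient alone determines \<open>i\<close>, and then \<open>c\<close>. Since
      \<open>i < ?l * ?e\<close>, there are at most \<open>?e\<close> quotients.\<close>
    let ?g = "\<lambda>(i, c :: 'p). i div ?l"
    have l: "?l > 0" using n_factor n_pos by (metis gr0I mult_0 less_irrefl)
    have "inj_on ?g (F u)"
    proof (rule inj_onI)
      fix z z' assume z: "z \<in> F u" "z' \<in> F u" "?g z = ?g z'"
      obtain i c i' c' where zz: "z = (i, c)" "z' = (i', c')" by (metis surj_pair)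
      then have d: "i div ?l = i' div ?l" using z(3) by simp
      have ne: "c \<noteq> 0" "c' \<noteq> 0" and eq: "\<iota>0 c * \<theta> ^ i = \<iota>0 c' * \<theta> ^ i'"
        using z(1,2) zz by (auto simp: F_def)
      have "i mod ?l = i' mod ?l"
      proof (cases "i' \<le> i")
        case True
        then show ?thesis using prime_field_multiples_of_theta[OF ne eq] by (metis mod_eq_dvd_iff_nat)
      next
        case False
        then show ?thesis
          using prime_field_multiples_of_theta[OF ne(2,1) eq[symmetric]] by (metis mod_eq_dvd_iff_nat nat_le_linear)
      qed
      then have i: "i = i'" using d by (metis div_mult_mod_eq)
      then have "\<iota>0 c = \<iota>0 c'" using eq theta_nonzero by simp
      then show "z = z'" using i zz field_hom_inj[OF hom0] by (auto dest: injD)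
    qed
    moreover have "?g ` F u \<subseteq> {..<?e}"
    proof
      fix y assume "y \<in> ?g ` F u"
      then obtain i where i: "y = i div ?l" "i < ?l * ?e" unfolding F_def n_factor by auto
      then show "y \<in> {..<?e}" by (simp add: less_mult_imp_div_less mult.commute)
    qed
    ultimately show ?thesis by (metis card_inj_on_le card_lessThan finite_lessThan)
  qed
  \<comment> \<open>Each of the \<open>n * (p - 1)\<close> pairs represents exactly one nonzero
    element, which fixes the average.\<close>
  have total: "(\<Sum>u\<in>UNIV - {0}. card (F u)) = (\<Sum>u\<in>UNIV - {0 :: 'f}. ?e)"
  proof -
    have "(\<Sum>u\<in>UNIV - {0}. card (F u)) =
        (\<Sum>u\<in>UNIV - {0}. \<Sum>z\<in>{z \<in> ?X. (case z of (i, c) \<Rightarrow> \<iota>0 c * \<theta> ^ i) = u}. 1)"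
    proof (rule sum.cong)
      fix u :: 'f
      have "{z \<in> ?X. (case z of (i, c) \<Rightarrow> \<iota>0 c * \<theta> ^ i) = u} = F u" by (auto simp: F_def)
      then show "card (F u) = (\<Sum>z\<in>{z \<in> ?X. (case z of (i, c) \<Rightarrow> \<iota>0 c * \<theta> ^ i) = u}. 1)"
        by (simp only: card_eq_sum)
    qed simp
    also have "\<dots> = (\<Sum>z\<in>?X. 1)"
      by (rule sum.group) (auto simp: theta_nonzero field_hom_eq_0_iff[OF hom0])
    also have "\<dots> = n * (p - 1)"
      by (simp add: card_cartesian_product card_Diff_singleton card_p)
    also have "\<dots> = n * N * ?e" using N(2) by (simp add: mult.assoc)
    also have "\<dots> = (\<Sum>u\<in>UNIV - {0 :: 'f}. ?e)"
      unfolding n_times_N by (simp add: card_Diff_singleton card_f)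
    finally show ?thesis .
  qed
  have "card (F u) = ?e"
  proof (rule ccontr)
    assume "card (F u) \<noteq> ?e"
    then have "card (F u) < ?e" using le[of u] by simp
    then have "(\<Sum>u\<in>UNIV - {0}. card (F u)) < (\<Sum>u\<in>UNIV - {0 :: 'f}. ?e)"
      using le u by (intro sum_strict_mono_ex1) auto
    then show False using total by simp
  qed
  then show ?thesis by (simp add: F_def)
qed

text \<open>A nonzero prime field factor does not affect whether a trace vanishes. So the pairs in
  \<open>?Y\<close> count each index of \<open>?I\<close> exactly \<open>p - 1\<close> times and, by
  \<open>card_representations\<close>, each element of \<open>?U\<close> exactly \<open>?e\<close>
  times. Hence \<open>N * card ?I = card ?U\<close>, and the trace fibres give the size of
  \<open>?U\<close>.\<close>

lemma card_nonzero_traces: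
  assumes v: "v \<noteq> 0"
  shows "real N * real (card {i\<in>{..<n}. Tr0 (v * \<theta> ^ i) \<noteq> 0}) = real p ^ m * (real p - 1) / real p"
proof -
  let ?e = "(p - 1) div N" and ?I = "{i\<in>{..<n}. Tr0 (v * \<theta> ^ i) \<noteq> 0}"
  let ?U = "{u. Tr0 (v * u) \<noteq> 0}"
  let ?X = "{..<n} \<times> (UNIV - {0 :: 'p})"
  let ?Y = "{z \<in> ?X. Tr0 (v * (\<iota>0 (snd z) * \<theta> ^ fst z)) \<noteq> 0}"
  have tr: "Tr0 (v * (\<iota>0 c * u)) = c * Tr0 (v * u)" for c u
    using T0.trace_scale[of c "v * u"] by (simp add: mult_ac)
  have "card ?Y = (\<Sum>z\<in>?Y. 1)" by simp
  also have "\<dots> = (\<Sum>u\<in>?U. \<Sum>z\<in>{z \<in> ?Y. \<iota>0 (snd z) * \<theta> ^ fst z = u}. 1)"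
    by (rule sum.group[symmetric]) auto
  also have "\<dots> = (\<Sum>u\<in>?U. ?e)"
  proof (rule sum.cong)
    fix u assume u: "u \<in> ?U"
    then have "u \<noteq> 0" using T0.trace_zero by auto
    have "{z \<in> ?Y. \<iota>0 (snd z) * \<theta> ^ fst z = u} = {(i, c) \<in> ?X. \<iota>0 c * \<theta> ^ i = u}"
      using u by auto
    then show "(\<Sum>z\<in>{z \<in> ?Y. \<iota>0 (snd z) * \<theta> ^ fst z = u}. 1) = ?e"
      using card_representations[OF \<open>u \<noteq> 0\<close>] by simp
  qed simp
  finally have 1: "card ?Y = card ?U * ?e" by simp
  have "?Y = ?I \<times> (UNIV - {0})" by (auto simp: tr)
  then have "card ?Y = card ?I * (p - 1)"
    by (simp add: card_cartesian_product card_Diff_singleton card_p)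
  also have "\<dots> = card ?I * N * ?e" using N(2) by simp
  finally have "card ?I * N * ?e = card ?U * ?e" using 1 by simp
  moreover have "?e > 0" using n_factor n_pos by (metis gr0I mult_0_right less_irrefl)
  ultimately have IU: "N * card ?I = card ?U" by (simp add: mult.commute)
  have "real (card ?U) = real p ^ m * (real p - 1) / real p"
  proof -
    have k: "p * card {u. Tr0 (v * u) = 0} = p ^ m"
      using T0.card_trace_fibre[OF v, of 0] card_f by simp
    have "?U = UNIV - {u. Tr0 (v * u) = 0}" by auto
    then have "card ?U = p ^ m - card {u. Tr0 (v * u) = 0}"
      by (simp add: card_Diff_subset card_f)
    moreover have "card {u. Tr0 (v * u) = 0} \<le> p ^ m"
      using card_mono[of "UNIV :: 'f set" "{u. Tr0 (v * u) = 0}"] card_f by simp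
    ultimately have "real (card ?U) = real (p ^ m) - real (card {u. Tr0 (v * u) = 0})" by simp
    moreover have "real (card {u. Tr0 (v * u) = 0}) = real (p ^ m) / real p"
    proof -
      have "real p * real (card {u. Tr0 (v * u) = 0}) = real (p ^ m)"
        using k by (metis of_nat_mult)
      then show ?thesis using p_gt_1 by (simp add: field_simps)
    qed
    ultimately show ?thesis using p_gt_1 by (simp add: diff_divide_distrib right_diff_distrib)
  qed
  then show ?thesis unfolding of_nat_mult[symmetric] IU .
qed

end

subsection \<open>Supports and weights\<close>

text \<open>A coordinate in the support of \<open>K\<close> is nonzero on exactly \<open>(1 - 1/p) |K|\<close> codewords.\<close>
lemma card_supp_set:
  fixes K :: "('i \<Rightarrow> 'p::{field,finite}) set"
  assumes sub: "module.subspace fscale K" and finK: "finite K" and finS: "finite (supp_set K)"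
  shows "CARD('p) * (\<Sum>v\<in>K. card {j. v j \<noteq> 0}) = card (supp_set K) * (CARD('p) - 1) * card K"
proof -
  interpret vector_space fscale by (rule vector_space_fscale)
  have K: "add_subgroup K"
    using subspace_0[OF sub] subspace_diff[OF sub] by (simp add: add_subgroup_def)
  have coord: "CARD('p) * card {v\<in>K. v j \<noteq> 0} = (CARD('p) - 1) * card K" if "j \<in> supp_set K" for j
  proof -
    obtain w where w: "w \<in> K" "w j \<noteq> 0" using \<open>j \<in> supp_set K\<close> by (auto simp: supp_set_def)
    \<comment> \<open>Scaling one word that is nonzero at \<open>j\<close> reaches every value, so
      the evaluation at \<open>j\<close> is onto and its kernel is a \<open>p\<close>-th of
      \<open>K\<close>.\<close>
    have "(\<lambda>v. v j) ` K = UNIV"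
    proof (intro equalityI subsetI)
      fix a :: 'p
      have "fscale (a / w j) w \<in> K" using subspace_scale[OF sub w(1)] .
      then show "a \<in> (\<lambda>v. v j) ` K"
        by (rule rev_image_eqI) (use w in \<open>simp add: fscale_def\<close>)
    qed simp
    then have z: "card K = CARD('p) * card {v\<in>K. v j = 0}"
      using card_additive_image[OF K finK, of "\<lambda>v. v j"] by simp
    have "card K = card ({v\<in>K. v j = 0} \<union> {v\<in>K. v j \<noteq> 0})"
      by (rule arg_cong[where f = card]) auto
    also have "\<dots> = card {v\<in>K. v j = 0} + card {v\<in>K. v j \<noteq> 0}"
      using finK by (intro card_Un_disjoint) auto
    finally have "CARD('p) * card K = card K + CARD('p) * card {v\<in>K. v j \<noteq> 0}"
      using z by (simp only: distrib_left)
    then show ?thesis by (simp add: diff_mult_distrib)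
  qed
  have "(\<Sum>v\<in>K. card {j. v j \<noteq> 0}) = (\<Sum>v\<in>K. \<Sum>j\<in>{j\<in>supp_set K. v j \<noteq> 0}. 1)"
    by (rule sum.cong) (auto simp: supp_set_def intro: arg_cong[where f = card])
  also have "\<dots> = (\<Sum>j\<in>supp_set K. \<Sum>v\<in>{v\<in>K. v j \<noteq> 0}. 1)"
    by (rule sum.swap_restrict[OF finK finS])
  finally have "CARD('p) * (\<Sum>v\<in>K. card {j. v j \<noteq> 0}) = (\<Sum>j\<in>supp_set K. CARD('p) * card {v\<in>K. v j \<noteq> 0})"
    by (simp add: sum_distrib_left)
  also have "\<dots> = (\<Sum>j\<in>supp_set K. (CARD('p) - 1) * card K)"
    by (rule sum.cong) (use coord in auto)
  finally show ?thesis by simp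
qed

text \<open>The space grows by one dimension at a time, by adjoining any \<open>z\<close> outside
  it. Closure under \<open>\<iota>\<close> lets the lemma serve subspaces of both \<open>'f\<close>
  and \<open>'b\<close> over the prime field.\<close>

lemma ex_subspace_of_card:
  fixes \<iota> :: "'p::{field,finite} \<Rightarrow> 'l::{field,finite}"
  assumes hom: "is_field_hom \<iota>" and card: "CARD('l) = CARD('p) ^ n" and j: "j \<le> n"
  shows "\<exists>U. add_subgroup U \<and> (\<forall>c. \<forall>x\<in>U. \<iota> c * x \<in> U) \<and> card U = CARD('p) ^ j"
  using j
proof (induction j)
  case 0
  have "add_subgroup {0 :: 'l}" by (simp add: add_subgroup_def)
  then show ?case by (intro exI[of _ "{0}"]) simp
next
  case (Suc j)
  then obtain U where U: "add_subgroup U" "\<And>c x. x \<in> U \<Longrightarrow> \<iota> c * x \<in> U" "card U = CARD('p) ^ j"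
    by auto
  have p: "CARD('p) > 1"
    using card_mono[of "UNIV :: 'p set" "{0, 1}"] by simp
  have "card U < CARD('l)"
    unfolding U(3) card using p Suc.prems by (intro power_strict_increasing) auto
  then obtain z where z: "z \<notin> U" by (metis UNIV_eq_I less_irrefl)
  let ?f = "\<lambda>(u, c). u + \<iota> c * z"
  have inj: "inj_on ?f (U \<times> UNIV)"
  proof (rule inj_onI, clarsimp)
    fix u c u' c' assume u: "u \<in> U" "u' \<in> U" and eq: "u + \<iota> c * z = u' + \<iota> c' * z"
    have "c = c'"
    \<comment> \<open>Different coefficients of \<open>z\<close> would express \<open>z\<close> by
      elements of \<open>U\<close>.\<close>
    proof (rule ccontr)
      assume ne: "c \<noteq> c'"
      have "\<iota> (c - c') * z = u' - u"
        using eq by (simp add: field_hom_diff[OF hom] algebra_simps)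
      then have "\<iota> (c - c') * z \<in> U" using add_subgroup_diff[OF U(1) u(2,1)] by simp
      then have "\<iota> (inverse (c - c')) * (\<iota> (c - c') * z) \<in> U" by (rule U(2))
      moreover have "\<iota> (inverse (c - c')) * \<iota> (c - c') = 1"
        using ne by (simp add: field_hom_one[OF hom] flip: field_hom_mult[OF hom])
      ultimately show False using z by (simp flip: mult.assoc)
    qed
    then show "u = u' \<and> c = c'" using eq by simp
  qed
  have "add_subgroup (?f ` (U \<times> UNIV))"
    unfolding add_subgroup_def
  proof (intro conjI ballI)
    show "0 \<in> ?f ` (U \<times> UNIV)"
      using add_subgroup_zero[OF U(1)] by (intro image_eqI[of _ _ "(0, 0)"]) (auto simp: field_hom_zero[OF hom])
    fix x y assume "x \<in> ?f ` (U \<times> UNIV)" "y \<in> ?f ` (U \<times> UNIV)"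
    then obtain u c u' c' where *: "u \<in> U" "u' \<in> U" "x = u + \<iota> c * z" "y = u' + \<iota> c' * z" by auto
    show "x - y \<in> ?f ` (U \<times> UNIV)"
      by (rule image_eqI[of _ _ "(u - u', c - c')"])
         (use * U(1) in \<open>auto simp: field_hom_diff[OF hom] algebra_simps intro: add_subgroup_diff\<close>)
  qed
  moreover have "\<iota> c * x \<in> ?f ` (U \<times> UNIV)" if x: "x \<in> ?f ` (U \<times> UNIV)" for c x
  proof -
    obtain u d where "u \<in> U" "x = u + \<iota> d * z" using x by auto
    then show ?thesis
      by (intro image_eqI[of _ _ "(\<iota> c * u, c * d)"])
         (simp_all add: field_hom_mult[OF hom] distrib_left mult.assoc U(2))
  qed
  moreover have "card (?f ` (U \<times> UNIV)) = CARD('p) ^ Suc j"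
    using card_image[OF inj] U(3) by (simp add: card_cartesian_product)
  ultimately show ?case by blast
qed

subsection \<open>Additive subgroups of the plane\<close>

text \<open>For \<open>z = (a, c)\<close> the argument of \<open>e\<close> is the value that
  \<open>Q\<close> must take for \<open>a * Q x + c\<close> to vanish.\<close>

definition ratio_sum :: "('f::{field,finite} \<Rightarrow> real) \<Rightarrow> ('f \<times> 'f) set \<Rightarrow> real" where
  "ratio_sum e G = (\<Sum>z\<in>{z\<in>G. fst z \<noteq> 0}. e (- (snd z / fst z)))"

text \<open>The quantity by which a subcode of fixed dimension undercuts the largest conceivable support;
  see \<open>card_supp_word\<close>.\<close>
definition deficit :: "('f::{field,finite} \<Rightarrow> real) \<Rightarrow> real \<Rightarrow> ('f \<times> 'f) set \<Rightarrow> real" where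
  "deficit e A G = ratio_sum e G - A * (real (card {z\<in>G. fst z = 0}) - 1)"

text \<open>\<open>q\<close> is a parameter so that the locale can be interpreted with
  \<open>real p ^ m\<close>.\<close>

locale plane_subgroup =
  fixes G :: "('f::{field,finite} \<times> 'f) set" and q :: real
  assumes G: "add_subgroup G" and q: "q = real CARD('f)"
begin

abbreviation g :: real where "g \<equiv> real (card G)"
abbreviation g0 :: real where "g0 \<equiv> real (card {z\<in>G. fst z = 0})"
abbreviation g1 :: real where "g1 \<equiv> real (card {z\<in>G. snd z = 0})"

lemma q_gt_1: "q > 1"
  using card_mono[of "UNIV :: 'f set" "{0, 1}"] by (simp add: q)

lemma card_le_kernel:
  fixes f :: "'f \<times> 'f \<Rightarrow> 'f"
  assumes "\<And>x y. f (x - y) = f x - f y"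
  shows "g \<le> q * real (card {z\<in>G. f z = 0})"
proof -
  have "card G = card (f ` G) * card {z\<in>G. f z = 0}"
    by (rule card_additive_image[OF G]) (simp_all add: assms)
  also have "\<dots> \<le> CARD('f) * card {z\<in>G. f z = 0}"
    by (intro mult_right_mono card_mono) auto
  finally have "g \<le> real (CARD('f) * card {z\<in>G. f z = 0})" by (simp only: of_nat_le_iff)
  then show ?thesis by (simp add: q)
qed

lemma g_le_g0: "g \<le> q * g0" and g_le_g1: "g \<le> q * g1"
  using card_le_kernel[of fst] card_le_kernel[of snd] by simp_all

lemma zero_in_G: "(0, 0) \<in> G"
  using add_subgroup_zero[OF G] by (simp add: zero_prod_def)

lemma g0_ge_1: "g0 \<ge> 1" and g1_ge_1: "g1 \<ge> 1" and g_ge_1: "g \<ge> 1"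
proof -
  have "0 < card S" if "(0, 0) \<in> S" for S :: "('f \<times> 'f) set"
    using that by (auto simp: card_gt_0_iff)
  then have "1 \<le> real (card S)" if "(0, 0) \<in> S" for S :: "('f \<times> 'f) set"
    using that by (simp add: Suc_le_eq)
  then show "g0 \<ge> 1" "g1 \<ge> 1" "g \<ge> 1" using zero_in_G by simp_all
qed

lemma g1_le_q: "g1 \<le> q"
proof -
  have "card {z\<in>G. snd z = 0} \<le> CARD('f)"
    by (rule card_inj_on_le[of fst]) (auto simp: inj_on_def prod_eq_iff)
  then show ?thesis by (simp add: q)
qed

text \<open>Elements with second coordinate 0 differ in the first, so there are at most as many as
  points in the first projection of \<open>G\<close>, whose fibres all have \<open>g0\<close>
  elements.\<close>

lemma g0_mult_g1: "g0 * g1 \<le> g"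
proof -
  have "card {z\<in>G. snd z = 0} \<le> card (fst ` G)"
    by (rule card_inj_on_le[of fst]) (auto simp: inj_on_def prod_eq_iff)
  moreover have "card G = card (fst ` G) * card {z\<in>G. fst z = 0}"
    by (rule card_additive_image[OF G]) simp_all
  ultimately have "card {z\<in>G. fst z = 0} * card {z\<in>G. snd z = 0} \<le> card G"
    by (simp add: mult.commute)
  then have "real (card {z\<in>G. fst z = 0} * card {z\<in>G. snd z = 0}) \<le> g" by (simp only: of_nat_le_iff)
  then show ?thesis by simp
qed

lemma card_fst_nonzero: "real (card {z\<in>G. fst z \<noteq> 0}) = g - g0"
proof -
  have "card G = card ({z\<in>G. fst z = 0} \<union> {z\<in>G. fst z \<noteq> 0})"
    by (rule arg_cong[where f = card]) auto
  also have "\<dots> = card {z\<in>G. fst z = 0} + card {z\<in>G. fst z \<noteq> 0}"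
    by (intro card_Un_disjoint) auto
  finally show ?thesis by simp
qed

text \<open>The ratio is 0 exactly when the second coordinate is. This happens \<open>g1 - 1\<close>
  times among the \<open>g - g0\<close> summands.\<close>

lemma ratio_sum_zero_weight:
  "ratio_sum (\<lambda>t. d * real_of_int (zero_weight t)) G = d * (q * (g1 - 1) - (g - g0))"
proof -
  let ?G = "{z\<in>G. fst z \<noteq> 0}"
  have "ratio_sum (\<lambda>t. d * real_of_int (zero_weight t)) G =
      (\<Sum>z\<in>?G. d * q * (if snd z = 0 then 1 else 0) - d)"
    unfolding ratio_sum_def by (rule sum.cong) (auto simp: zero_weight_def q algebra_simps)
  also have "\<dots> = d * q * (\<Sum>z\<in>?G. if snd z = 0 then 1 else 0) - d * (g - g0)"
    by (simp add: sum_subtractf card_fst_nonzero flip: sum_distrib_left)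
  also have "(\<Sum>z\<in>?G. if snd z = 0 then 1 else 0 :: real) = real (card {z\<in>?G. snd z = 0})"
    by (simp add: sum.If_cases Int_def)
  also have "{z\<in>?G. snd z = 0} = {z\<in>G. snd z = 0} - {(0, 0)}"
    by (auto simp: prod_eq_iff)
  also have "real (card \<dots>) = g1 - 1"
  proof -
    have "(0, 0) \<in> {z\<in>G. snd z = 0}" using zero_in_G by simp
    then have "card ({z\<in>G. snd z = 0} - {(0, 0)}) = card {z\<in>G. snd z = 0} - 1"
      by (rule card_Diff_singleton)
    then show ?thesis using g1_ge_1 by simp
  qed
  finally show ?thesis by (simp add: algebra_simps)
qed

text \<open>The lines through the origin partition \<open>G\<close>, and each of them meets \<open>G\<close> in at least \<open>|G| / q\<close>
  points. As \<open>\<chi>\<close> sums to \<open>0\<close>, only the excess over this bound contributes.\<close>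
lemma ratio_sum_character:
  fixes \<chi> :: "'f \<Rightarrow> real"
  assumes \<chi>0: "\<chi> 0 = 0" and le: "\<And>t. \<chi> t \<le> 1" and sum0: "(\<Sum>t\<in>UNIV. \<chi> t) = 0"
  shows "ratio_sum \<chi> G \<le> q - g / q" and "ratio_sum \<chi> G \<le> g - g0"
proof -
  let ?G = "{z\<in>G. fst z \<noteq> 0}"
  define \<kappa> where "\<kappa> t = real (card {z\<in>G. snd z + t * fst z = 0})" for t
  have line: "real (card {z\<in>?G. - (snd z / fst z) = t}) = \<kappa> t - 1" for t
  proof -
    have "{z\<in>?G. - (snd z / fst z) = t} = {z\<in>G. snd z + t * fst z = 0} - {(0, 0)}"
    proof (intro equalityI subsetI)
      fix z assume "z \<in> {z\<in>G. snd z + t * fst z = 0} - {(0, 0)}"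
      then have z: "z \<in> G" "snd z + t * fst z = 0" "z \<noteq> (0, 0)" by auto
      then have "fst z \<noteq> 0" by (auto simp: prod_eq_iff)
      moreover have "snd z = - t * fst z" using z(2) by (simp add: eq_neg_iff_add_eq_0)
      ultimately show "z \<in> {z\<in>?G. - (snd z / fst z) = t}" using z(1) by simp
    next
      fix z assume z: "z \<in> {z\<in>?G. - (snd z / fst z) = t}"
      then have "t * fst z = - snd z" by auto
      then show "z \<in> {z\<in>G. snd z + t * fst z = 0} - {(0, 0)}" using z by auto
    qed
    moreover have "(0, 0) \<in> {z\<in>G. snd z + t * fst z = 0}" using zero_in_G by simp
    moreover from this have "card {z\<in>G. snd z + t * fst z = 0} > 0"
      by (simp only: card_gt_0_iff finite) blast
    ultimately show ?thesis unfolding \<kappa>_def by (simp add: card_Diff_singleton)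
  qed
  have ge: "\<kappa> t \<ge> g / q" for t
  proof -
    have "g \<le> q * \<kappa> t" unfolding \<kappa>_def
      by (rule card_le_kernel) (simp add: algebra_simps)
    then show ?thesis using q_gt_1 by (simp add: field_simps)
  qed
  have group: "(\<Sum>z\<in>?G. F (- (snd z / fst z))) = (\<Sum>t\<in>UNIV. F t * (\<kappa> t - 1))" for F :: "'f \<Rightarrow> real"
  proof -
    have "(\<Sum>z\<in>?G. F (- (snd z / fst z))) =
        (\<Sum>t\<in>UNIV. \<Sum>z\<in>{z\<in>?G. - (snd z / fst z) = t}. F (- (snd z / fst z)))"
      by (rule sum.group[symmetric]) auto
    also have "\<dots> = (\<Sum>t\<in>UNIV. \<Sum>z\<in>{z\<in>?G. - (snd z / fst z) = t}. F t)"
      by (intro sum.cong) auto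
    also have "\<dots> = (\<Sum>t\<in>UNIV. F t * (\<kappa> t - 1))"
      by (simp add: mult.commute flip: line)
    finally show ?thesis .
  qed
  have "(\<Sum>t\<in>UNIV. \<kappa> t - 1) = g - g0"
    using group[of "\<lambda>_. 1"] card_fst_nonzero by simp
  then have sum_\<kappa>: "(\<Sum>t\<in>UNIV. \<kappa> t - g / q) = q - g0"
    using q_gt_1 by (simp add: sum_subtractf q[symmetric])
  have "ratio_sum \<chi> G = (\<Sum>t\<in>UNIV. \<chi> t * (\<kappa> t - 1))"
    unfolding ratio_sum_def by (rule group)
  \<comment> \<open>Subtracting the same constant from every line costs nothing because
    \<open>\<chi>\<close> sums to 0.\<close>
  also have "\<dots> = (\<Sum>t\<in>UNIV. \<chi> t * (\<kappa> t - g / q)) + (g / q - 1) * (\<Sum>t\<in>UNIV. \<chi> t)"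
    unfolding sum_distrib_left sum.distrib[symmetric] by (rule sum.cong) (simp_all add: algebra_simps)
  also have "\<dots> = (\<Sum>t\<in>UNIV. \<chi> t * (\<kappa> t - g / q))" by (simp add: sum0)
  \<comment> \<open>The excess is nonnegative, so \<open>\<chi>\<close> may be replaced by 1 except
    at 0, where \<open>\<chi>\<close> vanishes; the line for \<open>t = 0\<close> has
    \<open>g1\<close> points.\<close>
  also have "\<dots> \<le> (\<Sum>t\<in>UNIV. (\<kappa> t - g / q) - (if t = 0 then \<kappa> 0 - g / q else 0))"
  proof (rule sum_mono)
    fix t :: 'f
    have "\<chi> t * (\<kappa> t - g / q) \<le> 1 * (\<kappa> t - g / q)"
      by (intro mult_right_mono le) (use ge[of t] in simp)
    then show "\<chi> t * (\<kappa> t - g / q) \<le> (\<kappa> t - g / q) - (if t = 0 then \<kappa> 0 - g / q else 0)"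
      by (simp add: \<chi>0)
  qed
  also have "\<dots> = q - g0 - (g1 - g / q)"
    unfolding sum_subtractf[of "\<lambda>t. \<kappa> t - g / q"] sum_\<kappa> by (simp add: \<kappa>_def)
  also have "\<dots> \<le> q - g / q"
  proof -
    have "g / q \<le> g0" "g / q \<le> g1" using g_le_g0 g_le_g1 q_gt_1 by (simp_all add: field_simps)
    then show ?thesis by linarith
  qed
  finally show "ratio_sum \<chi> G \<le> q - g / q" .
  have "ratio_sum \<chi> G \<le> (\<Sum>z\<in>?G. 1)"
    unfolding ratio_sum_def by (rule sum_mono) (rule le)
  then show "ratio_sum \<chi> G \<le> g - g0" by (simp add: card_fst_nonzero)
qed

text \<open>The three bounds are attained in the three ranges of the dimension \<open>r\<close>, the last one
  with \<open>P = p\<^bsup>r - m(m\<^sub>2+1)\<^esup>\<close>; \<open>M\<close> is the maximum of \<open>e\<close>.\<close>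
definition deficit_bounded :: "('f \<Rightarrow> real) \<Rightarrow> real \<Rightarrow> real \<Rightarrow> bool" where
  "deficit_bounded e A M \<longleftrightarrow> deficit e A G \<le> (g - 1) * M \<and> deficit e A G \<le> (q - 1) * M \<and>
     (\<forall>P\<ge>1. q * P \<le> g \<longrightarrow> deficit e A G \<le> (q - P) * M - A * (P - 1))"

text \<open>Even rank with sign 1. From \<open>g0 * g1 \<le> g\<close> follows
  \<open>g1 - 1 \<le> g - g0\<close>, which bounds the ratio sum by
  \<open>d * ((q - 1) * (g1 - 1))\<close>; then \<open>g1 \<le> g\<close> and
  \<open>g1 \<le> q\<close> give the first two bounds.\<close>

lemma deficit_bounded_plus:
  assumes d: "d \<ge> 0" "q * d \<le> A"
  shows "deficit_bounded (\<lambda>t. d * real_of_int (zero_weight t)) A ((q - 1) * d)"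
proof -
  let ?E = "d * (q * (g1 - 1) - (g - g0))"
  have dA: "d \<le> A"
    using d q_gt_1 mult_right_mono[of 1 q d] by simp
  then have A: "A \<ge> 0" using d by simp
  have A0: "0 \<le> A * (g0 - 1)" using A g0_ge_1 by simp
  have "(g0 - 1) * (g1 - 1) \<ge> 0" using g0_ge_1 g1_ge_1 by simp
  then have "g1 - 1 \<le> g - g0" using g0_mult_g1 by (simp add: algebra_simps)
  then have E: "?E \<le> d * ((q - 1) * (g1 - 1))"
    by (intro mult_left_mono d) (simp add: algebra_simps)
  have "g1 \<le> g" by (simp add: card_mono)
  then have "d * ((q - 1) * (g1 - 1)) \<le> d * ((q - 1) * (g - 1))"
    using d q_gt_1 by (intro mult_left_mono) auto
  moreover have "d * ((q - 1) * (g1 - 1)) \<le> d * ((q - 1) * (q - 1))"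
    using d q_gt_1 g1_le_q by (intro mult_left_mono) auto
  moreover have "?E - A * (g0 - 1) \<le> (q - P) * ((q - 1) * d) - A * (P - 1)" if P: "P \<ge> 1" "q * P \<le> g" for P
  proof -
    have "q * P \<le> q * g0" using P g_le_g0 by linarith
    then have Pg: "P \<le> g0" using q_gt_1 by simp
    have "0 \<le> (A - d) * (g0 - P)" using dA Pg by simp
    moreover have "0 \<le> d * (g - q * P)" using d P by simp
    moreover have "0 \<le> q * d * (q - g1)" using d q_gt_1 g1_le_q by simp
    \<comment> \<open>The gap in the third bound is exactly the sum of these three nonnegative
      products.\<close>
    ultimately have "0 \<le> (A - d) * (g0 - P) + d * (g - q * P) + q * d * (q - g1)" by linarith
    also have "\<dots> = ((q - P) * ((q - 1) * d) - A * (P - 1)) - (?E - A * (g0 - 1))"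
      by (simp add: algebra_simps)
    finally show ?thesis by simp
  qed
  ultimately show ?thesis
    unfolding deficit_bounded_def deficit_def ratio_sum_zero_weight
    using A0 E by (auto simp: mult_ac)
qed

text \<open>Even rank with sign -1, where the maximum \<open>d\<close> is attained at every nonzero
  value. The hypothesis on \<open>A\<close> lets the penalty for \<open>g0\<close> outweigh the gain
  from a larger \<open>G\<close>.\<close>

lemma deficit_bounded_minus:
  assumes d: "d \<ge> 0" "q * d \<le> A"
  shows "deficit_bounded (\<lambda>t. (- d) * real_of_int (zero_weight t)) A d"
proof -
  let ?E = "(- d) * (q * (g1 - 1) - (g - g0))"
  have dA: "d \<le> A"
    using d q_gt_1 mult_right_mono[of 1 q d] by simp
  then have A: "A \<ge> 0" using d by simp
  have dq: "d * (q - 1) \<le> A" using d by (simp add: algebra_simps)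
  have E: "?E = d * (g - g0) - q * d * (g1 - 1)" by (simp add: algebra_simps)
  have E1: "0 \<le> q * d * (g1 - 1)" using d q_gt_1 g1_ge_1 by simp
  have A0: "0 \<le> A * (g0 - 1)" using A g0_ge_1 by simp
  have "d * (g - g0) \<le> d * (g - 1)"
    using d g0_ge_1 by (intro mult_left_mono) auto
  then have 1: "?E - A * (g0 - 1) \<le> (g - 1) * d"
    using E E1 A0 by (simp add: mult.commute)
  \<comment> \<open>By \<open>g \<le> q * g0\<close> the deficit lies below a function that does not
    increase in \<open>g0\<close> or \<open>g1\<close>. Inserting 1 for both gives the second bound.
    In the third range both are at least \<open>P\<close>, and inserting \<open>P\<close> gives the
    bound exactly.\<close>
  have up: "?E - A * (g0 - 1) \<le> d * (q - 1) - q * d * (g1 - 1) - (A - d * (q - 1)) * (g0 - 1)"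
  proof -
    have "d * (g - g0) \<le> d * (q * g0 - g0)"
      using d g_le_g0 by (intro mult_left_mono) auto
    then show ?thesis unfolding E by (simp add: algebra_simps)
  qed
  have "0 \<le> (A - d * (q - 1)) * (g0 - 1)" using dq g0_ge_1 by simp
  then have 2: "?E - A * (g0 - 1) \<le> (q - 1) * d"
    using up E1 by (simp add: mult.commute)
  have 3: "?E - A * (g0 - 1) \<le> (q - P) * d - A * (P - 1)" if P: "P \<ge> 1" "q * P \<le> g" for P
  proof -
    have "q * P \<le> q * g0" "q * P \<le> q * g1" using P g_le_g0 g_le_g1 by linarith+
    then have Pg: "P \<le> g0" "P \<le> g1" using q_gt_1 by simp_all
    have "q * d * (P - 1) \<le> q * d * (g1 - 1)" using d q_gt_1 Pg by (intro mult_left_mono) auto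
    moreover have "(A - d * (q - 1)) * (P - 1) \<le> (A - d * (q - 1)) * (g0 - 1)"
      using dq Pg by (intro mult_left_mono) auto
    ultimately have "?E - A * (g0 - 1) \<le> d * (q - 1) - q * d * (P - 1) - (A - d * (q - 1)) * (P - 1)"
      using up by linarith
    also have "\<dots> = (q - P) * d - A * (P - 1)" by (simp add: algebra_simps)
    finally show ?thesis .
  qed
  show ?thesis
    unfolding deficit_bounded_def deficit_def ratio_sum_zero_weight using 1 2 3 by blast
qed

text \<open>Odd rank. For the second bound, \<open>q - g / q\<close> suffices if
  \<open>g \<ge> q\<close>, and the trivial estimate \<open>g - g0\<close> otherwise. For the third,
  \<open>P \<le> g / q\<close> and \<open>P \<le> g0\<close> control the two terms of the deficit
  separately.\<close>

lemma deficit_bounded_character: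
  fixes \<chi> :: "'f \<Rightarrow> real"
  assumes \<chi>: "\<chi> 0 = 0" "\<And>t. \<chi> t \<le> 1" "(\<Sum>t\<in>UNIV. \<chi> t) = 0"
    and d: "d \<ge> 0" and A: "A \<ge> 0"
  shows "deficit_bounded (\<lambda>t. d * \<chi> t) A d"
proof -
  let ?X = "ratio_sum \<chi> G"
  have E: "ratio_sum (\<lambda>t. d * \<chi> t) G = ?X * d"
    unfolding ratio_sum_def by (simp add: sum_distrib_left mult.commute)
  note X = ratio_sum_character[OF \<chi>]
  have A0: "0 \<le> A * (g0 - 1)" using A g0_ge_1 by simp
  have "?X * d \<le> (g - 1) * d"
    using X(2) g0_ge_1 d by (intro mult_right_mono) auto
  moreover have "?X * d \<le> (q - 1) * d"
  proof (rule mult_right_mono)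
    show "?X \<le> q - 1"
    proof (cases "g \<ge> q")
      case True
      then have "g / q \<ge> 1" using q_gt_1 by simp
      then show ?thesis using X(1) by linarith
    qed (use X(2) g0_ge_1 in linarith)
  qed (rule d)
  moreover have "?X * d - A * (g0 - 1) \<le> (q - P) * d - A * (P - 1)" if P: "P \<ge> 1" "q * P \<le> g" for P
  proof -
    have "q * P \<le> q * g0" using P g_le_g0 by linarith
    then have "P \<le> g0" using q_gt_1 by simp
    then have "A * (P - 1) \<le> A * (g0 - 1)" using A by (intro mult_left_mono) auto
    moreover have "P \<le> g / q" using P q_gt_1 by (simp add: field_simps)
    then have "?X * d \<le> (q - P) * d" using X(1) d by (intro mult_right_mono) auto
    ultimately show ?thesis by linarith
  qed
  ultimately show ?thesis
    unfolding deficit_bounded_def deficit_def E using A0 by auto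
qed

end

subsection \<open>The descended code\<close>

lemma sum_filter_split:
  "finite K \<Longrightarrow> sum f K = sum f {k\<in>K. P k} + sum f {k\<in>K. \<not> P k}"
  by (subst sum.union_disjoint[symmetric]) (auto intro: sum.cong)

text \<open>The weights see \<open>Q\<close> only through the sizes of its level sets, so
  \<open>Q\<close> is a mere function here; the theory of quadratic forms enters through
  \<open>excess\<close> at the end.\<close>

locale code_setup = descent \<iota>0 p m N \<theta>
  for \<iota>0 :: "'p::{field,finite} \<Rightarrow> 'f::{field,finite}" and p m N :: nat and \<theta> :: 'f +
  fixes \<iota>2 :: "'f \<Rightarrow> 'b::{field,finite}" and Q :: "'a::{field,finite} \<Rightarrow> 'f" and m1 m2 :: nat
  assumes hom2: "is_field_hom \<iota>2" and m1: "m1 \<ge> 1" and m2: "m2 \<ge> 1"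
    and card_a: "CARD('a) = (p ^ m) ^ m1" and card_b: "CARD('b) = (p ^ m) ^ m2"
    and Q_0: "Q 0 = 0" and Q_nonzero: "\<exists>x. Q x \<noteq> 0"
begin

sublocale T2: trace_setup \<iota>2 p m m2
  using hom2 prime_p card_f card_b m2 by unfold_locales simp_all

abbreviation Tr2 :: "'b \<Rightarrow> 'f" where "Tr2 \<equiv> trace_into \<iota>2 (p ^ m) m2"

definition word :: "'f \<times> 'b \<times> 'f \<Rightarrow> (('a \<times> 'b) \<times> nat) \<Rightarrow> 'p" where
  "word = (\<lambda>(a, b, c). (\<lambda>((x, y), i). if i < (p ^ m - 1) div N
     then Tr0 ((a * Q x + Tr2 (b * y) + c) * \<theta> ^ i) else 0))"

text \<open>The entry at \<open>z\<close> of the codeword over \<open>'f\<close> before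
  descent.\<close>

definition val :: "'f \<times> 'b \<times> 'f \<Rightarrow> 'a \<times> 'b \<Rightarrow> 'f" where
  "val k z = fst k * Q (fst z) + Tr2 (fst (snd k) * snd z) + snd (snd k)"

text \<open>The action of the prime field on parameters that \<open>word\<close> turns into
  \<open>fscale\<close>.\<close>

definition scale :: "'p \<Rightarrow> 'f \<times> 'b \<times> 'f \<Rightarrow> 'f \<times> 'b \<times> 'f" where
  "scale s k = (\<iota>0 s * fst k, \<iota>2 (\<iota>0 s) * fst (snd k), \<iota>0 s * snd (snd k))"

abbreviation q :: real where "q \<equiv> real p ^ m"

definition A :: real where "A = q ^ (m1 - 1)"

definition excess :: "'f \<Rightarrow> real" where
  "excess t = real (card {x. Q x = t}) - A"

lemma q_gt_1: "q > 1"
  using p_gt_1 m by (intro one_less_power) auto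

lemma q_nonzero: "q \<noteq> 0"
  using q_gt_1 by linarith

lemma q_power_m1: "q ^ m1 = q * A"
  using m1 by (simp add: A_def power_eq_if)

lemma real_card_a: "real CARD('a) = q * A"
  by (simp only: card_a of_nat_power q_power_m1)

lemma word_eq: "word k = (\<lambda>(z, i). if i < n then Tr0 (val k z * \<theta> ^ i) else 0)"
  by (auto simp: word_def val_def fun_eq_iff split: prod.split)

lemma val_diff: "val (k - k') z = val k z - val k' z"
  by (simp add: val_def T2.trace_diff algebra_simps)

lemma word_diff: "word (k - k') = word k - word k'"
  by (auto simp: word_eq fun_eq_iff val_diff left_diff_distrib T0.trace_diff[simplified])

lemma val_scale: "val (scale s k) z = \<iota>0 s * val k z"
  using T2.trace_scale[of "\<iota>0 s" "fst (snd k) * snd z"]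
  by (simp add: val_def scale_def algebra_simps)

lemma word_scale: "word (scale s k) = fscale s (word k)"
proof -
  have "Tr0 (\<iota>0 s * (val k z * \<theta> ^ i)) = s * Tr0 (val k z * \<theta> ^ i)" for z i
    using T0.trace_scale[of s "val k z * \<theta> ^ i"] by simp
  then show ?thesis by (auto simp: word_eq fscale_def fun_eq_iff val_scale mult.assoc)
qed

definition nonzeros :: "'f \<times> 'b \<times> 'f \<Rightarrow> ('a \<times> 'b) set" where
  "nonzeros k = {z. val k z \<noteq> 0}"

lemma word_support: "{j. word k j \<noteq> 0} = (SIGMA z:nonzeros k. {i\<in>{..<n}. Tr0 (val k z * \<theta> ^ i) \<noteq> 0})"
  using T0.trace_zero by (auto simp: word_eq nonzeros_def split: if_splits)

text \<open>By \<open>card_nonzero_traces\<close> every nonzero entry before descent contributes the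
  same number of nonzero coordinates.\<close>

lemma weight_word:
  "real N * real (card {j. word k j \<noteq> 0}) = q * (real p - 1) / real p * real (card (nonzeros k))"
proof -
  have "real N * real (card {j. word k j \<noteq> 0}) =
      (\<Sum>z\<in>nonzeros k. real N * real (card {i\<in>{..<n}. Tr0 (val k z * \<theta> ^ i) \<noteq> 0}))"
    unfolding word_support by (subst card_SigmaI) (simp_all add: sum_distrib_left)
  also have "\<dots> = (\<Sum>z\<in>nonzeros k. q * (real p - 1) / real p)"
    by (rule sum.cong) (simp_all only: nonzeros_def mem_Collect_eq card_nonzero_traces not_False_eq_True)
  finally show ?thesis by simp
qed

text \<open>A word of weight 0 comes from a function \<open>val k\<close> that vanishes everywhere.
  The point \<open>(0, 0)\<close> then kills \<open>c\<close>, a point with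
  \<open>Q x \<noteq> 0\<close> kills \<open>a\<close>, and surjectivity of the trace kills
  \<open>b\<close>.\<close>

lemma inj_word: "inj word"
proof -
  have zero: "k = 0" if "word k = 0" for k
  proof -
    have "q * (real p - 1) / real p * real (card (nonzeros k)) = 0"
      unfolding weight_word[symmetric] by (simp add: that)
    moreover have "q * (real p - 1) / real p \<noteq> 0" using q_nonzero p_gt_1 by auto
    ultimately have "card (nonzeros k) = 0" by (metis mult_eq_0_iff of_nat_eq_0_iff)
    then have "nonzeros k = {}" by simp
    then have v: "val k z = 0" for z by (cases z) (auto simp: nonzeros_def)
    obtain a b c where k: "k = (a, b, c)" by (cases k)
    have "c = 0" using v[of "(0, 0)"] by (simp add: k val_def Q_0 T2.trace_zero)
    moreover obtain x where "Q x \<noteq> 0" using Q_nonzero by blast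
    then have "a = 0" using v[of "(x, 0)"] \<open>c = 0\<close> by (simp add: k val_def T2.trace_zero)
    moreover have "b = 0"
    proof (rule ccontr)
      assume "b \<noteq> 0"
      then obtain y where "Tr2 (b * y) = 1" using T2.surj_trace_mult by (metis surjD)
      then show False using v[of "(0, y)"] \<open>c = 0\<close> by (simp add: k val_def Q_0)
    qed
    ultimately show ?thesis by (simp add: k zero_prod_def)
  qed
  show ?thesis
  proof (rule injI)
    fix k k' assume "word k = word k'"
    then have "word (k - k') = 0" by (simp add: word_diff)
    from zero[OF this] show "k = k'" by simp
  qed
qed

lemma card_zeros: "real (card (nonzeros k)) = q * A * q ^ m2 - real (card {z. val k z = 0})"
proof -
  have "CARD('a \<times> 'b) = card ({z. val k z = 0} \<union> nonzeros k)"
    by (rule arg_cong[where f = card]) (auto simp: nonzeros_def)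
  also have "\<dots> = card {z. val k z = 0} + card (nonzeros k)"
    by (intro card_Un_disjoint) (auto simp: nonzeros_def)
  finally have "real CARD('a) * real CARD('b) = real (card {z. val k z = 0}) + real (card (nonzeros k))"
    by (simp flip: of_nat_mult of_nat_add)
  then show ?thesis by (simp add: real_card_a card_b)
qed

text \<open>For each \<open>x\<close> the zeros are a fibre of a trace map, and these fibres all
  have the same size; the values of \<open>Q\<close> have no influence.\<close>

lemma card_nonzeros_trace_part:
  assumes b: "b \<noteq> 0"
  shows "real (card (nonzeros (a, b, c))) = q ^ m2 * (A * (q - 1))"
proof -
  have fibre: "real (card {y. Tr2 (b * y) = v}) = q ^ m2 / q" for v
  proof -
    have "real (p ^ m * card {y. Tr2 (b * y) = v}) = q ^ m2"
      unfolding T2.card_trace_fibre[OF b] card_b by simp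
    then have "real (card {y. Tr2 (b * y) = v}) * q = q ^ m2" by (simp add: mult.commute)
    then show ?thesis by (rule iffD2[OF nonzero_eq_divide_eq[OF q_nonzero]])
  qed
  have "{z. val (a, b, c) z = 0} = (SIGMA x:UNIV. {y. Tr2 (b * y) = - (a * Q x + c)})"
  proof -
    have "a * Q x + Tr2 (b * y) + c = 0 \<longleftrightarrow> Tr2 (b * y) = - (a * Q x + c)" for x y
      by (metis (no_types) add.assoc add.commute eq_neg_iff_add_eq_0)
    then show ?thesis by (auto simp: val_def)
  qed
  then have "real (card {z. val (a, b, c) z = 0}) = real CARD('a) * (q ^ m2 / q)"
    by (simp add: fibre)
  also have "\<dots> = A * q ^ m2"
  proof -
    have "x * A * (y / x) = A * y" if "x \<noteq> 0" for x y :: real using that by simp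
    then show ?thesis unfolding real_card_a using q_nonzero .
  qed
  finally show ?thesis by (simp add: card_zeros algebra_simps)
qed

text \<open>Without \<open>b\<close> the value does not depend on \<open>y\<close>, hence the factor
  \<open>q ^ m2\<close>; the zeros in \<open>x\<close> are a level set of \<open>Q\<close> if
  \<open>a \<noteq> 0\<close>, and all or nothing otherwise.\<close>

lemma card_nonzeros_form_part:
  "real (card (nonzeros (a, 0, c))) = q ^ m2 * (q * A -
     (if a \<noteq> 0 then A + excess (- (c / a)) else if c = 0 then q * A else 0))"
proof -
  have "{z. val (a, 0, c) z = 0} = {x. a * Q x + c = 0} \<times> UNIV"
    by (auto simp: val_def T2.trace_zero)
  then have "real (card {z. val (a, 0, c) z = 0}) = real (card {x. a * Q x + c = 0}) * q ^ m2"
    by (simp add: card_cartesian_product card_b)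
  moreover have "real (card {x. a * Q x + c = 0}) =
      (if a \<noteq> 0 then A + excess (- (c / a)) else if c = 0 then q * A else 0)"
  proof (cases "a = 0")
    case True
    then show ?thesis using q_power_m1 card_a by simp
  next
    case False
    then have "a * u + c = 0 \<longleftrightarrow> u = - (c / a)" for u
      by (simp add: field_simps eq_neg_iff_add_eq_0)
    then show ?thesis using False by (simp add: excess_def)
  qed
  ultimately show ?thesis by (simp add: card_zeros algebra_simps)
qed

definition plane_part :: "('f \<times> 'b \<times> 'f) set \<Rightarrow> ('f \<times> 'f) set" where
  "plane_part K = {(a, c). (a, 0, c) \<in> K}"

lemma add_subgroup_plane_part: "add_subgroup K \<Longrightarrow> add_subgroup (plane_part K)"
proof -
  assume K: "add_subgroup K"
  have "(a - a', 0, c - c') \<in> K" if "(a, 0, c) \<in> K" "(a', 0, c') \<in> K" for a c a' c'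
    using add_subgroup_diff[OF K that] by simp
  then show ?thesis
    using add_subgroup_zero[OF K] by (auto simp: add_subgroup_def plane_part_def zero_prod_def)
qed

lemma card_b_zero: "card {k\<in>K. fst (snd k) = 0} = card (plane_part K)"
proof -
  have "{k\<in>K. fst (snd k) = 0} = (\<lambda>(a, c). (a, 0, c)) ` plane_part K"
    by (auto simp: plane_part_def image_iff)
  then show ?thesis by (simp add: card_image inj_on_def case_prod_unfold prod_eq_iff)
qed

lemma card_le_plane_part:
  assumes "add_subgroup K"
  shows "real (card K) \<le> q ^ m2 * real (card (plane_part K))"
proof -
  have "card K = card ((fst \<circ> snd) ` K) * card {k\<in>K. (fst \<circ> snd) k = 0}"
    by (rule card_additive_image[OF assms]) simp_all
  also have "\<dots> \<le> CARD('b) * card {k\<in>K. (fst \<circ> snd) k = 0}"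
    by (intro mult_right_mono card_mono) auto
  finally have "card K \<le> CARD('b) * card (plane_part K)" by (simp add: card_b_zero)
  then have "real (card K) \<le> real (CARD('b) * card (plane_part K))" by (simp only: of_nat_le_iff)
  then show ?thesis by (simp add: card_b)
qed

lemma card_plane_part_le: "card (plane_part K) \<le> card K"
  unfolding card_b_zero[symmetric] by (rule card_mono) auto

text \<open>Triples with \<open>b \<noteq> 0\<close> all contribute the same amount, so only the
  plane part distinguishes two subgroups of equal size.\<close>

lemma sum_card_nonzeros:
  assumes K: "add_subgroup K"
  shows "(\<Sum>k\<in>K. real (card (nonzeros k))) =
    q ^ m2 * (A * (q - 1) * (real (card K) - 1) - deficit excess A (plane_part K))"
proof -
  let ?G = "plane_part K"
  interpret G: plane_subgroup ?G q
    by unfold_locales (simp_all add: add_subgroup_plane_part[OF K] card_f)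
  \<comment> \<open>The number of \<open>x\<close> with \<open>a * Q x + c = 0\<close>, for
    \<open>z = (a, c)\<close>.\<close>
  let ?w = "\<lambda>z. if fst z \<noteq> 0 then A + excess (- (snd z / fst z)) else if snd z = 0 then q * A else 0"
  have "(\<Sum>z\<in>?G. ?w z) = (\<Sum>z\<in>{z\<in>?G. fst z \<noteq> 0}. ?w z) + (\<Sum>z\<in>{z\<in>?G. fst z = 0}. ?w z)"
    using sum_filter_split[of ?G ?w "\<lambda>z. fst z \<noteq> 0"] by simp
  also have "(\<Sum>z\<in>{z\<in>?G. fst z \<noteq> 0}. ?w z) = A * (G.g - G.g0) + ratio_sum excess ?G"
  proof -
    have "(\<Sum>z\<in>{z\<in>?G. fst z \<noteq> 0}. ?w z) = (\<Sum>z\<in>{z\<in>?G. fst z \<noteq> 0}. A + excess (- (snd z / fst z)))"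
      by (rule sum.cong) auto
    then show ?thesis by (simp add: sum.distrib G.card_fst_nonzero ratio_sum_def mult.commute)
  qed
  also have "(\<Sum>z\<in>{z\<in>?G. fst z = 0}. ?w z) = (\<Sum>z\<in>{z\<in>?G. fst z = 0}. if z = (0, 0) then q * A else 0)"
    by (rule sum.cong) (auto simp: prod_eq_iff)
  also have "\<dots> = q * A" using G.zero_in_G by simp
  finally have w: "(\<Sum>z\<in>?G. ?w z) = A * (G.g - G.g0) + ratio_sum excess ?G + q * A" .
  have cardK: "real (card K) = real (card {k\<in>K. fst (snd k) \<noteq> 0}) + G.g"
    using sum_filter_split[of K "\<lambda>_. 1 :: real" "\<lambda>k. fst (snd k) \<noteq> 0"] by (simp add: card_b_zero)
  have "(\<Sum>k\<in>K. real (card (nonzeros k))) =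
      (\<Sum>k\<in>{k\<in>K. fst (snd k) \<noteq> 0}. real (card (nonzeros k))) + (\<Sum>k\<in>{k\<in>K. fst (snd k) = 0}. real (card (nonzeros k)))"
    using sum_filter_split[of K "\<lambda>k. real (card (nonzeros k))" "\<lambda>k. fst (snd k) \<noteq> 0"] by simp
  also have "(\<Sum>k\<in>{k\<in>K. fst (snd k) \<noteq> 0}. real (card (nonzeros k))) =
      (\<Sum>k\<in>{k\<in>K. fst (snd k) \<noteq> 0}. q ^ m2 * (A * (q - 1)))"
    by (rule sum.cong) (auto simp: card_nonzeros_trace_part)
  also have "\<dots> = (real (card K) - G.g) * (q ^ m2 * (A * (q - 1)))" using cardK by simp
  also have "(\<Sum>k\<in>{k\<in>K. fst (snd k) = 0}. real (card (nonzeros k))) = (\<Sum>z\<in>?G. q ^ m2 * (q * A - ?w z))"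
  proof -
    have "{k\<in>K. fst (snd k) = 0} = (\<lambda>z. (fst z, 0, snd z)) ` ?G"
      by (auto simp: plane_part_def image_iff)
    moreover have "inj_on (\<lambda>z. (fst z, 0 :: 'b, snd z)) ?G" by (auto simp: inj_on_def prod_eq_iff)
    ultimately have "(\<Sum>k\<in>{k\<in>K. fst (snd k) = 0}. real (card (nonzeros k))) =
        (\<Sum>z\<in>?G. real (card (nonzeros (fst z, 0, snd z))))"
      by (simp only: sum.reindex o_def)
    then show ?thesis by (simp only: card_nonzeros_form_part)
  qed
  also have "\<dots> = q ^ m2 * (q * A * G.g - (A * (G.g - G.g0) + ratio_sum excess ?G + q * A))"
    unfolding sum_distrib_left[symmetric] sum_subtractf w by simp
  \<comment> \<open>The terms in \<open>G.g\<close> cancel, which leaves just the ratio sum and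
    \<open>G.g0\<close>.\<close>
  finally show ?thesis
    unfolding deficit_def by (simp only: ring_distribs mult_ac)
qed

text \<open>This joins the two double counts, \<open>card_supp_set\<close> and
  \<open>weight_word\<close>. For fixed size of \<open>K\<close> a larger deficit means a smaller
  support.\<close>

lemma card_supp_word:
  assumes K: "add_subgroup K" and sub: "module.subspace fscale (word ` K)"
  shows "real N * real (card (supp_set (word ` K))) * real (card K) =
    q ^ (m2 + 1) * (A * (q - 1) * (real (card K) - 1) - deficit excess A (plane_part K))"
proof -
  let ?S = "supp_set (word ` K)"
  have "?S \<subseteq> UNIV \<times> {..<n}"
    by (auto simp: supp_set_def word_eq split: if_splits)
  then have "finite ?S" by (rule finite_subset) simp
  then have "p * (\<Sum>v\<in>word ` K. card {j. v j \<noteq> 0}) = card ?S * (p - 1) * card (word ` K)"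
    using card_supp_set[OF sub] card_p by simp
  moreover have "card (word ` K) = card K"
    by (rule card_image[OF inj_on_subset[OF inj_word]]) simp
  moreover have "(\<Sum>v\<in>word ` K. card {j. v j \<noteq> 0}) = (\<Sum>k\<in>K. card {j. word k j \<noteq> 0})"
    by (subst sum.reindex[OF inj_on_subset[OF inj_word]]) simp_all
  ultimately have "real (p * (\<Sum>k\<in>K. card {j. word k j \<noteq> 0})) = real (card ?S * (p - 1) * card K)"
    by simp
  then have 1: "real p * (\<Sum>k\<in>K. real (card {j. word k j \<noteq> 0})) = real (card ?S) * (real p - 1) * real (card K)"
    using p_gt_1 by simp
  have "(real p - 1) * (real N * real (card ?S) * real (card K)) =
      real p * (\<Sum>k\<in>K. real N * real (card {j. word k j \<noteq> 0}))"
    using 1 by (simp add: mult_ac flip: sum_distrib_left)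
  also have "\<dots> = real p * (\<Sum>k\<in>K. q * (real p - 1) / real p * real (card (nonzeros k)))"
    by (simp only: weight_word)
  also have "\<dots> = (real p - 1) * (q * (\<Sum>k\<in>K. real (card (nonzeros k))))"
    unfolding sum_distrib_left[symmetric] using p_gt_1 by simp
  finally have "real N * real (card ?S) * real (card K) = q * (\<Sum>k\<in>K. real (card (nonzeros k)))"
    using p_gt_1 by simp
  then show ?thesis by (simp add: sum_card_nonzeros[OF K] mult.assoc)
qed

subsection \<open>Extremal subcodes\<close>

lemma sum_excess: "(\<Sum>t\<in>UNIV. excess t) = 0"
proof -
  have "(\<Sum>t\<in>(UNIV :: 'f set). card {x. Q x = t}) = CARD('a)"
    using sum.group[of "UNIV :: 'a set" "UNIV :: 'f set" Q "\<lambda>_. 1 :: nat"] by simp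
  then have "(\<Sum>t\<in>(UNIV :: 'f set). real (card {x. Q x = t})) = real CARD('a)"
    by (simp flip: of_nat_sum)
  also have "\<dots> = q * A" by (rule real_card_a)
  finally show ?thesis by (simp add: excess_def sum_subtractf card_f)
qed

text \<open>If \<open>S\<close> is trivial, every ratio equals \<open>t\<close>. If \<open>U\<close>
  is everything, the pairs with \<open>c = 0\<close> still give \<open>t\<close>, while each nonzero
  \<open>c\<close> makes the ratio run through all other values and so costs one
  \<open>excess t\<close>.\<close>

lemma deficit_extremal:
  assumes U: "add_subgroup U" and S: "add_subgroup S" and US: "U = UNIV \<or> S = {0}"
  shows "deficit excess A ((\<lambda>(a, c). (a, c - t * a)) ` (U \<times> S)) =
    (real (card U) - real (card S)) * excess t - A * (real (card S) - 1)"
proof -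
  let ?f = "\<lambda>(a, c). (a, c - t * a)"
  let ?G = "?f ` (U \<times> S)"
  have inj: "inj_on ?f X" for X by (auto simp: inj_on_def)
  have U0: "0 \<in> U" and S0: "0 \<in> S" using U S by (simp_all add: add_subgroup_zero)
  have "{z\<in>?G. fst z = 0} = ?f ` ({0} \<times> S)" using U0 by auto
  then have g0: "card {z\<in>?G. fst z = 0} = card S"
    by (simp only: card_image[OF inj] card_cartesian_product) simp
  have "{z\<in>?G. fst z \<noteq> 0} = ?f ` ((U - {0}) \<times> S)" by auto
  then have "ratio_sum excess ?G = (\<Sum>z\<in>(U - {0}) \<times> S. excess (- (snd (?f z) / fst (?f z))))"
    unfolding ratio_sum_def by (simp only: sum.reindex[OF inj] o_def)
  also have "\<dots> = (\<Sum>a\<in>U - {0}. \<Sum>c\<in>S. excess (t - c / a))"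
    unfolding sum.cartesian_product
  proof (rule sum.cong)
    fix z assume "z \<in> (U - {0}) \<times> S"
    then obtain a c where z: "z = (a, c)" "a \<noteq> 0" by blast
    then have "- ((c - t * a) / a) = t - c / a" by (simp add: diff_divide_distrib)
    then show "excess (- (snd (?f z) / fst (?f z))) = (case z of (a, c) \<Rightarrow> excess (t - c / a))"
      using z by simp
  qed simp
  also have "\<dots> = (real (card U) - real (card S)) * excess t"
    using US
  proof
    assume "S = {0}"
    moreover have "card U > 0" using U0 by (auto simp: card_gt_0_iff)
    ultimately show ?thesis using U0 by (simp add: card_Diff_singleton of_nat_diff)
  next
    assume UU: "U = UNIV"
    \<comment> \<open>As \<open>a\<close> runs through the nonzero elements,
      \<open>t - c / a\<close> takes each value except \<open>t\<close> once, and
      \<open>excess\<close> sums to 0.\<close>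
    have inner: "(\<Sum>a\<in>UNIV - {0}. excess (t - c / a)) = - excess t" if c: "c \<noteq> 0" for c
    proof -
      have "(\<Sum>a\<in>UNIV - {0}. excess (t - c / a)) = (\<Sum>s\<in>UNIV - {t}. excess s)"
        by (rule sum.reindex_bij_witness[of _ "\<lambda>s. c / (t - s)" "\<lambda>a. t - c / a"]) (use c in auto)
      also have "\<dots> = - excess t"
        using sum_excess by (simp add: sum_diff1)
      finally show ?thesis .
    qed
    have "(\<Sum>a\<in>U - {0}. \<Sum>c\<in>S. excess (t - c / a)) = (\<Sum>c\<in>S. \<Sum>a\<in>UNIV - {0}. excess (t - c / a))"
      unfolding UU by (rule sum.swap)
    also have "\<dots> = (\<Sum>a\<in>UNIV - {0 :: 'f}. excess t) + (\<Sum>c\<in>S - {0}. \<Sum>a\<in>UNIV - {0}. excess (t - c / a))"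
      by (subst sum.remove[OF _ S0]) simp_all
    also have "(\<Sum>c\<in>S - {0}. \<Sum>a\<in>UNIV - {0}. excess (t - c / a)) = (\<Sum>c\<in>S - {0}. - excess t)"
      by (rule sum.cong) (auto simp: inner)
    also have "(\<Sum>a\<in>UNIV - {0 :: 'f}. excess t) = (real (card U) - 1) * excess t"
    proof -
      have "1 \<le> p ^ m" using p_gt_1 by simp
      then show ?thesis using UU by (simp add: card_Diff_singleton card_f of_nat_diff)
    qed
    also have "(\<Sum>c\<in>S - {0}. - excess t) = (real (card S) - 1) * (- excess t)"
    proof -
      have "card S > 0" using S0 by (auto simp: card_gt_0_iff)
      then show ?thesis using S0 by (simp add: card_Diff_singleton of_nat_diff)
    qed
    finally show ?thesis by (simp add: algebra_simps)
  qed
  finally show ?thesis by (simp add: deficit_def g0)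
qed

text \<open>Over the prime field \<open>i\<close>, \<open>j\<close>, \<open>l\<close> are the
  dimensions of \<open>U\<close>, \<open>B\<close>, \<open>S\<close>. The shear by \<open>t\<close>
  moves the line \<open>c = 0\<close> to the line on which the ratio is \<open>t\<close>.\<close>

lemma ex_extremal_subcode:
  assumes i: "i \<le> m" and j: "j \<le> m * m2" and l: "l \<le> m" and il: "i = m \<or> l = 0"
  shows "\<exists>K \<subseteq> range word. module.subspace fscale K \<and> vector_space.dim fscale K = i + j + l \<and>
    real N * real (card (supp_set K)) * real (p ^ (i + j + l)) =
      q ^ (m2 + 1) * (A * (q - 1) * (real (p ^ (i + j + l)) - 1) -
        ((real (p ^ i) - real (p ^ l)) * excess t - A * (real (p ^ l) - 1)))"
proof -
  interpret V: vector_space "fscale :: 'p \<Rightarrow> (('a \<times> 'b) \<times> nat \<Rightarrow> 'p) \<Rightarrow> _" by (rule vector_space_fscale)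
  have cf: "CARD('f) = CARD('p) ^ m" by (simp add: card_f card_p)
  have cb: "CARD('b) = CARD('p) ^ (m * m2)" by (simp add: card_b card_p power_mult)
  obtain U where U: "add_subgroup U" "\<And>c x. x \<in> U \<Longrightarrow> \<iota>0 c * x \<in> U" "card U = p ^ i"
    using ex_subspace_of_card[OF hom0 cf i] card_p by auto
  obtain S where S: "add_subgroup S" "\<And>c x. x \<in> S \<Longrightarrow> \<iota>0 c * x \<in> S" "card S = p ^ l"
    using ex_subspace_of_card[OF hom0 cf l] card_p by auto
  obtain B where B: "add_subgroup B" "\<And>c x. x \<in> B \<Longrightarrow> \<iota>2 (\<iota>0 c) * x \<in> B" "card B = p ^ j"
    using ex_subspace_of_card[OF is_field_hom_comp[OF hom0 hom2] cb j] card_p by auto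
  \<comment> \<open>Sizes decide: \<open>i = m\<close> makes \<open>U\<close> everything and
    \<open>l = 0\<close> makes \<open>S\<close> trivial, as \<open>deficit_extremal\<close>
    requires.\<close>
  have US: "U = UNIV \<or> S = {0}"
    using il
  proof
    assume "i = m"
    then show ?thesis using U(3) card_f by (metis card_subset_eq finite subset_UNIV)
  next
    assume "l = 0"
    then have "card S = 1" using S(3) by simp
    then show ?thesis using add_subgroup_zero[OF S(1)] by (metis card_1_singletonE singletonD)
  qed
  let ?f = "\<lambda>(a, b :: 'b, c). (a, b, c - t * a)"
  define K where "K = ?f ` (U \<times> B \<times> S)"
  have mem: "(a, b, c) \<in> K \<longleftrightarrow> a \<in> U \<and> b \<in> B \<and> c + t * a \<in> S" for a b c
  proof
    assume "a \<in> U \<and> b \<in> B \<and> c + t * a \<in> S"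
    then show "(a, b, c) \<in> K" unfolding K_def by (intro image_eqI[of _ _ "(a, b, c + t * a)"]) auto
  qed (auto simp: K_def)
  have "inj_on ?f (U \<times> B \<times> S)" by (auto simp: inj_on_def)
  then have cardK: "card K = p ^ (i + j + l)"
    unfolding K_def by (simp add: card_image card_cartesian_product U B S power_add)
  have K: "add_subgroup K"
    unfolding add_subgroup_def
  proof (intro conjI ballI)
    show "0 \<in> K" by (simp add: zero_prod_def mem add_subgroup_zero U S B)
    fix k k' assume k: "k \<in> K" "k' \<in> K"
    obtain a b c a' b' c' where kk: "k = (a, b, c)" "k' = (a', b', c')" by (metis surj_pair)
    have "(c + t * a) - (c' + t * a') \<in> S"
      using k unfolding kk mem by (intro add_subgroup_diff[OF S(1)]) simp_all
    also have "(c + t * a) - (c' + t * a') = c - c' + t * (a - a')" by (simp add: algebra_simps)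
    finally have "c - c' + t * (a - a') \<in> S" .
    moreover have "a - a' \<in> U" "b - b' \<in> B"
      using k unfolding kk mem by (simp_all add: add_subgroup_diff U(1) B(1))
    ultimately show "k - k' \<in> K" by (simp only: kk mem diff_Pair simp_thms)
  qed
  have scale: "scale s k \<in> K" if "k \<in> K" for s k
  proof -
    obtain a b c where k: "k = (a, b, c)" by (metis surj_pair)
    have "\<iota>0 s * c + t * (\<iota>0 s * a) = \<iota>0 s * (c + t * a)" by (simp add: algebra_simps)
    then show ?thesis using that U(2) B(2) S(2) by (simp add: scale_def k mem)
  qed
  have sub: "V.subspace (word ` K)"
    unfolding V.subspace_def
  proof (intro conjI ballI allI)
    have "word 0 = 0" using word_diff[of 0 0] by simp
    then show "0 \<in> word ` K"
      by (intro image_eqI[where x = 0] add_subgroup_zero[OF K]) (rule sym)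
  next
    fix x y assume "x \<in> word ` K" "y \<in> word ` K"
    then obtain k k' where k: "k \<in> K" "k' \<in> K" "x = word k" "y = word k'" by blast
    have "word (k + k') = word k + word k'" using word_diff[of "k + k'" k'] by (simp add: algebra_simps)
    then show "x + y \<in> word ` K"
      by (intro image_eqI[where x = "k + k'"] add_subgroup_add[OF K k(1,2)]) (simp add: k)
  next
    fix s x assume "x \<in> word ` K"
    then obtain k where k: "k \<in> K" "x = word k" by blast
    show "fscale s x \<in> word ` K"
      by (rule image_eqI[where x = "scale s k"]) (simp_all add: k scale word_scale)
  qed
  \<comment> \<open>The dimension is recovered from the cardinality, a power of
    \<open>p\<close>.\<close>
  have "card (word ` K) = card K"
    by (rule card_image[OF inj_on_subset[OF inj_word]]) simp
  moreover have "card (word ` K) = p ^ V.dim (word ` K)"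
    using V.card_finite_subspace[OF sub] card_p by simp
  ultimately have "V.dim (word ` K) = i + j + l"
    using cardK p_gt_1 by simp
  moreover have "plane_part K = (\<lambda>(a, c). (a, c - t * a)) ` (U \<times> S)"
  proof (intro equalityI subsetI)
    fix z assume "z \<in> plane_part K"
    then have "fst z \<in> U" "snd z + t * fst z \<in> S" by (auto simp: plane_part_def mem)
    then show "z \<in> (\<lambda>(a, c). (a, c - t * a)) ` (U \<times> S)"
      by (intro image_eqI[of _ _ "(fst z, snd z + t * fst z)"]) auto
  qed (auto simp: plane_part_def mem add_subgroup_zero[OF B(1)])
  then have "deficit excess A (plane_part K) =
      (real (p ^ i) - real (p ^ l)) * excess t - A * (real (p ^ l) - 1)"
    using deficit_extremal[OF U(1) S(1) US, of t] by (simp add: U S)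
  then have "real N * real (card (supp_set (word ` K))) * real (p ^ (i + j + l)) =
      q ^ (m2 + 1) * (A * (q - 1) * (real (p ^ (i + j + l)) - 1) -
        ((real (p ^ i) - real (p ^ l)) * excess t - A * (real (p ^ l) - 1)))"
    using card_supp_word[OF K sub] cardK by simp
  ultimately show ?thesis using sub by (intro exI[of _ "word ` K"]) auto
qed

text \<open>\<open>G\<close> is the plane part of the preimage under \<open>word\<close>. It is the
  kernel of the projection to \<open>b\<close>, which takes at most \<open>q ^ m2\<close> values;
  this gives the lower bound on its size.\<close>

lemma card_supp_subcode:
  assumes KC: "K \<subseteq> range word" and sub: "module.subspace fscale K" and dim: "vector_space.dim fscale K = r"
  obtains G where "add_subgroup G" "real (card G) \<le> real (p ^ r)" "real (p ^ r) \<le> q ^ m2 * real (card G)"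
    "real N * real (card (supp_set K)) * real (p ^ r) =
      q ^ (m2 + 1) * (A * (q - 1) * (real (p ^ r) - 1) - deficit excess A G)"
proof -
  interpret V: vector_space "fscale :: 'p \<Rightarrow> (('a \<times> 'b) \<times> nat \<Rightarrow> 'p) \<Rightarrow> _" by (rule vector_space_fscale)
  define L where "L = word -` K"
  have img: "word ` L = K" using KC by (auto simp: L_def)
  have finK: "finite K" using KC by (rule finite_subset) simp
  have L: "add_subgroup L"
    unfolding add_subgroup_def
  proof (intro conjI ballI)
    have "word 0 = 0" using word_diff[of 0 0] by simp
    then show "0 \<in> L" using V.subspace_0[OF sub] by (simp add: L_def)
  qed (use V.subspace_diff[OF sub] in \<open>auto simp: L_def word_diff\<close>)
  have "card K = card L"
    unfolding img[symmetric] by (rule card_image[OF inj_on_subset[OF inj_word]]) simp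
  moreover have "card K = p ^ r"
    using V.card_finite_subspace[OF sub finK] card_p dim by simp
  ultimately have cardL: "card L = p ^ r" by simp
  show ?thesis
  proof (rule that[of "plane_part L"])
    show "add_subgroup (plane_part L)" by (rule add_subgroup_plane_part[OF L])
    show "real (card (plane_part L)) \<le> real (p ^ r)"
      using card_plane_part_le[of L] cardL by (simp only: of_nat_le_iff)
    show "real (p ^ r) \<le> q ^ m2 * real (card (plane_part L))"
      using card_le_plane_part[OF L] cardL by (simp only:)
    show "real N * real (card (supp_set K)) * real (p ^ r) =
      q ^ (m2 + 1) * (A * (q - 1) * (real (p ^ r) - 1) - deficit excess A (plane_part L))"
      using card_supp_word[OF L] sub cardL img by simp
  qed
qed

text \<open>The subcode built from \<open>i\<close>, \<open>j\<close>, \<open>l\<close> has deficit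
  \<open>D\<close>, so it is optimal once no admissible \<open>G\<close> has a larger
  deficit.\<close>

lemma gen_weight_eqI:
  assumes ijl: "i \<le> m" "j \<le> m * m2" "l \<le> m" "i = m \<or> l = 0" "r = i + j + l"
    and D: "D = (real (p ^ i) - real (p ^ l)) * excess t - A * (real (p ^ l) - 1)"
    and bound: "\<And>G. add_subgroup G \<Longrightarrow> real (card G) \<le> real (p ^ r) \<Longrightarrow>
      real (p ^ r) \<le> q ^ m2 * real (card G) \<Longrightarrow> deficit excess A G \<le> D"
  shows "real N * real (gen_weight (range word) r) * real (p ^ r) =
      q ^ (m2 + 1) * (A * (q - 1) * (real (p ^ r) - 1) - D)"
proof -
  obtain K where K: "K \<subseteq> range word" "module.subspace fscale K" "vector_space.dim fscale K = r"
    and w: "real N * real (card (supp_set K)) * real (p ^ r) = q ^ (m2 + 1) * (A * (q - 1) * (real (p ^ r) - 1) - D)"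
    using ex_extremal_subcode[OF ijl(1-4), of t] unfolding ijl(5) D by blast
  have "gen_weight (range word) r = card (supp_set K)"
    unfolding gen_weight_def
  proof (rule Min_eqI)
    have "{K. K \<subseteq> range word \<and> module.subspace fscale K \<and> vector_space.dim fscale K = r} \<subseteq> Pow (range word)"
      by auto
    then have "finite {K. K \<subseteq> range word \<and> module.subspace fscale K \<and> vector_space.dim fscale K = r}"
      by (rule finite_subset) simp
    then show "finite {card (supp_set K) |K. K \<subseteq> range word \<and> module.subspace fscale K \<and> vector_space.dim fscale K = r}"
      by simp
    show "card (supp_set K) \<in> {card (supp_set K) |K. K \<subseteq> range word \<and> module.subspace fscale K \<and> vector_space.dim fscale K = r}"
      using K by blast
  next
    fix y assume "y \<in> {card (supp_set K) |K. K \<subseteq> range word \<and> module.subspace fscale K \<and> vector_space.dim fscale K = r}"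
    then obtain K' where y: "y = card (supp_set K')" and K': "K' \<subseteq> range word" "module.subspace fscale K'"
      "vector_space.dim fscale K' = r" by blast
    obtain G where G: "add_subgroup G" "real (card G) \<le> real (p ^ r)" "real (p ^ r) \<le> q ^ m2 * real (card G)"
      "real N * real (card (supp_set K')) * real (p ^ r) =
        q ^ (m2 + 1) * (A * (q - 1) * (real (p ^ r) - 1) - deficit excess A G)"
      by (rule card_supp_subcode[OF K'])
    have "real N * real (card (supp_set K)) * real (p ^ r) \<le> real N * real y * real (p ^ r)"
      unfolding w y G(4) using bound[OF G(1-3)] q_gt_1 by (intro mult_left_mono) auto
    then have "real (card (supp_set K)) * (real N * real (p ^ r)) \<le> real y * (real N * real (p ^ r))"
      by (simp only: mult_ac)
    moreover have "real N * real (p ^ r) > 0" using N(1) p_gt_1 by simp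
    ultimately have "real (card (supp_set K)) \<le> real y" by (rule mult_right_le_imp_le)
    then show "card (supp_set K) \<le> y" by (simp only: of_nat_le_iff)
  qed
  then show ?thesis using w by simp
qed

text \<open>As \<open>r\<close> grows, \<open>U\<close> is filled first, then \<open>B\<close>, then
  \<open>S\<close>: the dimensions are \<open>(r, 0, 0)\<close>, then \<open>(m, r - m, 0)\<close>,
  then \<open>(m, m * m2, r - m * (m2 + 1))\<close>.\<close>

lemma gen_weight_ranges:
  assumes M: "excess t = M" "M \<ge> 0"
    and bounded: "\<And>G. add_subgroup G \<Longrightarrow> plane_subgroup.deficit_bounded G q excess A M"
  shows "1 \<le> r \<Longrightarrow> r \<le> m \<Longrightarrow> real N * real (gen_weight (range word) r) * real p ^ r =
      q ^ (m2 + 1) * (A * (q - 1) * (real p ^ r - 1) - (real p ^ r - 1) * M)" (is "_ \<Longrightarrow> _ \<Longrightarrow> ?R1")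
    and "m < r \<Longrightarrow> r \<le> m * (m2 + 1) \<Longrightarrow> real N * real (gen_weight (range word) r) * real p ^ r =
      q ^ (m2 + 1) * (A * (q - 1) * (real p ^ r - 1) - (q - 1) * M)" (is "_ \<Longrightarrow> _ \<Longrightarrow> ?R2")
    and "m * (m2 + 1) < r \<Longrightarrow> r \<le> m * (m2 + 2) \<Longrightarrow> real N * real (gen_weight (range word) r) * real p ^ r =
      q ^ (m2 + 1) * (A * (q - 1) * (real p ^ r - 1) -
        ((q - real p ^ (r - m * (m2 + 1))) * M - A * (real p ^ (r - m * (m2 + 1)) - 1)))" (is "_ \<Longrightarrow> _ \<Longrightarrow> ?R3")
proof -
  have bd: "deficit excess A G \<le> (real (card G) - 1) * M" "deficit excess A G \<le> (q - 1) * M"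
    "\<And>P. P \<ge> 1 \<Longrightarrow> q * P \<le> real (card G) \<Longrightarrow> deficit excess A G \<le> (q - P) * M - A * (P - 1)"
    if "add_subgroup G" for G
  proof -
    interpret plane_subgroup G q by unfold_locales (simp_all add: that card_f)
    note b = bounded[OF that, unfolded deficit_bounded_def]
    show "deficit excess A G \<le> (real (card G) - 1) * M" "deficit excess A G \<le> (q - 1) * M"
      by (rule b[THEN conjunct1], rule b[THEN conjunct2, THEN conjunct1])
    show "deficit excess A G \<le> (q - P) * M - A * (P - 1)" if "P \<ge> 1" "q * P \<le> real (card G)" for P
      by (rule b[THEN conjunct2, THEN conjunct2, rule_format, OF that])
  qed
  show ?R1 if r: "1 \<le> r" "r \<le> m"
  proof -
    have "real N * real (gen_weight (range word) r) * real (p ^ r) =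
        q ^ (m2 + 1) * (A * (q - 1) * (real (p ^ r) - 1) - (real (p ^ r) - 1) * M)"
    proof (rule gen_weight_eqI[of r 0 0 r _ t])
      fix G :: "('f \<times> 'f) set" assume G: "add_subgroup G" "real (card G) \<le> real (p ^ r)"
      have "(real (card G) - 1) * M \<le> (real (p ^ r) - 1) * M"
        using G(2) M(2) by (intro mult_right_mono) auto
      then show "deficit excess A G \<le> (real (p ^ r) - 1) * M" using bd(1)[OF G(1)] by linarith
    qed (use r M in auto)
    then show ?thesis by simp
  qed
  show ?R2 if r: "m < r" "r \<le> m * (m2 + 1)"
  proof -
    have "real N * real (gen_weight (range word) r) * real (p ^ r) =
        q ^ (m2 + 1) * (A * (q - 1) * (real (p ^ r) - 1) - (q - 1) * M)"
      by (rule gen_weight_eqI[of m "r - m" 0 r _ t]) (use r M bd(2) in auto)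
    then show ?thesis by simp
  qed
  show ?R3 if r: "m * (m2 + 1) < r" "r \<le> m * (m2 + 2)"
  proof -
    let ?s = "r - m * (m2 + 1)"
    have "real N * real (gen_weight (range word) r) * real (p ^ r) =
        q ^ (m2 + 1) * (A * (q - 1) * (real (p ^ r) - 1) - ((q - real (p ^ ?s)) * M - A * (real (p ^ ?s) - 1)))"
    proof (rule gen_weight_eqI[of m "m * m2" ?s r _ t])
      fix G :: "('f \<times> 'f) set" assume G: "add_subgroup G" "real (p ^ r) \<le> q ^ m2 * real (card G)"
      \<comment> \<open>The exponent is split so that the size condition becomes
        \<open>q * P \<le> card G\<close> with \<open>P = p ^ ?s\<close>, as the third bound
        demands.\<close>
      have "p ^ r = p ^ (m * m2 + (m + ?s))" using r by simp
      also have "\<dots> = (p ^ m) ^ m2 * (p ^ m * p ^ ?s)" by (simp only: power_add power_mult)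
      finally have "q ^ m2 * (q * real (p ^ ?s)) \<le> q ^ m2 * real (card G)" using G(2) by simp
      then have "q * real (p ^ ?s) \<le> real (card G)" using q_gt_1 p_gt_1 by simp
      moreover have "real (p ^ ?s) \<ge> 1" using p_gt_1 by (simp add: one_le_power)
      ultimately show "deficit excess A G \<le> (q - real (p ^ ?s)) * M - A * (real (p ^ ?s) - 1)"
        using bd(3)[OF G(1)] by blast
    qed (use r M in auto)
    then show ?thesis by simp
  qed
qed

text \<open>Here \<open>\<mu>\<close> is the maximal excess relative to the mean \<open>A\<close>.
  Factoring out \<open>A\<close> turns \<open>q ^ (m2 + 1)\<close> into the length
  \<open>q ^ (m1 + m2)\<close> of the code before descent.\<close>

lemma gen_weight_closed_form:
  assumes \<mu>: "excess t = A * \<mu>" "\<mu> \<ge> 0"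
    and bounded: "\<And>G. add_subgroup G \<Longrightarrow> plane_subgroup.deficit_bounded G q excess A (A * \<mu>)"
  shows "1 \<le> r \<Longrightarrow> r \<le> m \<Longrightarrow> real (gen_weight (range word) r) =
      q ^ (m1 + m2) / (real p ^ r * real N) * ((real p ^ r - 1) * (q - 1 - \<mu>))" (is "_ \<Longrightarrow> _ \<Longrightarrow> ?R1")
    and "m < r \<Longrightarrow> r \<le> m * (m2 + 1) \<Longrightarrow> real (gen_weight (range word) r) =
      q ^ (m1 + m2) / (real p ^ r * real N) * ((q - 1) * (real p ^ r - 1 - \<mu>))" (is "_ \<Longrightarrow> _ \<Longrightarrow> ?R2")
    and "m * (m2 + 1) < r \<Longrightarrow> r \<le> m * (m2 + 2) \<Longrightarrow> real (gen_weight (range word) r) =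
      q ^ (m1 + m2) / (real p ^ r * real N) *
        (real p ^ r * (q - 1) - (q - real p ^ (r - m * (m2 + 1))) * (1 + \<mu>))" (is "_ \<Longrightarrow> _ \<Longrightarrow> ?R3")
proof -
  have "A \<ge> 0" by (simp add: A_def)
  then have M: "A * \<mu> \<ge> 0" using \<mu>(2) by simp
  note ranges = gen_weight_ranges[OF \<mu>(1) M bounded]
  have W: "q ^ (m2 + 1) * A = q ^ (m1 + m2)"
    unfolding A_def power_add[symmetric] using m1 by (simp add: add.commute)
  have solve: "w = q ^ (m1 + m2) / (real p ^ r * real N) * Y"
    if "real N * w * real p ^ r = q ^ (m2 + 1) * X" "X = A * Y" for w X Y
  proof -
    have "w * (real p ^ r * real N) = q ^ (m1 + m2) * Y"
      using that by (simp add: mult_ac flip: W)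
    moreover have "real p ^ r * real N \<noteq> 0" using p_gt_1 N(1) by simp
    ultimately show ?thesis by (metis nonzero_mult_div_cancel_right times_divide_eq_left)
  qed
  show ?R1 if "1 \<le> r" "r \<le> m"
    by (rule solve[OF ranges(1)[OF _ that]]) (simp_all only: ring_distribs mult_ac)
  show ?R2 if "m < r" "r \<le> m * (m2 + 1)"
    by (rule solve[OF ranges(2)[OF _ that]]) (simp_all add: algebra_simps)
  show ?R3 if "m * (m2 + 1) < r" "r \<le> m * (m2 + 2)"
    by (rule solve[OF ranges(3)[OF _ that]]) (simp_all add: algebra_simps)
qed

end

section \<open>The three cases: even rank with either sign, and odd rank\<close>

theorem theorem6:
  fixes \<iota>0 :: "'p::{field,finite} \<Rightarrow> 'f::{field,finite}"
    and \<iota>1 :: "'f \<Rightarrow> 'a::{field,finite}"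
    and \<iota>2 :: "'f \<Rightarrow> 'b::{field,finite}"
    and Q :: "'a \<Rightarrow> 'f" and \<theta> :: 'f
    and p m m1 m2 N r :: nat
  defines "q \<equiv> p ^ m"
  defines "M \<equiv> m1 + m2"
  defines "rQ \<equiv> rank_qf \<iota>1 Q m1"
  defines "\<epsilon> \<equiv> eps_sign \<iota>1 Q p m m1"
  defines "C \<equiv> code_QN \<iota>0 \<iota>1 \<iota>2 Q p m m2 N \<theta>"
  defines "R \<equiv> m * (m2 + 1)"
  assumes "prime p" and "odd p" and "m \<ge> 1" and "m1 \<ge> 1" and "m2 \<ge> 1"
    and "CARD('p) = p" and "CARD('f) = q" and "CARD('a) = q ^ m1" and "CARD('b) = q ^ m2"
    and "is_field_hom \<iota>0" and "is_field_hom \<iota>1" and "is_field_hom \<iota>2"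
    and "is_quadratic_form \<iota>1 Q" and "\<exists>x. Q x \<noteq> 0"
    and "N > 0" and "N dvd (p - 1)" and "coprime N ((q - 1) div (p - 1))"
    and "\<theta> ^ ((q - 1) div N) = 1" and "\<forall>k. 0 < k \<and> k < (q - 1) div N \<longrightarrow> \<theta> ^ k \<noteq> 1"
    and "1 \<le> r" and "r \<le> m * (m2 + 2)"
  shows
   "(even rQ \<and> \<epsilon> = 1 \<longrightarrow>
      (r \<le> m \<longrightarrow> real (gen_weight C r) =
          real q ^ M * (real q - 1) / (real p ^ r * real N) * (real p ^ r - 1) * (1 - 1 / real q ^ (rQ div 2))) \<and>
      (m < r \<and> r \<le> R \<longrightarrow> real (gen_weight C r) =
          real q ^ M * (real q - 1) / (real p ^ r * real N) * (real p ^ r - 1 - (real q - 1) / real q ^ (rQ div 2))) \<and>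
      (R < r \<longrightarrow> real (gen_weight C r) =
          real q ^ M / (real p ^ r * real N) *
            (real p ^ r * (real q - 1) - (real q - real p ^ (r - R)) * (1 + (real q - 1) / real q ^ (rQ div 2))))) \<and>
    (even rQ \<and> \<epsilon> = -1 \<longrightarrow>
      (r \<le> m \<longrightarrow> real (gen_weight C r) =
          real q ^ M / (real p ^ r * real N) * (real p ^ r - 1) * (real q - 1 - 1 / real q ^ (rQ div 2))) \<and>
      (m < r \<and> r \<le> R \<longrightarrow> real (gen_weight C r) =
          real q ^ M * (real q - 1) / (real p ^ r * real N) * (real p ^ r - 1 - 1 / real q ^ (rQ div 2))) \<and>
      (R < r \<longrightarrow> real (gen_weight C r) =
          real q ^ M / (real p ^ r * real N) *
            (real p ^ r * (real q - 1) - (real q - real p ^ (r - R)) * (1 + 1 / real q ^ (rQ div 2))))) \<and>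
    (odd rQ \<longrightarrow>
      (r \<le> m \<longrightarrow> real (gen_weight C r) =
          real q ^ M / (real p ^ r * real N) * (real p ^ r - 1) * (real q - 1 - 1 / real q ^ ((rQ - 1) div 2))) \<and>
      (m < r \<and> r \<le> R \<longrightarrow> real (gen_weight C r) =
          real q ^ M * (real q - 1) / (real p ^ r * real N) * (real p ^ r - 1 - 1 / real q ^ ((rQ - 1) div 2))) \<and>
      (R < r \<longrightarrow> real (gen_weight C r) =
          real q ^ M / (real p ^ r * real N) *
            (real p ^ r * (real q - 1) - (real q - real p ^ (r - R)) * (1 + 1 / real q ^ ((rQ - 1) div 2)))))"
proof -
  obtain h where h: "CARD('f) = 2 * h + 1"
    using \<open>odd p\<close> \<open>CARD('f) = q\<close> unfolding q_def by (metis even_power oddE)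
  interpret F: quadratic_form \<iota>1 Q h m1
    using \<open>is_field_hom \<iota>1\<close> \<open>is_quadratic_form \<iota>1 Q\<close> h \<open>CARD('a) = q ^ m1\<close> \<open>CARD('f) = q\<close>
    by unfold_locales simp_all
  have "Q 0 = 0" using F.form_eq_bilin[of 0] F.bilin_zero by simp
  interpret D: code_setup \<iota>0 p m N \<theta> \<iota>2 Q m1 m2
    by unfold_locales (use assms(7-) \<open>Q 0 = 0\<close> in \<open>simp_all add: q_def\<close>)
  have C: "C = range D.word"
    unfolding C_def code_QN_def D.word_def ..
  have CARD_f: "real CARD('f) = real q" using \<open>CARD('f) = q\<close> by simp
  have real_q: "real q = real p ^ m" by (simp add: q_def)
  have A: "D.A = real q ^ (m1 - 1)" by (simp add: D.A_def q_def)
  have q1: "real q > 1" using D.q_gt_1 by (simp add: q_def)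
  have A0: "D.A \<ge> 0" by (simp add: A)
  have bounded_plane: "plane_subgroup G (real p ^ m)" if "add_subgroup G" for G :: "('f \<times> 'f) set"
    using that CARD_f by unfold_locales (simp_all add: q_def)
  \<comment> \<open>The condition \<open>q * d \<le> A\<close> of the even cases for
    \<open>d = A / q ^ k\<close>; it holds because the even rank is positive.\<close>
  have small: "real q * (D.A * (1 / real q ^ k)) \<le> D.A" if "k \<ge> 1" for k
  proof -
    have "real q ^ 1 \<le> real q ^ k" using q1 that by (intro power_increasing) auto
    then have "real q * (1 / real q ^ k) \<le> 1" using q1 by simp
    then have "D.A * (real q * (1 / real q ^ k)) \<le> D.A * 1" using A0 by (rule mult_left_mono)
    then show ?thesis by (simp add: mult_ac)
  qed
  have even_case: "D.excess t = \<epsilon> * (D.A * (1 / real q ^ (rQ div 2)) * zero_weight t)" "rQ div 2 \<ge> 1"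
    if "even rQ" for t
  proof -
    have rank: "rank_qf \<iota>1 Q m1 = 2 * (rQ div 2)" using that by (simp add: rQ_def)
    have "CARD('f) = p ^ m" using \<open>CARD('f) = q\<close> by (simp add: q_def)
    note * = F.card_level_set_even_rank[OF \<open>odd p\<close> this rank \<open>\<exists>x. Q x \<noteq> 0\<close>]
    show "rQ div 2 \<ge> 1" by (rule *(1))
    show "D.excess t = \<epsilon> * (D.A * (1 / real q ^ (rQ div 2)) * zero_weight t)"
      unfolding D.excess_def *(2) CARD_f A \<epsilon>_def by simp
  qed
  show ?thesis
  proof (intro conjI impI)
    assume e: "even rQ \<and> \<epsilon> = 1"
    let ?i = "1 / real q ^ (rQ div 2)"
    have ex: "D.excess = (\<lambda>t. (D.A * ?i) * real_of_int (zero_weight t))"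
      using even_case e by auto
    \<comment> \<open>With sign 1 the largest level set is the zero set of \<open>Q\<close>.\<close>
    have \<mu>: "D.excess 0 = D.A * ((real q - 1) * ?i)" "(real q - 1) * ?i \<ge> 0"
      using q1 CARD_f by (simp_all add: ex zero_weight_def)
    have b: "plane_subgroup.deficit_bounded G (real p ^ m) D.excess D.A (D.A * ((real q - 1) * ?i))"
      if "add_subgroup G" for G
    proof -
      interpret plane_subgroup G "real p ^ m" by (rule bounded_plane[OF that])
      show ?thesis
        using deficit_bounded_plus[of "D.A * ?i" D.A] small[of "rQ div 2"] even_case(2) e A0
        by (simp add: ex q_def mult_ac)
    qed
    note res = D.gen_weight_closed_form[OF \<mu> b]
    show "real (gen_weight C r) = real q ^ M * (real q - 1) / (real p ^ r * real N) * (real p ^ r - 1) * (1 - ?i)"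
      if "r \<le> m"
    proof -
      have "real q - 1 - (real q - 1) * ?i = (real q - 1) * (1 - ?i)"
        by (simp only: right_diff_distrib mult_1_right)
      then show ?thesis
        using res(1)[OF _ \<open>1 \<le> r\<close> that] unfolding C M_def real_q[symmetric] by simp
    qed
    show "real (gen_weight C r) = real q ^ M * (real q - 1) / (real p ^ r * real N) *
        (real p ^ r - 1 - (real q - 1) / real q ^ (rQ div 2))"
      if "m < r \<and> r \<le> R"
      using res(2)[of r] that unfolding C M_def R_def
      by (simp add: q_def)
    show "real (gen_weight C r) = real q ^ M / (real p ^ r * real N) *
        (real p ^ r * (real q - 1) - (real q - real p ^ (r - R)) * (1 + (real q - 1) / real q ^ (rQ div 2)))"
      if "R < r"
      using res(3)[of r] that \<open>r \<le> m * (m2 + 2)\<close> unfolding C M_def R_def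
      by (simp add: q_def)
  next
    assume e: "even rQ \<and> \<epsilon> = - 1"
    let ?i = "1 / real q ^ (rQ div 2)"
    have ex: "D.excess = (\<lambda>t. (- (D.A * ?i)) * real_of_int (zero_weight t))"
      using even_case e by auto
    \<comment> \<open>With sign -1 all nonzero values are equally frequent and beat 0; the value 1
      represents them.\<close>
    have \<mu>: "D.excess 1 = D.A * ?i" "?i \<ge> 0"
      by (simp_all add: ex zero_weight_def)
    have b: "plane_subgroup.deficit_bounded G (real p ^ m) D.excess D.A (D.A * ?i)"
      if "add_subgroup G" for G
    proof -
      interpret plane_subgroup G "real p ^ m" by (rule bounded_plane[OF that])
      show ?thesis
        using deficit_bounded_minus[of "D.A * ?i" D.A] small[of "rQ div 2"] even_case(2) e A0
        by (simp add: ex q_def)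
    qed
    note res = D.gen_weight_closed_form[OF \<mu> b]
    show "real (gen_weight C r) = real q ^ M / (real p ^ r * real N) * (real p ^ r - 1) * (real q - 1 - ?i)"
      if "r \<le> m"
      using res(1)[OF _ \<open>1 \<le> r\<close> that] unfolding C M_def by (simp add: q_def)
    show "real (gen_weight C r) = real q ^ M * (real q - 1) / (real p ^ r * real N) * (real p ^ r - 1 - ?i)"
      if "m < r \<and> r \<le> R"
      using res(2)[of r] that unfolding C M_def R_def by (simp add: q_def)
    show "real (gen_weight C r) = real q ^ M / (real p ^ r * real N) *
        (real p ^ r * (real q - 1) - (real q - real p ^ (r - R)) * (1 + ?i))"
      if "R < r"
      using res(3)[of r] that \<open>r \<le> m * (m2 + 2)\<close> unfolding C M_def R_def by (simp add: q_def)
  next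
    assume o: "odd rQ"
    let ?k = "(rQ - 1) div 2"
    let ?i = "1 / real q ^ ?k"
    have "rank_qf \<iota>1 Q m1 = 2 * ?k + 1" using o by (simp add: rQ_def)
    from F.card_level_set_odd_rank[OF this] obtain z where z: "z \<noteq> 0"
      and level: "\<And>t. real (card {x. Q x = t}) = real CARD('f) ^ (m1 - 1) +
        real_of_int (quad_char (z * t)) * (real CARD('f) ^ (m1 - 1) / real CARD('f) ^ ?k)"
      by blast
    have ex: "D.excess = (\<lambda>t. (D.A * ?i) * real_of_int (quad_char (z * t)))"
      unfolding D.excess_def level CARD_f A by auto
    \<comment> \<open>The maximum occurs where \<open>z * t\<close> is a nonzero square;
      \<open>t = 1 / z\<close> makes it 1.\<close>
    have \<mu>: "D.excess (1 / z) = D.A * ?i" "?i \<ge> 0"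
      using z by (simp_all add: ex quad_char_1[OF h])
    have sum0: "(\<Sum>t\<in>UNIV. real_of_int (quad_char (z * t))) = 0"
      by (simp add: quad_char_mult[OF h] sum_quad_char[OF h] flip: sum_distrib_left of_int_sum)
    have b: "plane_subgroup.deficit_bounded G (real p ^ m) D.excess D.A (D.A * ?i)"
      if "add_subgroup G" for G
    proof -
      interpret plane_subgroup G "real p ^ m" by (rule bounded_plane[OF that])
      show ?thesis
        unfolding ex using A0
        by (intro deficit_bounded_character sum0) (auto simp: quad_char_def)
    qed
    note res = D.gen_weight_closed_form[OF \<mu> b]
    show "real (gen_weight C r) = real q ^ M / (real p ^ r * real N) * (real p ^ r - 1) * (real q - 1 - ?i)"
      if "r \<le> m"
      using res(1)[OF _ \<open>1 \<le> r\<close> that] unfolding C M_def by (simp add: q_def)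
    show "real (gen_weight C r) = real q ^ M * (real q - 1) / (real p ^ r * real N) * (real p ^ r - 1 - ?i)"
      if "m < r \<and> r \<le> R"
      using res(2)[of r] that unfolding C M_def R_def by (simp add: q_def)
    show "real (gen_weight C r) = real q ^ M / (real p ^ r * real N) *
        (real p ^ r * (real q - 1) - (real q - real p ^ (r - R)) * (1 + ?i))"
      if "R < r"
      using res(3)[of r] that \<open>r \<le> m * (m2 + 2)\<close> unfolding C M_def R_def by (simp add: q_def)
  qed
qed

end
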